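(* Let $X$ be a complex Banach space, let $T\in B(X)$ be a decomposable operator, and let $S\in B(X)$ commute with $T$. Suppose that at least one of the following holds: (1) $S$ is quasinilpotent; (2) $S$ is compact; (3) $S$ has discrete spectrum. Then $T+S$ is decomposable. In particular, $T+S$ has the decomposition property $(\delta)$.
   Context: $B(X)$ is the Banach algebra of bounded linear operators on $X$. An operator $T\in B(X)$ is decomposable if for every open cover $\{U,V\}$ of $\mathbb{C}$ there are closed $T$-invariant subspaces $Y,Z\subset X$ with $X=Y+Z$, $\sigma(T|_Y)\subset U$ and $\sigma(T|_Z)\subset V$. Equivalently (well known), $T$ has both Bishop's property $(\beta)$ and the decomposition property $(\delta)$, where: $T$ has property $(\beta)$ if for every open $U\subset\mathbb{C}$ and every sequence of analytic functions $f_n:U\to X$, $(T-\lambda I)f_n(\lambda)\to 0$ uniformly on compact subsets of $U$ implies $f_n\to 0$ uniformly on compact subsets of $U$; and $T$ has property $(\delta)$ if the dual operator $T^*$ on $X^*$ has property $(\beta)$. $S$ is quasinilpotent if $\sigma(S)=\{0\}$ (for $X\neq\{0\}$). $S$ has discrete spectrum if $\sigma(S)$ is a discrete subset of $\mathbb{C}$. *)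

theory Defs
  imports "HOL-Analysis.Analysis"
begin

section \<open>Complex Banach spaces\<close>

class complex_normed_vector = real_normed_vector +
  fixes scaleC :: "complex \<Rightarrow> 'a \<Rightarrow> 'a" (infixr \<open>*\<^sub>C\<close> 75)
  assumes scaleC_add_right: "a *\<^sub>C (x + y) = a *\<^sub>C x + a *\<^sub>C y"
    and scaleC_add_left: "(a + b) *\<^sub>C x = a *\<^sub>C x + b *\<^sub>C x"
    and scaleC_scaleC: "a *\<^sub>C (b *\<^sub>C x) = (a * b) *\<^sub>C x"
    and scaleC_of_real: "complex_of_real r *\<^sub>C x = r *\<^sub>R x"
    and norm_scaleC: "norm (a *\<^sub>C x) = cmod a * norm x"

class cbanach = complex_normed_vector + banach

lemma scaleC_one [simp]: "1 *\<^sub>C (x::'a::complex_normed_vector) = x"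
  using scaleC_of_real[of 1 x] by simp

interpretation complex_vector: vector_space "scaleC :: complex \<Rightarrow> 'a \<Rightarrow> 'a::complex_normed_vector"
  by unfold_locales (simp_all add: scaleC_add_right scaleC_add_left scaleC_scaleC)

lemma scaleC_scaleR_commute:
  "a *\<^sub>C (r *\<^sub>R x) = r *\<^sub>R (a *\<^sub>C (x::'a::complex_normed_vector))"
  by (simp add: scaleC_of_real[symmetric] scaleC_scaleC mult.commute)

lemma bounded_linear_scaleC:
  "bounded_linear (\<lambda>x. a *\<^sub>C (x::'a::complex_normed_vector))"
  by (rule bounded_linear_intro[where K = "cmod a"])
    (simp_all add: scaleC_add_right scaleC_scaleR_commute norm_scaleC)

instantiation complex :: cbanach
begin

definition scaleC_complex :: "complex \<Rightarrow> complex \<Rightarrow> complex"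
  where "scaleC_complex a x = a * x"

instance
  by standard (simp_all add: scaleC_complex_def algebra_simps norm_mult scaleR_conv_of_real)

end

section \<open>Bounded complex-linear operators\<close>

typedef (overloaded) ('a, 'b) cblinfun (\<open>(_ \<Rightarrow>\<^sub>C\<^sub>L /_)\<close> [22, 21] 21) =
  "{f :: 'a::complex_normed_vector \<Rightarrow> 'b::complex_normed_vector.
      bounded_linear f \<and> (\<forall>c x. f (c *\<^sub>C x) = c *\<^sub>C f x)}"
  morphisms cblinfun_apply CBlinfun
  by (rule exI[where x = "\<lambda>_. 0"]) simp

declare [[coercion
  "cblinfun_apply :: ('a::complex_normed_vector \<Rightarrow>\<^sub>C\<^sub>L 'b::complex_normed_vector) \<Rightarrow> 'a \<Rightarrow> 'b"]]

setup_lifting type_definition_cblinfun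

lemma cblinfun_eqI: "(\<And>x. cblinfun_apply S x = cblinfun_apply T x) \<Longrightarrow> S = T"
  by transfer auto

lemma bounded_linear_cblinfun_apply: "bounded_linear (cblinfun_apply T)"
  by transfer simp

lemma cblinfun_apply_scaleC: "cblinfun_apply T (c *\<^sub>C x) = c *\<^sub>C cblinfun_apply T x"
  by transfer simp

instantiation cblinfun :: (complex_normed_vector, complex_normed_vector) complex_normed_vector
begin

lift_definition norm_cblinfun :: "'a \<Rightarrow>\<^sub>C\<^sub>L 'b \<Rightarrow> real" is onorm .

lift_definition minus_cblinfun :: "'a \<Rightarrow>\<^sub>C\<^sub>L 'b \<Rightarrow> 'a \<Rightarrow>\<^sub>C\<^sub>L 'b \<Rightarrow> 'a \<Rightarrow>\<^sub>C\<^sub>L 'b"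
  is "\<lambda>f g x. f x - g x"
  by (auto intro: bounded_linear_sub simp: complex_vector.scale_right_diff_distrib)

definition dist_cblinfun :: "'a \<Rightarrow>\<^sub>C\<^sub>L 'b \<Rightarrow> 'a \<Rightarrow>\<^sub>C\<^sub>L 'b \<Rightarrow> real"
  where "dist_cblinfun a b = norm (a - b)"

definition [code del]:
  "(uniformity :: (('a \<Rightarrow>\<^sub>C\<^sub>L 'b) \<times> ('a \<Rightarrow>\<^sub>C\<^sub>L 'b)) filter) =
    (INF e\<in>{0 <..}. principal {(x, y). dist x y < e})"

definition open_cblinfun :: "('a \<Rightarrow>\<^sub>C\<^sub>L 'b) set \<Rightarrow> bool"
  where [code del]: "open_cblinfun S = (\<forall>x\<in>S. \<forall>\<^sub>F (x', y) in uniformity. x' = x \<longrightarrow> y \<in> S)"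

lift_definition uminus_cblinfun :: "'a \<Rightarrow>\<^sub>C\<^sub>L 'b \<Rightarrow> 'a \<Rightarrow>\<^sub>C\<^sub>L 'b" is "\<lambda>f x. - f x"
  by (auto intro: bounded_linear_minus)

lift_definition zero_cblinfun :: "'a \<Rightarrow>\<^sub>C\<^sub>L 'b" is "\<lambda>x. 0"
  by simp

lift_definition plus_cblinfun :: "'a \<Rightarrow>\<^sub>C\<^sub>L 'b \<Rightarrow> 'a \<Rightarrow>\<^sub>C\<^sub>L 'b \<Rightarrow> 'a \<Rightarrow>\<^sub>C\<^sub>L 'b"
  is "\<lambda>f g x. f x + g x"
  by (auto intro: bounded_linear_add simp: scaleC_add_right)

lift_definition scaleR_cblinfun :: "real \<Rightarrow> 'a \<Rightarrow>\<^sub>C\<^sub>L 'b \<Rightarrow> 'a \<Rightarrow>\<^sub>C\<^sub>L 'b"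
  is "\<lambda>r f x. r *\<^sub>R f x"
  by (auto intro: bounded_linear_compose[OF bounded_linear_scaleR_right]
      simp: scaleC_scaleR_commute)

lift_definition scaleC_cblinfun :: "complex \<Rightarrow> 'a \<Rightarrow>\<^sub>C\<^sub>L 'b \<Rightarrow> 'a \<Rightarrow>\<^sub>C\<^sub>L 'b"
  is "\<lambda>c f x. c *\<^sub>C f x"
  by (auto intro: bounded_linear_compose[OF bounded_linear_scaleC]
      simp: scaleC_scaleC mult.commute)

definition sgn_cblinfun :: "'a \<Rightarrow>\<^sub>C\<^sub>L 'b \<Rightarrow> 'a \<Rightarrow>\<^sub>C\<^sub>L 'b"
  where "sgn_cblinfun x = scaleR (inverse (norm x)) x"

lemma onorm_scaleC:
  assumes f: "bounded_linear (f :: 'a \<Rightarrow> 'b)"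
  shows "onorm (\<lambda>x. c *\<^sub>C f x) = cmod c * onorm f"
proof -
  have le: "onorm (\<lambda>x. d *\<^sub>C g x) \<le> cmod d * onorm g"
    if g: "bounded_linear g" for d and g :: "'a \<Rightarrow> 'b"
  proof (rule onorm_bound)
    show "norm (d *\<^sub>C g x) \<le> cmod d * onorm g * norm x" for x
      using mult_left_mono[OF onorm[OF g, of x], of "cmod d"]
      by (simp add: norm_scaleC mult.assoc)
  qed (simp add: onorm_pos_le[OF g])
  show ?thesis
  proof (cases "c = 0")
    case True
    then show ?thesis by (simp add: onorm_zero)
  next
    case False
    have cf: "bounded_linear (\<lambda>x. c *\<^sub>C f x)"
      by (rule bounded_linear_compose[OF bounded_linear_scaleC f])
    have "onorm f \<le> cmod (inverse c) * onorm (\<lambda>x. c *\<^sub>C f x)"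
      using le[OF cf, of "inverse c"] False by (simp add: scaleC_scaleC)
    then have "cmod c * onorm f \<le> onorm (\<lambda>x. c *\<^sub>C f x)"
      using False by (simp add: norm_inverse norm_divide field_simps)
    with le[OF f, of c] show ?thesis by simp
  qed
qed

instance
  apply standard
  unfolding dist_cblinfun_def open_cblinfun_def sgn_cblinfun_def uniformity_cblinfun_def
  apply (rule refl | (transfer, force simp: onorm_triangle onorm_scaleR
        onorm_eq_0 algebra_simps scaleC_add_right scaleC_add_left scaleC_scaleC scaleC_of_real
        onorm_scaleC))+
  done

end

instance cblinfun :: (complex_normed_vector, cbanach) cbanach
proof
  fix X :: "nat \<Rightarrow> 'a \<Rightarrow>\<^sub>C\<^sub>L 'b"
  assume X: "Cauchy X"
  define Y where "Y n = Blinfun (cblinfun_apply (X n))" for n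
  have Y: "blinfun_apply (Y n) = cblinfun_apply (X n)" for n
    by (simp add: Y_def bounded_linear_Blinfun_apply bounded_linear_cblinfun_apply)
  have norm_diff: "norm (T - X n) = norm (Blinfun (cblinfun_apply T) - Y n)" for T n
    by (simp add: norm_cblinfun.rep_eq norm_blinfun.rep_eq minus_cblinfun.rep_eq
        minus_blinfun.rep_eq Y bounded_linear_Blinfun_apply bounded_linear_cblinfun_apply)
  have "Cauchy Y"
    using X by (simp add: Cauchy_def dist_norm norm_diff flip: Y_def)
  then obtain L where L: "Y \<longlonglongrightarrow> L"
    by (auto simp: Cauchy_convergent_iff convergent_def)
  have ptw: "(\<lambda>n. cblinfun_apply (X n) x) \<longlonglongrightarrow> blinfun_apply L x" for x
    using blinfun.tendsto[OF L tendsto_const[of x]] by (simp add: Y)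
  have "blinfun_apply L (c *\<^sub>C x) = c *\<^sub>C blinfun_apply L x" for c x
    using LIMSEQ_unique[OF ptw[of "c *\<^sub>C x"]]
      bounded_linear.tendsto[OF bounded_linear_scaleC ptw[of x], of c]
    by (simp add: cblinfun_apply_scaleC)
  then have "cblinfun_apply (CBlinfun (blinfun_apply L)) = blinfun_apply L"
    by (simp add: CBlinfun_inverse blinfun.bounded_linear_right)
  then have "norm (CBlinfun (blinfun_apply L) - X n) = norm (L - Y n)" for n
    by (simp add: norm_diff blinfun_apply_inverse)
  then have "X \<longlonglongrightarrow> CBlinfun (blinfun_apply L)"
    using L by (simp add: LIMSEQ_iff norm_minus_commute)
  then show "convergent X"
    by (auto simp: convergent_def)
qed

lift_definition cblinfun_id :: "'a::complex_normed_vector \<Rightarrow>\<^sub>C\<^sub>L 'a" is "\<lambda>x. x"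
  by (simp add: bounded_linear_ident)

lift_definition cblinfun_compose ::
  "'b::complex_normed_vector \<Rightarrow>\<^sub>C\<^sub>L 'c::complex_normed_vector \<Rightarrow>
    'a::complex_normed_vector \<Rightarrow>\<^sub>C\<^sub>L 'b \<Rightarrow> 'a \<Rightarrow>\<^sub>C\<^sub>L 'c" (infixl \<open>o\<^sub>C\<^sub>L\<close> 67)
  is "\<lambda>f g x. f (g x)"
  by (auto intro: bounded_linear_compose)

lemma norm_cblinfun_compose_le:
  fixes f :: "'b::complex_normed_vector \<Rightarrow>\<^sub>C\<^sub>L 'c::complex_normed_vector"
    and g :: "'a::complex_normed_vector \<Rightarrow>\<^sub>C\<^sub>L 'b"
  shows "norm (f o\<^sub>C\<^sub>L g) \<le> norm f * norm g"
  by transfer (auto dest: onorm_compose simp: o_def)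

section \<open>The dual operator\<close>

type_synonym 'a cdual = "'a \<Rightarrow>\<^sub>C\<^sub>L complex"

lift_definition dual_operator ::
  "('a::complex_normed_vector \<Rightarrow>\<^sub>C\<^sub>L 'a) \<Rightarrow> 'a cdual \<Rightarrow>\<^sub>C\<^sub>L 'a cdual"
  is "\<lambda>T (\<phi> :: 'a \<Rightarrow>\<^sub>C\<^sub>L complex). \<phi> o\<^sub>C\<^sub>L T"
proof (intro conjI allI)
  fix T :: "'a \<Rightarrow>\<^sub>C\<^sub>L 'a"
  show "bounded_linear (\<lambda>\<phi> :: 'a \<Rightarrow>\<^sub>C\<^sub>L complex. \<phi> o\<^sub>C\<^sub>L T)"
    by (rule bounded_linear_intro[where K = "norm T"])
      (auto intro!: cblinfun_eqI norm_cblinfun_compose_le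
        simp: cblinfun_compose.rep_eq plus_cblinfun.rep_eq scaleR_cblinfun.rep_eq)
  show "(c *\<^sub>C \<phi>) o\<^sub>C\<^sub>L T = c *\<^sub>C (\<phi> o\<^sub>C\<^sub>L T)" for c and \<phi> :: "'a \<Rightarrow>\<^sub>C\<^sub>L complex"
    by (auto intro!: cblinfun_eqI simp: cblinfun_compose.rep_eq scaleC_cblinfun.rep_eq)
qed

section \<open>Spectra\<close>

definition spectrum :: "('a::cbanach \<Rightarrow>\<^sub>C\<^sub>L 'a) \<Rightarrow> complex set" where
  "spectrum T = {z. \<not> (\<exists>R. R o\<^sub>C\<^sub>L (T - z *\<^sub>C cblinfun_id) = cblinfun_id \<and>
                           (T - z *\<^sub>C cblinfun_id) o\<^sub>C\<^sub>L R = cblinfun_id)}"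

definition bounded_operator_on :: "'a::complex_normed_vector set \<Rightarrow> ('a \<Rightarrow> 'a) \<Rightarrow> bool" where
  "bounded_operator_on Y f \<longleftrightarrow>
     f ` Y \<subseteq> Y \<and>
     (\<forall>x\<in>Y. \<forall>y\<in>Y. f (x + y) = f x + f y) \<and>
     (\<forall>c. \<forall>x\<in>Y. f (c *\<^sub>C x) = c *\<^sub>C f x) \<and>
     (\<exists>K. \<forall>x\<in>Y. norm (f x) \<le> K * norm x)"

text \<open>The spectrum, in \<open>B(Y)\<close>, of the restriction of \<open>T\<close> to a closed invariant subspace \<open>Y\<close>.
  Subspaces are sets, so an element of \<open>B(Y)\<close> is a function on the whole space of which only
  the values on \<open>Y\<close> matter.\<close>

definition spectrum_on :: "'a::cbanach set \<Rightarrow> ('a \<Rightarrow>\<^sub>C\<^sub>L 'a) \<Rightarrow> complex set" where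
  "spectrum_on Y T = {z. \<not> (\<exists>R. bounded_operator_on Y R \<and>
     (\<forall>y\<in>Y. R (T y - z *\<^sub>C y) = y \<and> T (R y) - z *\<^sub>C R y = y))}"

lemma bounded_operator_on_UNIV:
  "bounded_operator_on UNIV f \<longleftrightarrow> (\<exists>T. f = cblinfun_apply T)"
proof
  assume f: "bounded_operator_on UNIV f"
  then obtain K where K: "\<And>x. norm (f x) \<le> K * norm x"
    by (auto simp: bounded_operator_on_def)
  have "bounded_linear f"
    using f K by (intro bounded_linear_intro[where K = K])
      (auto simp: bounded_operator_on_def mult.commute simp flip: scaleC_of_real)
  then have "f = cblinfun_apply (CBlinfun f)"
    using f by (subst CBlinfun_inverse) (auto simp: bounded_operator_on_def)
  then show "\<exists>T. f = cblinfun_apply T" ..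
next
  assume "\<exists>T. f = cblinfun_apply T"
  then obtain T where T: "f = cblinfun_apply T" ..
  interpret bounded_linear f
    unfolding T by (rule bounded_linear_cblinfun_apply)
  from bounded show "bounded_operator_on UNIV f"
    by (auto simp: bounded_operator_on_def add[unfolded T] T cblinfun_apply_scaleC mult.commute)
qed

lemma spectrum_on_UNIV: "spectrum_on UNIV T = spectrum T"
proof -
  have comp_eq: "(\<forall>y. R (T y - z *\<^sub>C y) = y \<and> T (R y) - z *\<^sub>C R y = y) \<longleftrightarrow>
      R o\<^sub>C\<^sub>L (T - z *\<^sub>C cblinfun_id) = cblinfun_id \<and>
      (T - z *\<^sub>C cblinfun_id) o\<^sub>C\<^sub>L R = cblinfun_id" for R :: "'a \<Rightarrow>\<^sub>C\<^sub>L 'a" and z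
    by transfer (auto simp: fun_eq_iff)
  show ?thesis
    unfolding spectrum_on_def spectrum_def bounded_operator_on_UNIV comp_eq[symmetric]
    by auto
qed

section \<open>Decomposability and the properties $(\beta)$ and $(\delta)$\<close>

definition decomposable :: "('a::cbanach \<Rightarrow>\<^sub>C\<^sub>L 'a) \<Rightarrow> bool" where
  "decomposable T \<longleftrightarrow>
     (\<forall>U V. open U \<and> open V \<and> U \<union> V = UNIV \<longrightarrow>
       (\<exists>Y Z. complex_vector.subspace Y \<and> closed Y \<and> T ` Y \<subseteq> Y \<and>
              complex_vector.subspace Z \<and> closed Z \<and> T ` Z \<subseteq> Z \<and>
              (\<forall>x. \<exists>y\<in>Y. \<exists>z\<in>Z. x = y + z) \<and>
              spectrum_on Y T \<subseteq> U \<and> spectrum_on Z T \<subseteq> V))"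

text \<open>Vector-valued analytic functions on an open set: complex differentiable at every point.\<close>

definition vector_analytic_on :: "(complex \<Rightarrow> 'a::cbanach) \<Rightarrow> complex set \<Rightarrow> bool" where
  "vector_analytic_on f U \<longleftrightarrow> (\<forall>z\<in>U. \<exists>D. (f has_derivative (\<lambda>h. h *\<^sub>C D)) (at z))"

definition property_beta :: "('a::cbanach \<Rightarrow>\<^sub>C\<^sub>L 'a) \<Rightarrow> bool" where
  "property_beta T \<longleftrightarrow>
     (\<forall>U f. open U \<and> (\<forall>n::nat. vector_analytic_on (f n) U) \<and>
        (\<forall>K. compact K \<and> K \<subseteq> U \<longrightarrow>
          uniform_limit K (\<lambda>n z. T (f n z) - z *\<^sub>C f n z) (\<lambda>_. 0) sequentially) \<longrightarrow>
        (\<forall>K. compact K \<and> K \<subseteq> U \<longrightarrow> uniform_limit K f (\<lambda>_. 0) sequentially))"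

definition property_delta :: "('a::cbanach \<Rightarrow>\<^sub>C\<^sub>L 'a) \<Rightarrow> bool" where
  "property_delta T \<longleftrightarrow> property_beta (dual_operator T)"

section \<open>Classes of perturbations\<close>

text \<open>On the zero space the spectrum is empty; its only operator counts as quasinilpotent.\<close>

definition quasinilpotent :: "('a::cbanach \<Rightarrow>\<^sub>C\<^sub>L 'a) \<Rightarrow> bool" where
  "quasinilpotent S \<longleftrightarrow> ((\<exists>x::'a. x \<noteq> 0) \<longrightarrow> spectrum S = {0})"

definition compact_operator :: "('a::cbanach \<Rightarrow>\<^sub>C\<^sub>L 'a) \<Rightarrow> bool" where
  "compact_operator S \<longleftrightarrow> compact (closure (S ` cball 0 1))"

definition has_discrete_spectrum :: "('a::cbanach \<Rightarrow>\<^sub>C\<^sub>L 'a) \<Rightarrow> bool" where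
  "has_discrete_spectrum S \<longleftrightarrow> discrete (spectrum S)"

end

theory Submission
  imports Defs "HOL-Complex_Analysis.Complex_Analysis"
begin

text \<open>Every closed subspace \<open>Y\<close> occurring in a decomposition for \<open>T\<close> may be replaced by its hyperinvariant
  hull, the closed span of the \<open>A y\<close> with \<open>y \<in> Y\<close> and \<open>A\<close> commuting with \<open>T\<close>. If \<open>T - z\<close> is
  invertible on \<open>Y\<close>, then \<open>u = A y\<close> equals \<open>(T - z)\<^sup>k a\<^sub>k\<close> with \<open>a\<^sub>k\<close> growing at most geometrically;
  decomposing \<open>a\<^sub>k\<close> along a cover by a small disc around \<open>z\<close> and the complement of a smaller one shows
  that \<open>u\<close> lies in the second summand, where \<open>T - z\<close> is bounded below. So \<open>T - z\<close> is invertible on the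
  hull too, and \<open>S\<close> leaves the hull invariant.

  If the powers of \<open>S - m\<close> grow more slowly than \<open>e\<^sup>k\<close>, a Neumann series shows that adding \<open>S\<close> moves the
  spectra on the hulls by \<open>m\<close> up to an error \<open>e\<close>. In each of the three cases \<open>S\<close> has only finitely many
  spectral points outside any disc around \<open>0\<close>; splitting them off one by one with spectral projections,
  which commute with \<open>T\<close>, reduces the claim to this situation.

  Property \<open>(\<delta>)\<close> follows from decomposability by testing functionals on the two summands of a
  decomposition adapted to a disc.\<close>

section \<open>Bounded operators on a subspace\<close>

text \<open>The obstacle is that decomposability supplies subspaces invariant under \<open>T\<close>
  only, while \<open>S\<close> must act on them before \<open>T + S - l\<close> can be inverted
  there; this forces the hulls. A second obstacle is that splitting off a spectral point of
  \<open>S\<close> would pass to the range of a projection and ask again for decomposability of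
  \<open>T\<close> on that range. Instead every piece stays on the whole space: \<open>S\<close> is
  replaced by \<open>S P + l Q\<close> and by \<open>S Q\<close>, which agree with \<open>S\<close>
  on one summand and are scalar on the other. All pieces perturb the same \<open>T\<close>, so their
  errors do not accumulate, and one \<open>e\<close>, obtained from a Lebesgue number of the cover,
  serves the whole induction. Both the spectral radius bound and the spectral projections are read
  off from \<open>(1 - A^n)^-1\<close> along \<open>n = 2^k\<close>.\<close>

lemma subspace_scaleR:
  assumes "complex_vector.subspace Y" "y \<in> Y"
  shows "r *\<^sub>R y \<in> Y"
  using complex_vector.subspace_scale[OF assms, of "complex_of_real r"] by (simp add: scaleC_of_real)

lemma bop_mem: "bounded_operator_on Y f \<Longrightarrow> y \<in> Y \<Longrightarrow> f y \<in> Y"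
  by (auto simp: bounded_operator_on_def)

lemma bop_add: "bounded_operator_on Y f \<Longrightarrow> x \<in> Y \<Longrightarrow> y \<in> Y \<Longrightarrow> f (x + y) = f x + f y"
  by (auto simp: bounded_operator_on_def)

lemma bop_scaleC: "bounded_operator_on Y f \<Longrightarrow> y \<in> Y \<Longrightarrow> f (c *\<^sub>C y) = c *\<^sub>C f y"
  by (auto simp: bounded_operator_on_def)

lemma bop_bound:
  assumes "bounded_operator_on Y f"
  obtains K where "K > 0" "\<And>y. y \<in> Y \<Longrightarrow> norm (f y) \<le> K * norm y"
proof -
  have "\<exists>K. \<forall>y\<in>Y. norm (f y) \<le> K * norm y"
    using assms by (simp add: bounded_operator_on_def)
  then obtain K where K: "\<And>y. y \<in> Y \<Longrightarrow> norm (f y) \<le> K * norm y"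
    by auto
  have "norm (f y) \<le> (\<bar>K\<bar> + 1) * norm y" if "y \<in> Y" for y
    using order_trans[OF K[OF that] mult_right_mono[of K "\<bar>K\<bar> + 1" "norm y"]] by simp
  moreover have "\<bar>K\<bar> + 1 > 0" by simp
  ultimately show ?thesis using that by blast
qed

lemma bop_zero:
  assumes "complex_vector.subspace Y" "bounded_operator_on Y f"
  shows "f 0 = 0"
  using bop_scaleC[OF assms(2) complex_vector.subspace_0[OF assms(1)], of 0] by simp

lemma bop_diff:
  assumes "complex_vector.subspace Y" "bounded_operator_on Y f" "x \<in> Y" "y \<in> Y"
  shows "f (x - y) = f x - f y"
  using bop_add[OF assms(2), of "x - y" y] complex_vector.subspace_diff[OF assms(1,3,4)] assms(4)
  by (simp add: algebra_simps)

lemma bop_sum: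
  assumes "complex_vector.subspace Y" "bounded_operator_on Y f" "\<And>i. i \<in> I \<Longrightarrow> x i \<in> Y"
  shows "f (\<Sum>i\<in>I. x i) = (\<Sum>i\<in>I. f (x i))"
  using assms(3)
proof (induction I rule: infinite_finite_induct)
  case (insert i I)
  then have "(\<Sum>i\<in>I. x i) \<in> Y"
    by (intro complex_vector.subspace_sum[OF assms(1)]) auto
  with insert show ?case by (simp add: bop_add[OF assms(2)])
qed (simp_all add: bop_zero[OF assms(1,2)])

lemma bop_ident: "bounded_operator_on Y (\<lambda>x. x)"
  unfolding bounded_operator_on_def by (auto intro!: exI[of _ 1])

lemma bop_plus:
  assumes "complex_vector.subspace Y" "bounded_operator_on Y f" "bounded_operator_on Y g"
  shows "bounded_operator_on Y (\<lambda>x. f x + g x)"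
proof -
  obtain K L where "\<And>y. y \<in> Y \<Longrightarrow> norm (f y) \<le> K * norm y" "\<And>y. y \<in> Y \<Longrightarrow> norm (g y) \<le> L * norm y"
    using bop_bound[OF assms(2)] bop_bound[OF assms(3)] by metis
  then have "norm (f y + g y) \<le> (K + L) * norm y" if "y \<in> Y" for y
    using that by (smt (verit) norm_triangle_ineq distrib_right)
  then show ?thesis
    using assms unfolding bounded_operator_on_def
    by (auto simp: complex_vector.subspace_add scaleC_add_right image_subset_iff)
qed

lemma bop_scale:
  assumes "complex_vector.subspace Y" "bounded_operator_on Y f"
  shows "bounded_operator_on Y (\<lambda>x. c *\<^sub>C f x)"
proof -
  obtain K where K: "\<And>y. y \<in> Y \<Longrightarrow> norm (f y) \<le> K * norm y"
    using bop_bound[OF assms(2)] by metis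
  have "norm (c *\<^sub>C f y) \<le> (cmod c * K) * norm y" if "y \<in> Y" for y
    using mult_left_mono[OF K[OF that], of "cmod c"] by (simp add: norm_scaleC mult.assoc)
  then have "\<exists>K. \<forall>y\<in>Y. norm (c *\<^sub>C f y) \<le> K * norm y" by blast
  with assms show ?thesis
    unfolding bounded_operator_on_def
    by (auto simp: complex_vector.subspace_scale scaleC_add_right scaleC_scaleC mult.commute image_subset_iff)
qed

lemma bop_minus:
  assumes "complex_vector.subspace Y" "bounded_operator_on Y f" "bounded_operator_on Y g"
  shows "bounded_operator_on Y (\<lambda>x. f x - g x)"
  using bop_plus[OF assms(1,2) bop_scale[OF assms(1,3), of "-1"]] by simp

lemma bop_comp:
  assumes "bounded_operator_on Y f" "bounded_operator_on Y g"
  shows "bounded_operator_on Y (\<lambda>x. f (g x))"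
proof -
  obtain K where K: "K > 0" "\<And>y. y \<in> Y \<Longrightarrow> norm (f y) \<le> K * norm y"
    using bop_bound[OF assms(1)] by metis
  obtain L where L: "\<And>y. y \<in> Y \<Longrightarrow> norm (g y) \<le> L * norm y"
    using bop_bound[OF assms(2)] by metis
  have "norm (f (g y)) \<le> (K * L) * norm y" if "y \<in> Y" for y
    using order_trans[OF K(2)[OF bop_mem[OF assms(2) that]] mult_left_mono[OF L[OF that], of K]] K(1)
    by (simp add: mult.assoc)
  then show ?thesis
    using assms unfolding bounded_operator_on_def by (auto simp: image_subset_iff)
qed

lemma bop_funpow: "bounded_operator_on Y f \<Longrightarrow> bounded_operator_on Y (f ^^ n)"
proof (induction n)
  case 0
  then show ?case using bop_ident[of Y] by (simp add: id_def)
next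
  case (Suc n)
  then show ?case using bop_comp[of Y f "f ^^ n"] by (simp add: o_def)
qed

lemma bop_sum_op:
  assumes "complex_vector.subspace Y" "\<And>i. i \<in> I \<Longrightarrow> bounded_operator_on Y (f i)"
  shows "bounded_operator_on Y (\<lambda>x. \<Sum>i\<in>I. f i x)"
  using assms(2)
proof (induction I rule: infinite_finite_induct)
  case (insert i I)
  then show ?case by (simp add: bop_plus[OF assms(1)])
qed (use bop_scale[OF assms(1) bop_ident, of 0] in simp_all)

lemma bop_cblinfun:
  fixes T :: "'a::complex_normed_vector \<Rightarrow>\<^sub>C\<^sub>L 'a"
  assumes "T ` Y \<subseteq> Y"
  shows "bounded_operator_on Y (cblinfun_apply T)"
  using assms bounded_operator_on_UNIV[of "cblinfun_apply T"]
  by (auto simp: bounded_operator_on_def)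

lemma bop_UNIV: "bounded_operator_on UNIV (cblinfun_apply T)"
  by (simp add: bop_cblinfun)

lemma bop_shift:
  assumes "complex_vector.subspace Y" "bounded_operator_on Y f"
  shows "bounded_operator_on Y (\<lambda>x. f x - z *\<^sub>C x)"
  by (intro bop_minus bop_scale bop_ident assms)

lemma funpow_commute:
  assumes "\<And>y. y \<in> Y \<Longrightarrow> f (g y) = g (f y)" "g ` Y \<subseteq> Y" "y \<in> Y"
  shows "f ((g ^^ n) y) = (g ^^ n) (f y)"
proof (induction n)
  case (Suc n)
  have "(g ^^ n) y \<in> Y" using assms(2,3) by (induction n) auto
  then show ?case using Suc assms(1) by simp
qed simp

text \<open>Invertibility in B(Y), for functions of which only the values on \<open>Y\<close> count.
  Bare functions rather than operators on the whole space admit maps such as an inverse composed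
  with \<open>S - m\<close>, which make sense on \<open>Y\<close> alone.\<close>

definition regular_on :: "'a::complex_normed_vector set \<Rightarrow> ('a \<Rightarrow> 'a) \<Rightarrow> bool" where
  "regular_on Y f \<longleftrightarrow> bounded_operator_on Y f \<and>
     (\<exists>g. bounded_operator_on Y g \<and> (\<forall>y\<in>Y. g (f y) = y \<and> f (g y) = y))"

lemma regular_onE:
  assumes "regular_on Y f"
  obtains g where "bounded_operator_on Y g" "\<And>y. y \<in> Y \<Longrightarrow> g (f y) = y" "\<And>y. y \<in> Y \<Longrightarrow> f (g y) = y"
  using assms by (auto simp: regular_on_def)

lemma regular_onI:
  assumes "bounded_operator_on Y f" "bounded_operator_on Y g"
    "\<And>y. y \<in> Y \<Longrightarrow> g (f y) = y" "\<And>y. y \<in> Y \<Longrightarrow> f (g y) = y"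
  shows "regular_on Y f"
  using assms by (auto simp: regular_on_def)

lemma regular_on_bop: "regular_on Y f \<Longrightarrow> bounded_operator_on Y f"
  by (simp add: regular_on_def)

lemma regular_on_cong:
  assumes "\<And>y. y \<in> Y \<Longrightarrow> f y = g y" "complex_vector.subspace Y"
  shows "regular_on Y f \<longleftrightarrow> regular_on Y g"
proof -
  have "regular_on Y g" if eq: "\<And>y. y \<in> Y \<Longrightarrow> f y = g y" and reg: "regular_on Y f" for f g :: "'a \<Rightarrow> 'a"
  proof -
    obtain k where k: "bounded_operator_on Y k" "\<And>y. y \<in> Y \<Longrightarrow> k (f y) = y"
      "\<And>y. y \<in> Y \<Longrightarrow> f (k y) = y"
      using regular_onE[OF reg] by metis
    have "bounded_operator_on Y f" by (rule regular_on_bop[OF reg])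
    then have "bounded_operator_on Y g"
      unfolding bounded_operator_on_def image_subset_iff
      by (simp add: eq[symmetric] complex_vector.subspace_add[OF assms(2)]
          complex_vector.subspace_scale[OF assms(2)])
    then show ?thesis
      by (rule regular_onI[OF _ k(1)]) (use k eq bop_mem[OF k(1)] in metis)+
  qed
  from this[of f g] this[of g f] show ?thesis
    using assms(1)[symmetric] assms(1) by blast
qed

lemma regular_on_bounded_below:
  assumes "regular_on Y f"
  obtains c where "c > 0" "\<And>y. y \<in> Y \<Longrightarrow> c * norm y \<le> norm (f y)"
proof -
  obtain g where g: "bounded_operator_on Y g" "\<And>y. y \<in> Y \<Longrightarrow> g (f y) = y"
    using regular_onE[OF assms] by metis
  obtain K where K: "K > 0" "\<And>y. y \<in> Y \<Longrightarrow> norm (g y) \<le> K * norm y"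
    using bop_bound[OF g(1)] by metis
  have "1 / K * norm y \<le> norm (f y)" if "y \<in> Y" for y
    using K(2)[OF bop_mem[OF regular_on_bop[OF assms] that]] g(2)[OF that] K(1)
    by (simp add: field_simps)
  moreover have "1 / K > 0" using K(1) by simp
  ultimately show ?thesis using that by blast
qed

lemma regular_on_surj:
  assumes "regular_on Y f" "y \<in> Y"
  obtains x where "x \<in> Y" "f x = y"
  using regular_onE[OF assms(1)] bop_mem assms(2) by metis

text \<open>The lower bound does double duty: it makes \<open>f\<close> injective and bounds the
  inverse by \<open>1 / c\<close>.\<close>

lemma regular_onI_bounded_below:
  assumes Y: "complex_vector.subspace Y" and f: "bounded_operator_on Y f"
    and c: "c > 0" "\<And>y. y \<in> Y \<Longrightarrow> c * norm y \<le> norm (f y)"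
    and surj: "\<And>y. y \<in> Y \<Longrightarrow> \<exists>x\<in>Y. f x = y"
  shows "regular_on Y f"
proof -
  have inj: "x = y" if "x \<in> Y" "y \<in> Y" "f x = f y" for x y
    using c(2)[of "x - y"] c(1) that complex_vector.subspace_diff[OF Y] bop_diff[OF Y f that(1,2)]
    by (simp add: mult_le_0_iff)
  obtain g where g: "\<And>y. y \<in> Y \<Longrightarrow> g y \<in> Y \<and> f (g y) = y"
    using surj by metis
  have gf: "g (f y) = y" if "y \<in> Y" for y
    using g[OF bop_mem[OF f that]] inj that by blast
  have "bounded_operator_on Y g"
    unfolding bounded_operator_on_def
  proof (intro conjI ballI allI)
    show "g ` Y \<subseteq> Y" using g by auto
    show "g (x + y) = g x + g y" if "x \<in> Y" "y \<in> Y" for x y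
      using gf[of "g x + g y"] g that bop_add[OF f, of "g x" "g y"]
      by (simp add: complex_vector.subspace_add[OF Y])
    show "g (a *\<^sub>C x) = a *\<^sub>C g x" if "x \<in> Y" for x a
      using gf[of "a *\<^sub>C g x"] g that bop_scaleC[OF f, of "g x" a]
      by (simp add: complex_vector.subspace_scale[OF Y])
    show "\<exists>K. \<forall>x\<in>Y. norm (g x) \<le> K * norm x"
      using c(2) g c(1) by (intro exI[of _ "1 / c"]) (auto simp: field_simps, metis)
  qed
  then show ?thesis using gf g f by (auto intro: regular_onI)
qed

lemma regular_on_comp:
  assumes "regular_on Y f" "regular_on Y g"
  shows "regular_on Y (\<lambda>x. f (g x))"
proof -
  obtain f' where f': "bounded_operator_on Y f'" "\<And>y. y \<in> Y \<Longrightarrow> f' (f y) = y" "\<And>y. y \<in> Y \<Longrightarrow> f (f' y) = y"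
    using regular_onE[OF assms(1)] by metis
  obtain g' where g': "bounded_operator_on Y g'" "\<And>y. y \<in> Y \<Longrightarrow> g' (g y) = y" "\<And>y. y \<in> Y \<Longrightarrow> g (g' y) = y"
    using regular_onE[OF assms(2)] by metis
  show ?thesis
    by (rule regular_onI[where g = "\<lambda>y. g' (f' y)"])
      (use f' g' in \<open>auto simp: bop_comp[OF regular_on_bop[OF assms(1)] regular_on_bop[OF assms(2)]] bop_comp[OF g'(1) f'(1)] bop_mem[OF regular_on_bop[OF assms(2)]] bop_mem[OF f'(1)]\<close>)
qed

lemma regular_on_scale:
  assumes "complex_vector.subspace Y" "regular_on Y f" "c \<noteq> 0"
  shows "regular_on Y (\<lambda>x. c *\<^sub>C f x)"
proof -
  obtain g where g: "bounded_operator_on Y g" "\<And>y. y \<in> Y \<Longrightarrow> g (f y) = y" "\<And>y. y \<in> Y \<Longrightarrow> f (g y) = y"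
    using regular_onE[OF assms(2)] by metis
  note f = regular_on_bop[OF assms(2)]
  show ?thesis
  proof (rule regular_onI[where g = "\<lambda>y. (1 / c) *\<^sub>C g y"])
    show "bounded_operator_on Y (\<lambda>x. c *\<^sub>C f x)" "bounded_operator_on Y (\<lambda>x. (1 / c) *\<^sub>C g x)"
      by (intro bop_scale assms(1) f g)+
  next
    fix y assume "y \<in> Y"
    then show "(1 / c) *\<^sub>C g (c *\<^sub>C f y) = y" "c *\<^sub>C f ((1 / c) *\<^sub>C g y) = y"
      using g assms(3) by (simp_all add: bop_scaleC[OF g(1)] bop_scaleC[OF f] bop_mem[OF f] bop_mem[OF g(1)] scaleC_scaleC)
  qed
qed

text \<open>On \<open>Y\<close>, \<open>B g = g f B g = g B f g = g B\<close>.\<close>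

lemma regular_on_inverse_commute:
  assumes g: "bounded_operator_on Y g" "\<And>y. y \<in> Y \<Longrightarrow> g (f y) = y" "\<And>y. y \<in> Y \<Longrightarrow> f (g y) = y"
    and B: "\<And>y. y \<in> Y \<Longrightarrow> B y \<in> Y" "\<And>y. y \<in> Y \<Longrightarrow> B (f y) = f (B y)"
    and y: "y \<in> Y"
  shows "B (g y) = g (B y)"
  using g(2)[of "B (g y)"] B(2)[of "g y"] g(3)[OF y] B(1) bop_mem[OF g(1) y] by simp

lemma spectrum_on_regular:
  fixes T :: "'a::cbanach \<Rightarrow>\<^sub>C\<^sub>L 'a"
  assumes "complex_vector.subspace Y" "T ` Y \<subseteq> Y"
  shows "z \<notin> spectrum_on Y T \<longleftrightarrow> regular_on Y (\<lambda>y. T y - z *\<^sub>C y)"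
  unfolding spectrum_on_def regular_on_def
  using bop_shift[OF assms(1) bop_cblinfun[OF assms(2)], of z] by simp

lemma spectrum_regular:
  fixes T :: "'a::cbanach \<Rightarrow>\<^sub>C\<^sub>L 'a"
  shows "z \<notin> spectrum T \<longleftrightarrow> regular_on UNIV (\<lambda>y. T y - z *\<^sub>C y)"
  using spectrum_on_regular[of UNIV T z] by (simp add: spectrum_on_UNIV complex_vector.subspace_UNIV)

section \<open>Neumann series\<close>

lemma regular_on_id_minus_contraction:
  fixes Y :: "'a::cbanach set"
  assumes Y: "complex_vector.subspace Y" "closed Y" and B: "bounded_operator_on Y B"
    and q: "q < 1" "\<And>y. y \<in> Y \<Longrightarrow> norm (B y) \<le> q * norm y"
  shows "regular_on Y (\<lambda>y. y - B y)"
proof (rule regular_onI_bounded_below[OF Y(1), where c = "1 - q"])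
  show "bounded_operator_on Y (\<lambda>y. y - B y)" by (intro bop_minus Y bop_ident B)
  show "1 - q > 0" using q by simp
  show "(1 - q) * norm y \<le> norm (y - B y)" if "y \<in> Y" for y
    using q(2)[OF that] norm_triangle_ineq2[of y "B y"] by (simp add: algebra_simps)
  fix y assume y: "y \<in> Y"
  have "\<exists>!x\<in>Y. y + B x = x"
  proof (rule Banach_fix)
    show "complete Y" using Y(2) by (simp add: complete_eq_closed)
    \<comment> \<open>A contraction constant must be nonnegative, whereas \<open>q\<close> may be
      negative when \<open>Y = {0}\<close>.\<close>
    show "dist (y + B u) (y + B v) \<le> max q 0 * dist u v" if "u \<in> Y" "v \<in> Y" for u v
    proof -
      have "norm (B (u - v)) \<le> q * norm (u - v)"
        by (intro q complex_vector.subspace_diff Y that)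
      also have "\<dots> \<le> max q 0 * norm (u - v)"
        by (intro mult_right_mono) auto
      finally show ?thesis by (simp add: dist_norm bop_diff[OF Y(1) B that])
    qed
  qed (use y q in \<open>auto simp: complex_vector.subspace_add[OF Y(1)] bop_mem[OF B]\<close>)
  then show "\<exists>x\<in>Y. x - B x = y" by (metis add_diff_cancel_right')
qed

text \<open>\<open>1 - B^n = (1 - B) (1 + B + ... + B^(n-1))\<close>, so the inverse is the
  geometric sum applied after \<open>(1 - B^n)^-1\<close>. That it is also a left inverse uses that
  \<open>(1 - B^n)^-1\<close> commutes with \<open>B\<close>.\<close>

lemma regular_on_id_minus_power_contraction:
  fixes Y :: "'a::cbanach set"
  assumes Y: "complex_vector.subspace Y" "closed Y" and B: "bounded_operator_on Y B"
    and q: "q < 1" "\<And>y. y \<in> Y \<Longrightarrow> norm ((B ^^ n) y) \<le> q * norm y"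
  shows "regular_on Y (\<lambda>y. y - B y)"
proof -
  define S where "S = (\<lambda>y. \<Sum>i<n. (B ^^ i) y)"
  have S: "bounded_operator_on Y S"
    unfolding S_def by (intro bop_sum_op Y bop_funpow B)
  have tele: "S y - B (S y) = y - (B ^^ n) y" if "y \<in> Y" for y
  proof -
    have "B (S y) = (\<Sum>i<n. (B ^^ Suc i) y)"
      unfolding S_def using that B by (subst bop_sum[OF Y(1) B]) (auto simp: bop_mem[OF bop_funpow[OF B]])
    then show ?thesis
      using sum_lessThan_telescope'[of "\<lambda>i. (B ^^ i) y" n] unfolding S_def
      by (simp add: sum_subtractf)
  qed
  have SB: "S (B y) = B (S y)" if "y \<in> Y" for y
    unfolding S_def using that B
    by (subst bop_sum[OF Y(1) B]) (auto simp: bop_mem[OF bop_funpow[OF B]] funpow_swap1[of B])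
  have "regular_on Y (\<lambda>y. y - (B ^^ n) y)"
    by (intro regular_on_id_minus_contraction[OF Y _ q] bop_funpow B)
  then obtain g where g: "bounded_operator_on Y g" "\<And>y. y \<in> Y \<Longrightarrow> g (y - (B ^^ n) y) = y"
    "\<And>y. y \<in> Y \<Longrightarrow> g y - (B ^^ n) (g y) = y"
    by (rule regular_onE) metis
  have gB: "B (g y) = g (B y)" if "y \<in> Y" for y
  proof (rule regular_on_inverse_commute[where f = "\<lambda>y. y - (B ^^ n) y", OF g _ _ that])
    show "B (z - (B ^^ n) z) = B z - (B ^^ n) (B z)" if "z \<in> Y" for z
      using that by (simp add: bop_diff[OF Y(1) B] bop_mem[OF bop_funpow[OF B]] funpow_swap1[of B])
  qed (simp_all add: bop_mem[OF B])
  show ?thesis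
  proof (rule regular_onI[where g = "\<lambda>y. S (g y)"])
    show "bounded_operator_on Y (\<lambda>y. y - B y)" by (intro bop_minus Y bop_ident B)
    show "bounded_operator_on Y (\<lambda>y. S (g y))" by (rule bop_comp[OF S g(1)])
    fix y assume y: "y \<in> Y"
    show "S (g y) - B (S (g y)) = y"
      using tele[of "g y"] g(3) y bop_mem[OF g(1)] by simp
    have "S (g (y - B y)) = S (g y - B (g y))"
      using y by (simp add: gB bop_diff[OF Y(1) g(1)] bop_mem[OF B])
    also have "\<dots> = S (g y) - B (S (g y))"
      using y by (simp add: SB bop_diff[OF Y(1) S] bop_mem[OF B] bop_mem[OF g(1)])
    finally show "S (g (y - B y)) = y"
      using tele[of "g y"] g(3) y bop_mem[OF g(1)] by simp
  qed
qed

text \<open>The lower bounds for single \<open>w\<close> become uniform on the compact set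
  \<open>D\<close> because \<open>A - w B\<close> depends continuously on \<open>w\<close>. With the
  identity in the place of \<open>A\<close> this serves \<open>1 - w B\<close>, with the identity in
  the place of \<open>B\<close> it serves \<open>T - w\<close>.\<close>

lemma regular_on_uniformly_bounded_below:
  fixes A :: "'a::complex_normed_vector \<Rightarrow> 'a" and D :: "complex set"
  assumes Y: "complex_vector.subspace Y" and A: "bounded_operator_on Y A" and B: "bounded_operator_on Y B"
    and D: "compact D" and reg: "\<And>w. w \<in> D \<Longrightarrow> regular_on Y (\<lambda>y. A y - w *\<^sub>C B y)"
  obtains c where "c > 0" "\<And>w y. w \<in> D \<Longrightarrow> y \<in> Y \<Longrightarrow> c * norm y \<le> norm (A y - w *\<^sub>C B y)"
proof (rule ccontr)
  assume contra: "\<not> thesis"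
  have "\<exists>w y. w \<in> D \<and> y \<in> Y \<and> norm (A y - w *\<^sub>C B y) < 1 / Suc n * norm y" for n
    using that[of "1 / Suc n"] contra by (force simp: not_le)
  then obtain w y where wy: "\<And>n. w n \<in> D" "\<And>n. y n \<in> Y"
    "\<And>n. norm (A (y n) - w n *\<^sub>C B (y n)) < 1 / Suc n * norm (y n)" by metis
  obtain w0 r where r: "w0 \<in> D" "strict_mono r" "(w \<circ> r) \<longlonglongrightarrow> w0"
    using D wy(1) by (metis compact_def)
  obtain c where c: "c > 0" "\<And>y. y \<in> Y \<Longrightarrow> c * norm y \<le> norm (A y - w0 *\<^sub>C B y)"
    using regular_on_bounded_below[OF reg[OF r(1)]] by metis
  obtain L where L: "L > 0" "\<And>y. y \<in> Y \<Longrightarrow> norm (B y) \<le> L * norm y"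
    using bop_bound[OF B] by metis
  \<comment> \<open>The factor \<open>norm ?y\<close> cancels, leaving an inequality between numbers
    whose right side tends to 0.\<close>
  have le: "c \<le> 1 / Suc (r n) + cmod (w (r n) - w0) * L" for n
  proof -
    let ?y = "y (r n)" and ?w = "w (r n)"
    have "A ?y - w0 *\<^sub>C B ?y = (A ?y - ?w *\<^sub>C B ?y) + (?w - w0) *\<^sub>C B ?y"
      by (simp add: complex_vector.scale_left_diff_distrib)
    then have "norm (A ?y - w0 *\<^sub>C B ?y) \<le> norm (A ?y - ?w *\<^sub>C B ?y) + norm ((?w - w0) *\<^sub>C B ?y)"
      by (metis norm_triangle_ineq)
    also have "norm ((?w - w0) *\<^sub>C B ?y) \<le> cmod (?w - w0) * (L * norm ?y)"
      using L(2)[OF wy(2)] by (simp add: norm_scaleC mult_left_mono)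
    finally have "c * norm ?y \<le> (1 / Suc (r n) + cmod (?w - w0) * L) * norm ?y"
      using c(2)[OF wy(2)[of "r n"]] wy(3)[of "r n"] by (simp add: distrib_right)
    moreover have "norm ?y > 0"
      using order_le_less_trans[OF norm_ge_zero wy(3)[of "r n"]] by (auto simp: zero_less_mult_iff)
    ultimately show ?thesis by (simp only: mult_le_cancel_right_pos)
  qed
  have "(\<lambda>n. 1 / Suc (r n) + cmod (w (r n) - w0) * L) \<longlonglongrightarrow> 0 + cmod (w0 - w0) * L"
    using r(3) LIMSEQ_subseq_LIMSEQ[OF LIMSEQ_inverse_real_of_nat r(2)]
    by (intro tendsto_intros) (simp_all add: o_def inverse_eq_divide)
  then have "c \<le> 0" using le by (intro LIMSEQ_le_const) auto
  with c(1) show False by simp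
qed

section \<open>Resolvents along repeated squaring\<close>

text \<open>Divide \<open>k\<close> by \<open>n\<close> with remainder: full blocks of
  \<open>n\<close> factors do not increase the norm, and fewer than \<open>n\<close> factors
  remain.\<close>

lemma power_bounded_of_power_contraction:
  assumes Y: "complex_vector.subspace Y" and A: "bounded_operator_on Y A" and n: "n > 0"
    and le: "\<And>y. y \<in> Y \<Longrightarrow> norm ((A ^^ n) y) \<le> norm y"
  obtains C where "C > 0" "\<And>k y. y \<in> Y \<Longrightarrow> norm ((A ^^ k) y) \<le> C * norm y"
proof -
  obtain K where K: "K > 0" "\<And>y. y \<in> Y \<Longrightarrow> norm (A y) \<le> K * norm y"
    using bop_bound[OF A] by metis
  \<comment> \<open>At least 1, so that \<open>L ^ i \<le> L ^ n\<close> for every remainder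
    \<open>i < n\<close>.\<close>
  define L where "L = max K 1"
  note pow_mem = bop_mem[OF bop_funpow[OF A]]
  have small: "norm ((A ^^ i) y) \<le> L ^ i * norm y" if "y \<in> Y" for i y
  proof (induction i)
    case (Suc i)
    have "norm ((A ^^ Suc i) y) \<le> K * norm ((A ^^ i) y)"
      using K(2)[OF pow_mem[OF that]] by simp
    also have "\<dots> \<le> L * (L ^ i * norm y)"
      using Suc K(1) by (intro mult_mono) (auto simp: L_def)
    finally show ?case by (simp add: mult.assoc)
  qed simp
  have mult: "norm ((A ^^ (n * q)) y) \<le> norm y" if "y \<in> Y" for q y
  proof (induction q)
    case (Suc q)
    have "(A ^^ (n * Suc q)) y = (A ^^ n) ((A ^^ (n * q)) y)"
      by (simp add: funpow_add)
    also have "norm \<dots> \<le> norm ((A ^^ (n * q)) y)"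
      by (rule le[OF pow_mem[OF that]])
    finally show ?case using Suc by simp
  qed simp
  have "norm ((A ^^ k) y) \<le> L ^ n * norm y" if "y \<in> Y" for k y
  proof -
    have "(A ^^ k) y = (A ^^ (k mod n)) ((A ^^ (n * (k div n))) y)"
      by (metis comp_apply funpow_add mod_mult_div_eq)
    also have "norm \<dots> \<le> L ^ (k mod n) * norm ((A ^^ (n * (k div n))) y)"
      by (rule small[OF pow_mem[OF that]])
    also have "\<dots> \<le> L ^ n * norm y"
      using n by (intro mult_mono mult[OF that] power_increasing) (auto simp: L_def less_imp_le)
    finally show ?thesis .
  qed
  moreover have "L ^ n > 0" by (simp add: L_def)
  ultimately show ?thesis using that by blast
qed

lemma closed_kernel_on:
  assumes Y: "complex_vector.subspace Y" "closed Y" and f: "bounded_operator_on Y f"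
  shows "complex_vector.subspace {y\<in>Y. f y = 0}" "closed {y\<in>Y. f y = 0}"
proof -
  show "complex_vector.subspace {y\<in>Y. f y = 0}"
    using complex_vector.subspace_0[OF Y(1)] complex_vector.subspace_add[OF Y(1)]
      complex_vector.subspace_scale[OF Y(1)] bop_zero[OF Y(1) f]
    by (intro complex_vector.subspaceI) (simp_all add: bop_add[OF f] bop_scaleC[OF f])
  obtain K where K: "K > 0" "\<And>y. y \<in> Y \<Longrightarrow> norm (f y) \<le> K * norm y"
    using bop_bound[OF f] by metis
  show "closed {y\<in>Y. f y = 0}"
    unfolding closed_sequential_limits
  proof (intro allI impI)
    fix x l assume xl: "(\<forall>n::nat. x n \<in> {y\<in>Y. f y = 0}) \<and> x \<longlonglongrightarrow> l"
    then have l: "l \<in> Y" using Y(2) by (auto simp: closed_sequential_limits)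
    have "norm (f l) \<le> K * norm (l - x n)" for n
      using K(2)[of "l - x n"] xl complex_vector.subspace_diff[OF Y(1) l]
        bop_diff[OF Y(1) f l, of "x n"] by auto
    moreover have "(\<lambda>n. K * norm (l - x n)) \<longlonglongrightarrow> K * norm (l - l)"
      using xl by (intro tendsto_intros) auto
    ultimately have "norm (f l) \<le> K * norm (l - l)"
      by (intro LIMSEQ_le_const) auto
    with l show "l \<in> {y\<in>Y. f y = 0}" by simp
  qed
qed

text \<open>\<open>g\<close> is \<open>(1 - c A)^-1\<close>. This normalisation, rather than
  \<open>(A - z)^-1\<close>, includes \<open>c = 0\<close> and turns squaring of \<open>A\<close>
  into squaring of \<open>c\<close>.\<close>

definition resolvent_at ::
    "'a::complex_normed_vector set \<Rightarrow> ('a \<Rightarrow> 'a) \<Rightarrow> complex \<Rightarrow> ('a \<Rightarrow> 'a) \<Rightarrow> bool" where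
  "resolvent_at Y A c g \<longleftrightarrow> bounded_operator_on Y g \<and>
     (\<forall>y\<in>Y. g (y - c *\<^sub>C A y) = y \<and> g y - c *\<^sub>C A (g y) = y)"

lemma resolvent_atD:
  assumes "resolvent_at Y A c g"
  shows "bounded_operator_on Y g" "\<And>y. y \<in> Y \<Longrightarrow> g (y - c *\<^sub>C A y) = y"
    "\<And>y. y \<in> Y \<Longrightarrow> g y - c *\<^sub>C A (g y) = y" "\<And>y. y \<in> Y \<Longrightarrow> c *\<^sub>C A (g y) = g y - y"
  using assms by (auto simp: resolvent_at_def algebra_simps)

lemma regular_on_resolvent_at:
  assumes "regular_on Y (\<lambda>y. y - c *\<^sub>C A y)"
  obtains g where "resolvent_at Y A c g"
proof -
  obtain g where "bounded_operator_on Y g" "\<And>y. y \<in> Y \<Longrightarrow> g (y - c *\<^sub>C A y) = y"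
    "\<And>y. y \<in> Y \<Longrightarrow> g y - c *\<^sub>C A (g y) = y"
    using regular_onE[OF assms] by metis
  then have "resolvent_at Y A c g" by (simp add: resolvent_at_def)
  then show ?thesis by (rule that)
qed

lemma half_scaleC: "(1 / 2 :: complex) *\<^sub>C (x + x) = (x :: 'a::complex_normed_vector)"
proof -
  have "x + x = (2 :: complex) *\<^sub>C x"
    using scaleC_add_left[of 1 1 x] by simp
  then show ?thesis by (simp add: scaleC_scaleC)
qed

text \<open>The partial fraction \<open>1 / (1 - x^2) = (1 / (1 - x) + 1 / (1 + x)) / 2\<close> with
  \<open>x = c A\<close>. The second claim is the factorisation
  \<open>1 - x^2 = (1 - x) (1 + x)\<close> read for the inverses; it makes the limit of the means
  idempotent.\<close>

lemma resolvent_at_double: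
  fixes A :: "'a::complex_normed_vector \<Rightarrow> 'a"
  assumes Y: "complex_vector.subspace Y" and A: "bounded_operator_on Y A"
    and g: "resolvent_at Y A c g" and g': "resolvent_at Y A (- c) g'"
  shows "resolvent_at Y (\<lambda>x. A (A x)) (c * c) (\<lambda>y. (1 / 2) *\<^sub>C (g y + g' y))"
    and "y \<in> Y \<Longrightarrow> g (g' y) = (1 / 2) *\<^sub>C (g y + g' y)"
proof -
  note bg = resolvent_atD(1)[OF g] and bg' = resolvent_atD(1)[OF g']
  note mem = bop_mem[OF A] bop_mem[OF bg] bop_mem[OF bg'] complex_vector.subspace_add[OF Y]
    complex_vector.subspace_scale[OF Y] complex_vector.subspace_diff[OF Y]
  note lin = bop_add[OF A] bop_scaleC[OF A] bop_diff[OF Y A]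
  show "resolvent_at Y (\<lambda>x. A (A x)) (c * c) (\<lambda>y. (1 / 2) *\<^sub>C (g y + g' y))"
    unfolding resolvent_at_def
  proof (intro conjI ballI)
    show "bounded_operator_on Y (\<lambda>y. (1 / 2) *\<^sub>C (g y + g' y))"
      by (intro bop_scale bop_plus Y bg bg')
    fix y assume y: "y \<in> Y"
    let ?z = "y - (c * c) *\<^sub>C A (A y)"
    have "g ?z = y + c *\<^sub>C A y"
      using resolvent_atD(2)[OF g, of "y + c *\<^sub>C A y"] y
      by (simp add: mem lin scaleC_scaleC scaleC_add_right)
    moreover have "g' ?z = y - c *\<^sub>C A y"
      using resolvent_atD(2)[OF g', of "y - c *\<^sub>C A y"] y
      by (simp add: mem lin scaleC_scaleC complex_vector.scale_right_diff_distrib)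
    ultimately have "g ?z + g' ?z = y + y" by simp
    then show "(1 / 2) *\<^sub>C (g ?z + g' ?z) = y"
      by (simp only: half_scaleC)
    have 1: "c *\<^sub>C A (g y) = g y - y" and 2: "c *\<^sub>C A (g' y) = y - g' y"
      using resolvent_atD(4)[OF g y] resolvent_atD(4)[OF g' y] by (simp_all add: algebra_simps)
    have "(c * c) *\<^sub>C A (A (g y)) = c *\<^sub>C A (c *\<^sub>C A (g y))"
      using y by (simp add: mem lin scaleC_scaleC)
    also have "\<dots> = g y - y - c *\<^sub>C A y"
      using y 1 by (simp add: mem lin complex_vector.scale_right_diff_distrib)
    finally have 3: "(c * c) *\<^sub>C A (A (g y)) = g y - y - c *\<^sub>C A y" .
    have "(c * c) *\<^sub>C A (A (g' y)) = c *\<^sub>C A (c *\<^sub>C A (g' y))"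
      using y by (simp add: mem lin scaleC_scaleC)
    also have "\<dots> = c *\<^sub>C A y - (y - g' y)"
      using y 2 by (simp add: mem lin complex_vector.scale_right_diff_distrib)
    finally have 4: "(c * c) *\<^sub>C A (A (g' y)) = c *\<^sub>C A y - (y - g' y)" .
    have "(c * c) *\<^sub>C A (A ((1 / 2) *\<^sub>C (g y + g' y)))
        = (1 / 2) *\<^sub>C ((c * c) *\<^sub>C A (A (g y)) + (c * c) *\<^sub>C A (A (g' y)))"
      using y by (simp add: mem lin scaleC_scaleC scaleC_add_right mult.commute)
    also have "\<dots> = (1 / 2) *\<^sub>C (g y + g' y) - (1 / 2) *\<^sub>C (y + y)"
      unfolding 3 4 by (simp add: complex_vector.scale_right_diff_distrib scaleC_add_right algebra_simps)
    finally show "(1 / 2) *\<^sub>C (g y + g' y) - (c * c) *\<^sub>C A (A ((1 / 2) *\<^sub>C (g y + g' y))) = y"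
      by (simp only: half_scaleC diff_diff_eq2 add_diff_cancel_left')
  qed
  assume y: "y \<in> Y"
  have 1: "c *\<^sub>C A (g y) = g y - y" and 2: "c *\<^sub>C A (g' y) = y - g' y"
    using resolvent_atD(4)[OF g y] resolvent_atD(4)[OF g' y] by (simp_all add: algebra_simps)
  let ?u = "(1 / 2) *\<^sub>C (g y + g' y)"
  have "c *\<^sub>C A ?u = (1 / 2) *\<^sub>C (c *\<^sub>C A (g y) + c *\<^sub>C A (g' y))"
    using y by (simp add: mem lin scaleC_scaleC scaleC_add_right mult.commute)
  also have "\<dots> = ?u - (1 / 2) *\<^sub>C (g' y + g' y)"
    unfolding 1 2 by (simp add: complex_vector.scale_right_diff_distrib scaleC_add_right algebra_simps)
  finally have "?u - c *\<^sub>C A ?u = g' y"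
    by (simp only: half_scaleC diff_diff_eq2 add_diff_cancel_left')
  moreover have "?u \<in> Y" using y by (simp add: mem)
  ultimately show "g (g' y) = ?u"
    using resolvent_atD(2)[OF g, of ?u] by simp
qed

text \<open>The resolvent identity, which turns a bound on the resolvents into a Lipschitz estimate
  in the parameter.\<close>

lemma resolvent_at_diff:
  assumes Y: "complex_vector.subspace Y" and A: "bounded_operator_on Y A"
    and g: "resolvent_at Y A c g" and g': "resolvent_at Y A d g'" and y: "y \<in> Y"
  shows "g y - g' y = (c - d) *\<^sub>C g (A (g' y))"
proof -
  note bg = resolvent_atD(1)[OF g] and bg' = resolvent_atD(1)[OF g']
  define v where "v = g' y"
  have v: "v \<in> Y" "A v \<in> Y" using y by (auto simp: v_def intro: bop_mem[OF bg'] bop_mem[OF A])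
  have "y = (v - c *\<^sub>C A v) + (c - d) *\<^sub>C A v"
    using resolvent_atD(3)[OF g' y] by (simp add: v_def complex_vector.scale_left_diff_distrib)
  then have "g y = v + (c - d) *\<^sub>C g (A v)"
    using bop_add[OF bg, of "v - c *\<^sub>C A v" "(c - d) *\<^sub>C A v"] v resolvent_atD(2)[OF g v(1)]
    by (simp add: bop_scaleC[OF bg] complex_vector.subspace_diff[OF Y] complex_vector.subspace_scale[OF Y])
  then show ?thesis by (simp add: v_def)
qed

lemma resolvent_at_commute:
  assumes g: "resolvent_at Y A c g" and Y: "complex_vector.subspace Y" and A: "bounded_operator_on Y A"
    and B: "bounded_operator_on Y B" and comm: "\<And>y. y \<in> Y \<Longrightarrow> B (A y) = A (B y)" and y: "y \<in> Y"
  shows "B (g y) = g (B y)"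
proof (rule regular_on_inverse_commute[where f = "\<lambda>y. y - c *\<^sub>C A y", OF resolvent_atD(1-3)[OF g] _ _ y])
  show "B (y - c *\<^sub>C A y) = B y - c *\<^sub>C A (B y)" if "y \<in> Y" for y
    using that by (simp add: bop_diff[OF Y B] bop_scaleC[OF B] comm bop_mem[OF A]
        complex_vector.subspace_scale[OF Y])
qed (simp_all add: bop_mem[OF B])

text \<open>On the convex left half-plane the derivative satisfies
  \<open>|exp z| = exp (Re z) \<le> 1\<close>.\<close>

lemma exp_lipschitz_left_half_plane:
  assumes "Re z \<le> 0" "Re w \<le> 0"
  shows "cmod (exp z - exp w) \<le> cmod (z - w)"
proof -
  have "norm (exp w - exp z) \<le> 1 * norm (w - z)"
  proof (rule field_differentiable_bound[where S = "{z. Re z \<le> 0}" and f' = exp])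
    show "convex {z. Re z \<le> 0}" by (rule convex_halfspace_Re_le)
    show "(exp has_field_derivative exp z) (at z within {z. Re z \<le> 0})" for z
      by (intro DERIV_exp[THEN has_field_derivative_at_within])
  qed (use assms in auto)
  then show ?thesis by (simp add: norm_minus_commute)
qed

text \<open>If \<open>G z = (1 - exp z A)\<^sup>-\<^sup>1\<close>, then the \<open>k\<close>-th mean at \<open>z\<close> is \<open>(1 - exp z A\<^sup>n)\<^sup>-\<^sup>1\<close> with \<open>n = 2\<^sup>k\<close>,
  because \<open>(1 - c\<^sup>2B\<^sup>2)\<^sup>-\<^sup>1\<close> is the mean of \<open>(1 - c B)\<^sup>-\<^sup>1\<close> and \<open>(1 + c B)\<^sup>-\<^sup>1\<close>. Halving the exponent also halves
  the Lipschitz constant; this replaces contour integration.\<close>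

primrec resolvent_mean :: "(complex \<Rightarrow> 'a::complex_normed_vector \<Rightarrow> 'a) \<Rightarrow> nat \<Rightarrow> complex \<Rightarrow> 'a \<Rightarrow> 'a" where
  "resolvent_mean G 0 = G"
| "resolvent_mean G (Suc k) = (\<lambda>z y. (1 / 2) *\<^sub>C
     (resolvent_mean G k (z / 2) y + resolvent_mean G k (z / 2 + \<i> * of_real pi) y))"

text \<open>Writing the parameter as \<open>exp z\<close> turns squaring of \<open>c\<close> into
  doubling of \<open>z\<close> and the change of sign into a shift by \<open>i pi\<close>; hence the
  closure conditions on \<open>W\<close>. It will be the left half-plane for spectral radii and the
  imaginary axis for spectral projections. \<open>M\<close> is uniform because the means run over
  ever more points.\<close>

locale resolvent_family =
  fixes Y :: "'a::cbanach set" and A :: "'a \<Rightarrow> 'a" and W :: "complex set"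
    and G :: "complex \<Rightarrow> 'a \<Rightarrow> 'a" and M :: real
  assumes subspace: "complex_vector.subspace Y" and closed: "closed Y"
    and bop: "bounded_operator_on Y A"
    and G: "z \<in> W \<Longrightarrow> resolvent_at Y A (exp z) (G z)"
    and W_half: "z \<in> W \<Longrightarrow> z / 2 \<in> W" and W_shift: "z \<in> W \<Longrightarrow> z + \<i> * of_real pi \<in> W"
    and W_Re: "z \<in> W \<Longrightarrow> Re z \<le> 0"
    and M_pos: "M > 0" and G_bound: "z \<in> W \<Longrightarrow> y \<in> Y \<Longrightarrow> norm (G z y) \<le> M * norm y"
begin

abbreviation "h \<equiv> resolvent_mean G"

lemma funpow_double: "(A ^^ 2 ^ Suc k) = (\<lambda>y. (A ^^ 2 ^ k) ((A ^^ 2 ^ k) y))"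
  by (simp add: mult_2 funpow_add o_def)

lemma exp_half: "exp (z / 2) * exp (z / 2) = exp (z::complex)"
  by (simp flip: exp_add)

lemma exp_half_shift: "exp (z / 2 + \<i> * of_real pi) = - exp (z / 2)"
  by (simp add: exp_add)

lemma h_resolvent: "z \<in> W \<Longrightarrow> resolvent_at Y (A ^^ 2 ^ k) (exp z) (h k z)"
proof (induction k arbitrary: z)
  case 0
  then show ?case using G by simp
next
  case (Suc k)
  from Suc.IH[OF W_half[OF Suc.prems]] Suc.IH[OF W_shift[OF W_half[OF Suc.prems]]]
  show ?case
    unfolding exp_half_shift funpow_double exp_half[of z, symmetric] resolvent_mean.simps
    by (intro resolvent_at_double(1) subspace bop_funpow bop)
qed

lemma h_mult:
  assumes "z \<in> W" "y \<in> Y"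
  shows "h k (z / 2) (h k (z / 2 + \<i> * of_real pi) y) = h (Suc k) z y"
  using h_resolvent[OF W_half[OF assms(1)], of k] h_resolvent[OF W_shift[OF W_half[OF assms(1)]], of k]
    resolvent_at_double(2)[OF subspace bop_funpow[OF bop] _ _ assms(2)]
  unfolding exp_half_shift resolvent_mean.simps by metis

lemma h_bop: "z \<in> W \<Longrightarrow> bounded_operator_on Y (h k z)"
  by (rule resolvent_atD(1)[OF h_resolvent])

lemma norm_half: "norm ((1 / 2 :: complex) *\<^sub>C (x + y)) \<le> (norm x + norm y) / 2" for x y :: 'a
  using norm_triangle_ineq[of x y] by (simp add: norm_scaleC)

lemma le_mean: "x \<le> (a + b) / 2 \<Longrightarrow> a \<le> c \<Longrightarrow> b \<le> c \<Longrightarrow> x \<le> c" for a b c x :: real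
  by simp

lemma h_bound: "z \<in> W \<Longrightarrow> y \<in> Y \<Longrightarrow> norm (h k z y) \<le> M * norm y"
proof (induction k arbitrary: z)
  case 0
  then show ?case using G_bound by simp
next
  case (Suc k)
  have "norm (h (Suc k) z y) \<le> (norm (h k (z / 2) y) + norm (h k (z / 2 + \<i> * of_real pi) y)) / 2"
    using norm_half by simp
  then show ?case
    using Suc.IH[OF W_half[OF Suc.prems(1)] Suc.prems(2)]
      Suc.IH[OF W_shift[OF W_half[OF Suc.prems(1)]] Suc.prems(2)] by (rule le_mean)
qed

lemma h_lipschitz:
  obtains L where "L > 0"
    "\<And>k z w y. z \<in> W \<Longrightarrow> w \<in> W \<Longrightarrow> y \<in> Y \<Longrightarrow> norm (h k z y - h k w y) \<le> L / 2 ^ k * cmod (z - w) * norm y"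
proof -
  obtain K where K: "K > 0" "\<And>y. y \<in> Y \<Longrightarrow> norm (A y) \<le> K * norm y"
    using bop_bound[OF bop] by metis
  \<comment> \<open>The resolvent identity contains two resolvents, each bounded by
    \<open>M\<close>, with \<open>A\<close> between them.\<close>
  define L where "L = M * (K * M)"
  have "norm (h k z y - h k w y) \<le> L / 2 ^ k * cmod (z - w) * norm y"
    if "z \<in> W" "w \<in> W" and y: "y \<in> Y" for k z w y
    using that(1,2)
  proof (induction k arbitrary: z w)
    case 0
    have mem: "G w y \<in> Y" "A (G w y) \<in> Y"
      using bop_mem[OF resolvent_atD(1)[OF G[OF 0(2)]] y] bop_mem[OF bop] by auto
    have "norm (G z (A (G w y))) \<le> M * norm (A (G w y))"
      by (rule G_bound[OF 0(1) mem(2)])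
    also have "\<dots> \<le> M * (K * norm (G w y))"
      using K(2)[OF mem(1)] M_pos by (intro mult_left_mono) auto
    also have "\<dots> \<le> M * (K * (M * norm y))"
      using G_bound[OF 0(2) y] M_pos K(1) by (intro mult_left_mono) auto
    finally have "norm (G z (A (G w y))) \<le> L * norm y" by (simp add: L_def mult.assoc)
    then have "cmod (exp z - exp w) * norm (G z (A (G w y))) \<le> cmod (z - w) * (L * norm y)"
      using exp_lipschitz_left_half_plane[OF W_Re[OF 0(1)] W_Re[OF 0(2)]]
      by (intro mult_mono) auto
    then show ?case
      using resolvent_at_diff[OF subspace bop G[OF 0(1)] G[OF 0(2)] y]
      by (simp add: norm_scaleC mult_ac)
  next
    case (Suc k)
    let ?s = "\<lambda>z. z / 2 + \<i> * of_real pi"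
    have half: "cmod (z / 2 - w / 2) = cmod (z - w) / 2" "cmod (?s z - ?s w) = cmod (z - w) / 2"
      by (simp_all flip: diff_divide_distrib)
    have "h (Suc k) z y - h (Suc k) w y = (1 / 2) *\<^sub>C
        ((h k (z / 2) y - h k (w / 2) y) + (h k (?s z) y - h k (?s w) y))"
      by (simp add: scaleC_add_right complex_vector.scale_right_diff_distrib)
    then have "norm (h (Suc k) z y - h (Suc k) w y) \<le>
        (norm (h k (z / 2) y - h k (w / 2) y) + norm (h k (?s z) y - h k (?s w) y)) / 2"
      using norm_half by metis
    then have "norm (h (Suc k) z y - h (Suc k) w y) \<le> L / 2 ^ k * (cmod (z - w) / 2) * norm y"
      using Suc.IH[OF W_half[OF Suc.prems(1)] W_half[OF Suc.prems(2)]]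
        Suc.IH[OF W_shift[OF W_half[OF Suc.prems(1)]] W_shift[OF W_half[OF Suc.prems(2)]]]
      unfolding half by (rule le_mean)
    then show ?case by (simp add: field_simps)
  qed
  moreover have "L > 0" using M_pos K(1) by (simp add: L_def)
  ultimately show ?thesis using that by blast
qed

end

text \<open>Compactness is asked of a superset \<open>D\<close> of the image of \<open>W\<close>:
  \<open>exp\<close> maps the left half-plane onto the closed unit disc without 0, and only adding 0
  gives a compact set. The uniform lower bound over \<open>D\<close> provides
  \<open>M\<close>.\<close>

lemma resolvent_family_exists:
  fixes A :: "'a::cbanach \<Rightarrow> 'a"
  assumes Y: "complex_vector.subspace Y" "closed Y" and A: "bounded_operator_on Y A"
    and D: "compact D" "\<And>z. z \<in> W \<Longrightarrow> exp z \<in> D"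
    and W: "\<And>z. z \<in> W \<Longrightarrow> z / 2 \<in> W" "\<And>z. z \<in> W \<Longrightarrow> z + \<i> * of_real pi \<in> W" "\<And>z. z \<in> W \<Longrightarrow> Re z \<le> 0"
    and reg: "\<And>w. w \<in> D \<Longrightarrow> regular_on Y (\<lambda>y. y - w *\<^sub>C A y)"
  obtains G M where "resolvent_family Y A W G M"
proof -
  obtain c where c: "c > 0" "\<And>w y. w \<in> D \<Longrightarrow> y \<in> Y \<Longrightarrow> c * norm y \<le> norm (y - w *\<^sub>C A y)"
    using regular_on_uniformly_bounded_below[OF Y(1) bop_ident A D(1) reg] by metis
  have "\<forall>z. \<exists>g. z \<in> W \<longrightarrow> resolvent_at Y A (exp z) g"
    using regular_on_resolvent_at[OF reg[OF D(2)]] by metis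
  then obtain G where G: "\<And>z. z \<in> W \<Longrightarrow> resolvent_at Y A (exp z) (G z)" by metis
  have "norm (G z y) \<le> 1 / c * norm y" if "z \<in> W" "y \<in> Y" for z y
    using c(2)[OF D(2)[OF that(1)], of "G z y"] c(1) resolvent_atD(3)[OF G that(2), of z] that
      bop_mem[OF resolvent_atD(1)[OF G], of z y] by (simp add: field_simps)
  then have "resolvent_family Y A W G (1 / c)"
    using Y A G W c(1) by unfold_locales simp_all
  then show ?thesis using that by blast
qed

section \<open>Spectral radius and spectral projections\<close>

context resolvent_family
begin

text \<open>Apply the nearness to \<open>u - B u\<close> with \<open>B = exp z A^n\<close>,
  \<open>n = 2^k\<close>: its image is \<open>u\<close>, so the error is exactly \<open>B u\<close>,
  and \<open>|B u| \<le> (|u| + |B u|) / 4\<close>.\<close>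

lemma power_contraction:
  assumes z: "z \<in> W" and near: "\<And>y. y \<in> Y \<Longrightarrow> norm (h k z y - y) \<le> 1 / 4 * norm y" and u: "u \<in> Y"
  shows "cmod (exp z) * norm ((A ^^ 2 ^ k) u) \<le> 1 / 2 * norm u"
proof -
  let ?B = "\<lambda>u. exp z *\<^sub>C (A ^^ 2 ^ k) u"
  have "u - ?B u \<in> Y"
    by (intro complex_vector.subspace_diff complex_vector.subspace_scale subspace u
        bop_mem[OF bop_funpow[OF bop]])
  from near[OF this] have "norm (?B u) \<le> 1 / 4 * norm (u - ?B u)"
    unfolding resolvent_atD(2)[OF h_resolvent[OF z] u] by simp
  with norm_triangle_ineq4[of u "?B u"] norm_ge_zero[of u] have "norm (?B u) \<le> 1 / 2 * norm u" by argo
  then show ?thesis by (simp add: norm_scaleC)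
qed

end

text \<open>A closed-disc form of the spectral radius formula. For large \<open>t\<close> the
  operator \<open>exp (- t) A\<close> is a contraction, and invertibility on the disc lets
  \<open>t\<close> descend to 0. The descent advances by a fixed amount each time, since the
  Lipschitz constant \<open>L / 2^j\<close> of the means cancels the factor \<open>2^j\<close> by
  which powers stretch the logarithmic parameter.\<close>

lemma power_bounded_unit:
  fixes Y :: "'a::cbanach set"
  assumes Y: "complex_vector.subspace Y" "closed Y" and A: "bounded_operator_on Y A"
    and reg: "\<And>w. cmod w \<le> 1 \<Longrightarrow> regular_on Y (\<lambda>y. y - w *\<^sub>C A y)"
  obtains C where "C > 0" "\<And>k y. y \<in> Y \<Longrightarrow> norm ((A ^^ k) y) \<le> C * norm y"
proof -
  define W where "W = {z. Re z \<le> 0}"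
  obtain G M where "resolvent_family Y A W G M"
    by (rule resolvent_family_exists[OF Y A compact_cball[of 0 1], of W]) (auto simp: W_def reg)
  then interpret resolvent_family Y A W G M .
  obtain L where L: "L > 0"
    "\<And>k z w y. z \<in> W \<Longrightarrow> w \<in> W \<Longrightarrow> y \<in> Y \<Longrightarrow> norm (h k z y - h k w y) \<le> L / 2 ^ k * cmod (z - w) * norm y"
    using h_lipschitz by blast
  \<comment> \<open>Measures the progress of the descent: after rescaling by
    \<open>exp (- t)\<close> some dyadic power halves norms. The exponent may grow as
    \<open>t\<close> falls.\<close>
  define E where "E t k \<longleftrightarrow> (\<forall>y\<in>Y. exp (- (2 ^ k * t)) * norm ((A ^^ 2 ^ k) y) \<le> 1 / 2 * norm y)"
    for t :: real and k :: nat
  note pow_mem = bop_mem[OF bop_funpow[OF A]]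
  have step: "\<exists>k. E t' k" if E: "E t k" and t: "0 \<le> t'" "t' \<le> t" "t - t' \<le> 1 / (8 * L)" for t t' k
  proof -
    \<comment> \<open>Two more squarings improve the factor 1/2 to 1/16, which leaves room for the
      error 1/8 made in passing from \<open>t\<close> to \<open>t'\<close>.\<close>
    define j where "j = Suc (Suc k)"
    define a where "a = exp (- (2 ^ k * t))"
    have a: "a * norm ((A ^^ 2 ^ k) y) \<le> 1 / 2 * norm y" if "y \<in> Y" for y
      using E that by (simp add: E_def a_def)
    have pow4: "A ^^ 2 ^ j = (\<lambda>y. (A ^^ 2 ^ k) ((A ^^ 2 ^ k) ((A ^^ 2 ^ k) ((A ^^ 2 ^ k) y))))"
      unfolding j_def by (simp only: funpow_double)
    have a4: "exp (- (2 ^ j * t)) = a * (a * (a * a))"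
      by (simp add: a_def j_def flip: exp_add)
    have a_pos: "a > 0" by (simp add: a_def)
    have small: "exp (- (2 ^ j * t)) * norm ((A ^^ 2 ^ j) y) \<le> 1 / 16 * norm y" if y: "y \<in> Y" for y
    proof -
      let ?N = "\<lambda>y. (A ^^ 2 ^ k) y"
      have s: "a * (b * norm (?N v)) \<le> 1 / 2 * (b * norm v)" if "b \<ge> 0" "v \<in> Y" for b v
        using mult_left_mono[OF a[OF that(2)] that(1)] by (simp add: mult_ac)
      have "a * (a * (a * a)) * norm (?N (?N (?N (?N y)))) = a * (a * a * a * norm (?N (?N (?N (?N y)))))"
        by simp
      also have "\<dots> \<le> 1 / 2 * (a * a * a * norm (?N (?N (?N y))))"
        using a_pos by (intro s pow_mem y) simp
      also have "a * a * a * norm (?N (?N (?N y))) = a * (a * a * norm (?N (?N (?N y))))" by simp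
      also have "\<dots> \<le> 1 / 2 * (a * a * norm (?N (?N y)))"
        using a_pos by (intro s pow_mem y) simp
      also have "a * a * norm (?N (?N y)) = a * (a * norm (?N (?N y)))" by simp
      also have "\<dots> \<le> 1 / 2 * (a * norm (?N y))"
        using a_pos by (intro s pow_mem y) simp
      also have "a * norm (?N y) \<le> 1 / 2 * norm y" by (rule a[OF y])
      finally show ?thesis unfolding a4 pow4 by simp
    qed
    define z w where "z = complex_of_real (- (2 ^ j * t))" and "w = complex_of_real (- (2 ^ j * t'))"
    have zw: "z \<in> W" "w \<in> W" using t by (simp_all add: z_def w_def W_def)
    have nexp: "cmod (exp z) = exp (- (2 ^ j * t))" "cmod (exp w) = exp (- (2 ^ j * t'))"
      by (simp_all add: z_def w_def)
    have "norm (h j w y - y) \<le> 1 / 4 * norm y" if y: "y \<in> Y" for y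
    proof -
      let ?u = "h j z y"
      have u: "?u \<in> Y" by (rule bop_mem[OF h_bop[OF zw(1)] y])
      have "norm (?u - y) = cmod (exp z) * norm ((A ^^ 2 ^ j) ?u)"
        using resolvent_atD(4)[OF h_resolvent[OF zw(1)] y] by (metis norm_scaleC)
      also have "\<dots> \<le> 1 / 16 * norm ?u" unfolding nexp by (rule small[OF u])
      finally have 1: "norm (?u - y) \<le> 1 / 16 * norm ?u" .
      have "norm ?u \<le> norm y + norm (?u - y)" by (metis add.commute norm_triangle_sub)
      \<comment> \<open>\<open>|u - y| \<le> (|y| + |u - y|) / 16\<close> gives
        \<open>|u - y| \<le> |y| / 15\<close>.\<close>
      with 1 norm_ge_zero[of y] have 2: "norm (?u - y) \<le> 1 / 8 * norm y" by argo
      have "cmod (w - z) = \<bar>2 ^ j * (t - t')\<bar>"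
        unfolding z_def w_def of_real_diff[symmetric] norm_of_real by (simp add: algebra_simps)
      then have d: "cmod (w - z) = 2 ^ j * (t - t')" using t by simp
      have "norm (h j w y - ?u) \<le> L / 2 ^ j * cmod (w - z) * norm y"
        by (rule L(2)[OF zw(2,1) y])
      \<comment> \<open>The level \<open>j\<close> has dropped out, so the step length
        \<open>1 / (8 * L)\<close> is the same at every stage.\<close>
      also have "L / 2 ^ j * cmod (w - z) = L * (t - t')" by (simp add: d)
      also have "\<dots> * norm y \<le> 1 / 8 * norm y"
        using t(3) L(1) by (intro mult_right_mono) (simp_all add: field_simps)
      finally have 3: "norm (h j w y - ?u) \<le> 1 / 8 * norm y" .
      have "norm (h j w y - y) \<le> norm (h j w y - ?u) + norm (?u - y)"
        using norm_triangle_ineq[of "h j w y - ?u" "?u - y"] by simp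
      with 2 3 show ?thesis by linarith
    qed
    then have "E t' j"
      unfolding E_def nexp(2)[symmetric] by (intro ballI power_contraction[OF zw(2)])
    then show ?thesis ..
  qed
  obtain K where K: "K > 0" "\<And>y. y \<in> Y \<Longrightarrow> norm (A y) \<le> K * norm y"
    using bop_bound[OF A] by metis
  \<comment> \<open>Chosen so that \<open>exp (- t0) * K \<le> 1 / 2\<close>, which gives
    \<open>E t0 0\<close>; the absolute value keeps \<open>t0\<close> nonnegative.\<close>
  define t0 where "t0 = \<bar>ln (2 * K)\<bar>"
  have "exp (- t0) * K \<le> 1 / 2"
  proof -
    have "exp (- t0) \<le> exp (- ln (2 * K))" by (simp add: t0_def)
    then show ?thesis using K(1) by (simp add: exp_minus field_simps)
  qed
  then have K': "exp (- t0) * (K * norm y) \<le> 1 / 2 * norm y" for y :: 'a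
    using mult_right_mono[of "exp (- t0) * K" "1 / 2" "norm y"] by (simp add: mult_ac)
  have "exp (- t0) * norm (A y) \<le> 1 / 2 * norm y" if "y \<in> Y" for y
    by (rule order_trans[OF mult_left_mono[OF K(2)[OF that]] K']) simp
  then have "E t0 0" by (simp add: E_def)
  then have start: "\<exists>k. E (max 0 (t0 - 0 / (8 * L))) k" by (auto simp: t0_def)
  have desc: "\<exists>k. E (max 0 (t0 - real m / (8 * L))) k" for m
  proof (induction m)
    case 0
    then show ?case using start by simp
  next
    case (Suc m)
    then obtain k where k: "E (max 0 (t0 - real m / (8 * L))) k" ..
    have "real (Suc m) / (8 * L) = real m / (8 * L) + 1 / (8 * L)"
      by (simp add: add_divide_distrib)
    moreover have "1 / (8 * L) > 0" using L(1) by simp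
    ultimately show ?case by (intro step[OF k]) linarith+
  qed
  obtain m where "t0 * (8 * L) \<le> real m" using real_arch_simple by blast
  then have "t0 \<le> real m / (8 * L)" using L(1) by (simp add: field_simps)
  then have "max 0 (t0 - real m / (8 * L)) = 0" by simp
  with desc[of m] obtain k where k: "E 0 k" by auto
  have "norm ((A ^^ 2 ^ k) y) \<le> norm y" if "y \<in> Y" for y
  proof -
    have "norm ((A ^^ 2 ^ k) y) \<le> 1 / 2 * norm y"
      using k that by (simp add: E_def)
    then show ?thesis using norm_ge_zero[of y] by linarith
  qed
  then show ?thesis
    using power_bounded_of_power_contraction[OF Y(1) A, of "2 ^ k"] that by (metis zero_less_power zero_less_numeral)
qed

section \<open>Growth of powers from the location of the spectrum\<close>

lemma funpow_scaleC:
  assumes "complex_vector.subspace Y" "bounded_operator_on Y A" "y \<in> Y"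
  shows "((\<lambda>y. c *\<^sub>C A y) ^^ k) y = c ^ k *\<^sub>C (A ^^ k) y"
  by (induction k)
    (simp_all add: bop_scaleC[OF assms(2)] bop_mem[OF bop_funpow[OF assms(2)] assms(3)] scaleC_scaleC)

lemma power_bounded_of_regular:
  fixes Y :: "'a::cbanach set"
  assumes Y: "complex_vector.subspace Y" "closed Y" and A: "bounded_operator_on Y A" and s: "s \<ge> 0"
    and reg: "\<And>w. cmod w \<le> s \<Longrightarrow> regular_on Y (\<lambda>y. y - w *\<^sub>C A y)"
  obtains C where "C > 0" "\<And>k y. y \<in> Y \<Longrightarrow> s ^ k * norm ((A ^^ k) y) \<le> C * norm y"
proof -
  have "regular_on Y (\<lambda>y. y - w *\<^sub>C (of_real s *\<^sub>C A y))" if "cmod w \<le> 1" for w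
    using reg[of "w * of_real s"] that s by (simp add: scaleC_scaleC norm_mult mult_left_le_one_le)
  from power_bounded_unit[OF Y bop_scale[OF Y(1) A] this]
  obtain C where C: "C > 0" "\<And>k y. y \<in> Y \<Longrightarrow> norm (((\<lambda>y. of_real s *\<^sub>C A y) ^^ k) y) \<le> C * norm y"
    by blast
  have "s ^ k * norm ((A ^^ k) y) \<le> C * norm y" if "y \<in> Y" for k y
    using C(2)[OF that, of k] s by (simp add: funpow_scaleC[OF Y(1) A that] norm_scaleC norm_power)
  with C(1) show ?thesis using that by blast
qed

text \<open>With \<open>w = 1 / z\<close> the exterior \<open>|z| \<ge> r\<close> becomes the
  punctured disc of radius \<open>1 / r\<close>, because \<open>1 - w A = - w (A - z)\<close>; at
  \<open>w = 0\<close> the operator is the identity.\<close>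

lemma power_bounded_of_shifts_regular:
  fixes Y :: "'a::cbanach set"
  assumes Y: "complex_vector.subspace Y" "closed Y" and A: "bounded_operator_on Y A" and r: "r > 0"
    and reg: "\<And>z. cmod z \<ge> r \<Longrightarrow> regular_on Y (\<lambda>y. A y - z *\<^sub>C y)"
  obtains C where "C > 0" "\<And>k y. y \<in> Y \<Longrightarrow> norm ((A ^^ k) y) \<le> C * r ^ k * norm y"
proof -
  have "regular_on Y (\<lambda>y. y - w *\<^sub>C A y)" if w: "cmod w \<le> 1 / r" for w
  proof (cases "w = 0")
    case True
    have "regular_on Y (\<lambda>y. y)"
      by (rule regular_onI[OF bop_ident bop_ident]) auto
    then show ?thesis using True by simp
  next
    case False
    then have "r \<le> cmod (1 / w)" using w r by (simp add: norm_divide field_simps)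
    from regular_on_scale[OF Y(1) reg[OF this], of "- w"] False
    show ?thesis by (simp add: complex_vector.scale_right_diff_distrib scaleC_scaleC)
  qed
  moreover have "1 / r \<ge> 0" using r by simp
  ultimately obtain C where C: "C > 0" "\<And>k y. y \<in> Y \<Longrightarrow> (1 / r) ^ k * norm ((A ^^ k) y) \<le> C * norm y"
    using power_bounded_of_regular[OF Y A] by blast
  have "norm ((A ^^ k) y) \<le> C * r ^ k * norm y" if "y \<in> Y" for k y
    using C(2)[OF that, of k] r by (simp add: field_simps)
  with C(1) show ?thesis using that by blast
qed

section \<open>Spectral projections\<close>

lemma bop_limit:
  fixes Y :: "'a::complex_normed_vector set"
  assumes Y: "closed Y" and f: "\<And>k. bounded_operator_on Y (f k)"
    and M: "\<And>k y. y \<in> Y \<Longrightarrow> norm (f k y) \<le> M * norm y"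
    and lim: "\<And>y. y \<in> Y \<Longrightarrow> (\<lambda>k. f k y) \<longlonglongrightarrow> P y"
    and Y': "complex_vector.subspace Y"
  shows "bounded_operator_on Y P"
  unfolding bounded_operator_on_def image_subset_iff
proof (intro conjI ballI allI)
  show "P y \<in> Y" if "y \<in> Y" for y
    using closed_sequentially[OF Y _ lim[OF that]] bop_mem[OF f that] by blast
  show "P (x + y) = P x + P y" if "x \<in> Y" "y \<in> Y" for x y
    using tendsto_add[OF lim[OF that(1)] lim[OF that(2)]] lim[of "x + y"] that
    by (simp add: bop_add[OF f that] complex_vector.subspace_add[OF Y'] LIMSEQ_unique)
  show "P (c *\<^sub>C y) = c *\<^sub>C P y" if "y \<in> Y" for c y
    using bounded_linear.tendsto[OF bounded_linear_scaleC lim[OF that], of c] lim[of "c *\<^sub>C y"] that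
    by (simp add: bop_scaleC[OF f that] complex_vector.subspace_scale[OF Y'] LIMSEQ_unique)
  have "norm (P y) \<le> M * norm y" if "y \<in> Y" for y
    using tendsto_norm[OF lim[OF that]] M[OF that] by (intro LIMSEQ_le_const2) auto
  then show "\<exists>K. \<forall>y\<in>Y. norm (P y) \<le> K * norm y" by blast
qed

lemma bop_tendsto:
  assumes Y: "complex_vector.subspace Y" and B: "bounded_operator_on Y B"
    and x: "\<And>k::nat. x k \<in> Y" "l \<in> Y" "x \<longlonglongrightarrow> l"
  shows "(\<lambda>k. B (x k)) \<longlonglongrightarrow> B l"
proof -
  obtain K where K: "K > 0" "\<And>y. y \<in> Y \<Longrightarrow> norm (B y) \<le> K * norm y"
    using bop_bound[OF B] by metis
  have "(\<lambda>k. x k - l) \<longlonglongrightarrow> 0" using x(3) by (simp add: LIM_zero)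
  then have "(\<lambda>k. B (x k) - B l) \<longlonglongrightarrow> 0"
    by (rule tendsto_0_le[where K = K])
      (use K x complex_vector.subspace_diff[OF Y] in \<open>auto simp: mult.commute simp flip: bop_diff[OF Y B]\<close>)
  then show ?thesis by (rule LIM_zero_cancel)
qed

text \<open>\<open>P\<close> is the limit of \<open>(1 - A^n)^-1\<close> along
  \<open>n = 2^k\<close>, which tends to 1 where the spectrum of \<open>A\<close> lies inside the
  unit circle and to 0 where it lies outside. So \<open>P\<close> is the Riesz projection for the
  inner part: powers of \<open>A\<close> stay bounded on its range, and \<open>A\<close> is
  invertible on its kernel.\<close>

theorem spectral_projection:
  fixes Y :: "'a::cbanach set"
  assumes Y: "complex_vector.subspace Y" "closed Y" and A: "bounded_operator_on Y A"
    and reg: "\<And>w. cmod w = 1 \<Longrightarrow> regular_on Y (\<lambda>y. y - w *\<^sub>C A y)"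
  obtains P C where "bounded_operator_on Y P" "\<And>y. y \<in> Y \<Longrightarrow> P (P y) = P y"
    "\<And>B y. bounded_operator_on Y B \<Longrightarrow> (\<And>y. y \<in> Y \<Longrightarrow> B (A y) = A (B y)) \<Longrightarrow> y \<in> Y \<Longrightarrow> B (P y) = P (B y)"
    "\<And>k y. y \<in> Y \<Longrightarrow> norm ((A ^^ k) (P y)) \<le> C * norm y"
    "regular_on {y\<in>Y. P y = 0} A"
proof -
  define W where "W = {z. Re z = 0}"
  obtain G M where "resolvent_family Y A W G M"
    by (rule resolvent_family_exists[OF Y A compact_sphere[of 0 1], of W]) (auto simp: W_def reg)
  then interpret resolvent_family Y A W G M .
  obtain L where L: "L > 0"
    "\<And>k z w y. z \<in> W \<Longrightarrow> w \<in> W \<Longrightarrow> y \<in> Y \<Longrightarrow> norm (h k z y - h k w y) \<le> L / 2 ^ k * cmod (z - w) * norm y"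
    using h_lipschitz by blast
  define s where "s = \<i> * complex_of_real pi"
  have W: "0 \<in> W" "s \<in> W" by (simp_all add: W_def s_def)
  \<comment> \<open>Since \<open>exp s = - 1\<close>, \<open>h k s\<close> is
    \<open>(1 + A^n)^-1\<close> with \<open>n = 2^k\<close>; it will have the same limit as
    \<open>h k 0\<close>.\<close>
  have shift: "norm (h k s y - h k 0 y) \<le> 4 * L / 2 ^ k * norm y" if "y \<in> Y" for k y
  proof -
    have "cmod s \<le> 4" using pi_less_4 by (simp add: s_def norm_mult)
    then have "L / 2 ^ k * cmod (s - 0) * norm y \<le> L / 2 ^ k * 4 * norm y"
      using L(1) by (intro mult_right_mono mult_left_mono) auto
    with L(2)[OF W(2,1) that, of k] show ?thesis by (simp add: mult_ac)
  qed
  \<comment> \<open>\<open>h (Suc k) 0\<close> is the mean of \<open>h k 0\<close> and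
    \<open>h k s\<close>, so the increment is half their difference.\<close>
  have next_le: "norm (h (Suc k) 0 y - h k 0 y) \<le> 2 * L / 2 ^ k * norm y" if "y \<in> Y" for k y
  proof -
    have "h (Suc k) 0 y - h k 0 y = (1 / 2) *\<^sub>C ((h k 0 y + h k s y) - (h k 0 y + h k 0 y))"
      unfolding complex_vector.scale_right_diff_distrib half_scaleC by (simp add: s_def)
    then have "norm (h (Suc k) 0 y - h k 0 y) = norm (h k s y - h k 0 y) / 2"
      by (simp add: norm_scaleC)
    also have "\<dots> \<le> (4 * L / 2 ^ k * norm y) / 2"
      by (intro divide_right_mono shift that) simp
    finally show ?thesis by simp
  qed
  \<comment> \<open>The bounds on the increments telescope: \<open>2 * L / 2 ^ i\<close> equals
    \<open>4 * L / 2 ^ i - 4 * L / 2 ^ Suc i\<close>.\<close>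
  have far: "norm (h (k + j) 0 y - h k 0 y) \<le> (4 * L / 2 ^ k - 4 * L / 2 ^ (k + j)) * norm y"
    if "y \<in> Y" for k j y
  proof (induction j)
    case (Suc j)
    have "norm (h (k + Suc j) 0 y - h k 0 y) \<le>
        norm (h (Suc (k + j)) 0 y - h (k + j) 0 y) + norm (h (k + j) 0 y - h k 0 y)"
      using norm_triangle_ineq[of "h (Suc (k + j)) 0 y - h (k + j) 0 y" "h (k + j) 0 y - h k 0 y"] by simp
    also have "\<dots> \<le> 2 * L / 2 ^ (k + j) * norm y + (4 * L / 2 ^ k - 4 * L / 2 ^ (k + j)) * norm y"
      by (intro add_mono next_le that Suc)
    also have "\<dots> = (4 * L / 2 ^ k - 4 * L / 2 ^ (k + Suc j)) * norm y"
      by (simp add: algebra_simps)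
    finally show ?case .
  qed simp
  have geo: "(\<lambda>k. 4 * L / 2 ^ k * c) \<longlonglongrightarrow> 0" for c :: real
  proof -
    have "(\<lambda>k. 4 * L * c * (1 / 2) ^ k) \<longlonglongrightarrow> 4 * L * c * 0"
      by (intro tendsto_mult tendsto_const LIMSEQ_power_zero) simp
    then show ?thesis by (simp add: power_divide mult_ac)
  qed
  have far': "norm (h m 0 y - h k 0 y) \<le> 4 * L / 2 ^ k * norm y" if "y \<in> Y" "k \<le> m" for m k y
  proof -
    have "norm (h m 0 y - h k 0 y) \<le> (4 * L / 2 ^ k - 4 * L / 2 ^ m) * norm y"
      using far[OF that(1), of k "m - k"] that(2) by simp
    also have "\<dots> \<le> 4 * L / 2 ^ k * norm y"
      using L(1) by (intro mult_right_mono) auto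
    finally show ?thesis .
  qed
  have "convergent (\<lambda>k. h k 0 y)" if y: "y \<in> Y" for y
  proof (rule Cauchy_convergent, rule metric_CauchyI)
    fix e :: real assume "e > 0"
    then have "eventually (\<lambda>k. 4 * L / 2 ^ k * norm y < e / 2) sequentially"
      using order_tendstoD(2)[OF geo, of "e / 2"] by simp
    then obtain N where N: "4 * L / 2 ^ N * norm y < e / 2"
      by (auto simp: eventually_sequentially)
    have "dist (h m 0 y) (h n 0 y) < e" if "m \<ge> N" "n \<ge> N" for m n
    proof -
      have "dist (h m 0 y) (h n 0 y) \<le> dist (h m 0 y) (h N 0 y) + dist (h n 0 y) (h N 0 y)"
        by (rule dist_triangle2)
      with far'[OF y that(1)] far'[OF y that(2)] N show ?thesis by (simp add: dist_norm)
    qed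
    then show "\<exists>N. \<forall>m\<ge>N. \<forall>n\<ge>N. dist (h m 0 y) (h n 0 y) < e" by blast
  qed
  then obtain P where P: "\<And>y. y \<in> Y \<Longrightarrow> (\<lambda>k. h k 0 y) \<longlonglongrightarrow> P y"
    unfolding convergent_def by metis
  have P_bop: "bounded_operator_on Y P"
    by (rule bop_limit[OF Y(2) h_bop[OF W(1)] h_bound[OF W(1)] P Y(1)])
  note P_mem = bop_mem[OF P_bop] and h_mem = bop_mem[OF h_bop[OF W(1)]] bop_mem[OF h_bop[OF W(2)]]
  have P_near: "norm (h k 0 y - P y) \<le> 4 * L / 2 ^ k * norm y" if "y \<in> Y" for k y
  proof (rule LIMSEQ_le_const2)
    show "(\<lambda>m. norm (h k 0 y - h m 0 y)) \<longlonglongrightarrow> norm (h k 0 y - P y)"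
      by (intro tendsto_intros P that)
    show "\<exists>N. \<forall>m\<ge>N. norm (h k 0 y - h m 0 y) \<le> 4 * L / 2 ^ k * norm y"
      using far'[OF that] by (subst norm_minus_commute) blast
  qed
  have s_lim: "(\<lambda>k. h k s y) \<longlonglongrightarrow> P y" if "y \<in> Y" for y
  proof -
    have "(\<lambda>k. h k s y - h k 0 y) \<longlonglongrightarrow> 0"
      by (rule Lim_null_comparison[OF _ geo[of "norm y"]]) (use shift[OF that] in simp)
    from tendsto_add[OF this P[OF that]] show ?thesis by simp
  qed
  \<comment> \<open>Pass to the limit in \<open>h k 0 (h k s y) = h (Suc k) 0 y\<close>, that is, in
    \<open>(1 - A^n)^-1 (1 + A^n)^-1 = (1 - A^(2 n))^-1\<close>.\<close>
  have idem: "P (P y) = P y" if y: "y \<in> Y" for y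
  proof -
    have "(\<lambda>k. h k 0 (h k s y - P y)) \<longlonglongrightarrow> 0"
    proof (rule tendsto_0_le[where K = M])
      show "(\<lambda>k. h k s y - P y) \<longlonglongrightarrow> 0" using s_lim[OF y] by (simp add: LIM_zero)
      show "\<forall>\<^sub>F k in sequentially. norm (h k 0 (h k s y - P y)) \<le> norm (h k s y - P y) * M"
        using h_bound[OF W(1) complex_vector.subspace_diff[OF Y(1) h_mem(2)[OF y] P_mem[OF y]]]
        by (simp add: mult.commute)
    qed
    from tendsto_add[OF this P[OF P_mem[OF y]]]
    have "(\<lambda>k. h k 0 (h k s y)) \<longlonglongrightarrow> P (P y)"
      by (simp add: bop_diff[OF Y(1) h_bop[OF W(1)] h_mem(2)[OF y] P_mem[OF y]])
    moreover have "h k 0 (h k s y) = h (Suc k) 0 y" for k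
      using h_mult[OF W(1) y, of k] by (simp add: s_def)
    ultimately have "(\<lambda>k. h (Suc k) 0 y) \<longlonglongrightarrow> P (P y)" by simp
    with LIMSEQ_Suc[OF P[OF y]] show ?thesis by (rule LIMSEQ_unique[symmetric])
  qed
  have comm: "B (P y) = P (B y)"
    if B: "bounded_operator_on Y B" "\<And>y. y \<in> Y \<Longrightarrow> B (A y) = A (B y)" and y: "y \<in> Y" for B y
  proof -
    have "B (h k 0 y) = h k 0 (B y)" for k
    proof (rule resolvent_at_commute[OF h_resolvent[OF W(1)] Y(1) bop_funpow[OF A] B(1) _ y])
      show "B ((A ^^ 2 ^ k) y) = (A ^^ 2 ^ k) (B y)" if "y \<in> Y" for y
        using B(2) A that by (intro funpow_commute[where Y = Y]) (auto simp: bounded_operator_on_def)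
    qed
    with bop_tendsto[OF Y(1) B(1) h_mem(1)[OF y] P_mem[OF y] P[OF y]] P[OF bop_mem[OF B(1) y]]
    show ?thesis by (simp add: LIMSEQ_unique)
  qed
  \<comment> \<open>From here on a single level suffices, at which \<open>h k 0\<close> differs from
    \<open>P\<close> by at most 1/4 in norm.\<close>
  obtain k where k: "4 * L / 2 ^ k \<le> 1 / 4"
  proof -
    have "eventually (\<lambda>k. 4 * L / 2 ^ k * 1 < 1 / 4) sequentially"
      by (rule order_tendstoD(2)[OF geo]) simp
    then show ?thesis using that by (auto simp: eventually_sequentially intro: less_imp_le)
  qed
  have near: "norm (h k 0 y - P y) \<le> 1 / 4 * norm y" if "y \<in> Y" for y
    using P_near[OF that, of k] mult_right_mono[OF k norm_ge_zero[of y]] by linarith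
  note pow = bop_funpow[OF A, of "2 ^ k"]
  have PA: "P (A y) = A (P y)" if "y \<in> Y" for y
    using comm[OF A _ that] by simp
  have P_pow: "P ((A ^^ n) y) = (A ^^ n) (P y)" if "y \<in> Y" for n y
    using funpow_commute[of Y P A, OF PA _ that] A by (simp add: bounded_operator_on_def)

  \<comment> \<open>On the range of \<open>P\<close>, \<open>h k 0\<close> is within 1/4 of the
    identity, which forces \<open>A^n\<close> with \<open>n = 2^k\<close> to be a contraction
    there.\<close>
  define R where "R = {y\<in>Y. y - P y = 0}"
  have R: "complex_vector.subspace R" "closed R"
    unfolding R_def by (rule closed_kernel_on[OF Y bop_minus[OF Y(1) bop_ident P_bop]])+
  have A_R: "bounded_operator_on R A"
    using A PA by (auto simp: bounded_operator_on_def R_def image_subset_iff)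
  have "norm ((A ^^ 2 ^ k) u) \<le> norm u" if u: "u \<in> R" for u
  proof -
    have uY: "u \<in> Y" "P u = u" using u by (auto simp: R_def)
    let ?y = "u - (A ^^ 2 ^ k) u"
    have yY: "?y \<in> Y" by (intro complex_vector.subspace_diff Y uY bop_mem[OF pow])
    have "h k 0 ?y = u" using resolvent_atD(2)[OF h_resolvent[OF W(1)] uY(1), of k] by simp
    moreover have "P ?y = ?y"
      using uY by (simp add: bop_diff[OF Y(1) P_bop] bop_mem[OF pow] P_pow)
    ultimately have "norm ((A ^^ 2 ^ k) u) \<le> 1 / 4 * norm ?y" using near[OF yY] by simp
    with norm_triangle_ineq4[of u "(A ^^ 2 ^ k) u"] norm_ge_zero[of u] show ?thesis by argo
  qed
  then obtain C where C: "C > 0" "\<And>n y. y \<in> R \<Longrightarrow> norm ((A ^^ n) y) \<le> C * norm y"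
    using power_bounded_of_power_contraction[OF R(1) A_R, of "2 ^ k"] by (metis zero_less_power zero_less_numeral)
  obtain K where K: "K > 0" "\<And>y. y \<in> Y \<Longrightarrow> norm (P y) \<le> K * norm y"
    using bop_bound[OF P_bop] by metis
  have bound: "norm ((A ^^ n) (P y)) \<le> C * K * norm y" if y: "y \<in> Y" for n y
  proof -
    have "norm ((A ^^ n) (P y)) \<le> C * norm (P y)"
      using y by (intro C(2)) (simp add: R_def P_mem idem)
    also have "\<dots> \<le> C * (K * norm y)" using K(2)[OF y] C(1) by (intro mult_left_mono) auto
    finally show ?thesis by (simp add: mult.assoc)
  qed

  \<comment> \<open>On the kernel of \<open>P\<close>, \<open>h k 0\<close> has norm at most 1/4.
    With \<open>n = 2^k\<close>, its defining equation then bounds \<open>A^n\<close> below, and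
    \<open>1 - h = - A^n h\<close> with invertible left side makes \<open>A^n\<close> onto;
    splitting off one factor \<open>A\<close> gives both for \<open>A\<close>.\<close>
  define N where "N = {y\<in>Y. P y = 0}"
  have N: "complex_vector.subspace N" "closed N"
    unfolding N_def by (rule closed_kernel_on[OF Y P_bop])+
  have A_N: "bounded_operator_on N A"
    using A PA bop_zero[OF Y(1) A] by (auto simp: bounded_operator_on_def N_def image_subset_iff)
  have h_N: "bounded_operator_on N (h k 0)"
  proof -
    have "P (h k 0 y) = h k 0 (P y)" if "y \<in> Y" for y
    proof (rule resolvent_at_commute[OF h_resolvent[OF W(1)] Y(1) pow P_bop _ that])
      show "P ((A ^^ 2 ^ k) y) = (A ^^ 2 ^ k) (P y)" if "y \<in> Y" for y by (rule P_pow[OF that])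
    qed
    then show ?thesis
      using h_bop[OF W(1), of k] bop_zero[OF Y(1) h_bop[OF W(1)], of k]
      by (auto simp: bounded_operator_on_def N_def image_subset_iff)
  qed
  have small: "norm (h k 0 y) \<le> 1 / 4 * norm y" if "y \<in> N" for y
    using near[of y] that by (simp add: N_def)
  obtain m where m: "2 ^ k = Suc m"
    by (metis Suc_pred zero_less_numeral zero_less_power)
  have "regular_on N A"
  proof -
    obtain K where K: "K > 0" "\<And>y. y \<in> N \<Longrightarrow> norm ((A ^^ m) y) \<le> K * norm y"
      using bop_bound[OF bop_funpow[OF A_N]] by metis
    show ?thesis
    proof (rule regular_onI_bounded_below[OF N(1) A_N, where c = "1 / K"])
      show "1 / K > 0" using K(1) by simp
    next
      fix u assume u: "u \<in> N"
      then have uY: "u \<in> Y" by (simp add: N_def)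
      let ?y = "u - (A ^^ 2 ^ k) u"
      have "?y \<in> N" by (intro complex_vector.subspace_diff N u bop_mem[OF bop_funpow[OF A_N]])
      from small[OF this] have "norm u \<le> 1 / 4 * norm ?y"
        using resolvent_atD(2)[OF h_resolvent[OF W(1)] uY, of k] by simp
      with norm_triangle_ineq4[of u "(A ^^ 2 ^ k) u"] norm_ge_zero[of u]
      have "norm u \<le> norm ((A ^^ 2 ^ k) u)" by argo
      also have "(A ^^ 2 ^ k) u = (A ^^ m) (A u)" unfolding m by (simp add: funpow_swap1)
      also have "norm \<dots> \<le> K * norm (A u)" by (rule K(2)[OF bop_mem[OF A_N u]])
      finally show "1 / K * norm u \<le> norm (A u)" using K(1) by (simp add: field_simps)
    next
      fix y assume y: "y \<in> N"
      have "regular_on N (\<lambda>y. y - h k 0 y)"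
        by (rule regular_on_id_minus_contraction[OF N h_N _ small]) simp
      then obtain u where u: "u \<in> N" "u - h k 0 u = y" using regular_on_surj[OF _ y] by blast
      have uY: "u \<in> Y" using u by (simp add: N_def)
      have "(A ^^ 2 ^ k) (h k 0 u) = - y"
        using resolvent_atD(4)[OF h_resolvent[OF W(1)] uY, of k] unfolding u(2)[symmetric] by simp
      then have "A ((-1) *\<^sub>C (A ^^ m) (h k 0 u)) = y"
        unfolding m using bop_scaleC[OF A_N bop_mem[OF bop_funpow[OF A_N] bop_mem[OF h_N u(1)]], of "-1" m]
        by simp
      moreover have "(-1) *\<^sub>C (A ^^ m) (h k 0 u) \<in> N"
        by (intro complex_vector.subspace_scale N bop_mem[OF bop_funpow[OF A_N]] bop_mem[OF h_N u(1)])
      ultimately show "\<exists>x\<in>N. A x = y" by blast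
    qed
  qed
  with that[of P "C * K"] P_bop idem comm bound show ?thesis
    unfolding N_def by blast
qed

section \<open>Sums of closed subspaces\<close>

lemma csubspace_closure:
  fixes S :: "'a::complex_normed_vector set"
  assumes S: "complex_vector.subspace S"
  shows "complex_vector.subspace (closure S)"
proof (rule complex_vector.subspaceI)
  show "0 \<in> closure S"
    using complex_vector.subspace_0[OF S] closure_subset by blast
next
  fix x y assume "x \<in> closure S" "y \<in> closure S"
  then obtain f g where "\<forall>n. f n \<in> S" "f \<longlonglongrightarrow> x" "\<forall>n. g n \<in> S" "g \<longlonglongrightarrow> y"
    unfolding closure_sequential by blast
  then show "x + y \<in> closure S"
    unfolding closure_sequential using complex_vector.subspace_add[OF S]
    by (intro exI[of _ "\<lambda>n. f n + g n"]) (auto intro: tendsto_add)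
next
  fix c x assume "x \<in> closure S"
  then obtain f where "\<forall>n. f n \<in> S" "f \<longlonglongrightarrow> x"
    unfolding closure_sequential by blast
  then show "c *\<^sub>C x \<in> closure S"
    unfolding closure_sequential using complex_vector.subspace_scale[OF S]
    by (intro exI[of _ "\<lambda>n. c *\<^sub>C f n"]) (auto intro: bounded_linear.tendsto[OF bounded_linear_scaleC])
qed

lemma suminf_in_closed_subspace:
  fixes Y :: "'a::cbanach set"
  assumes Y: "complex_vector.subspace Y" "closed Y" and f: "summable f" "\<And>n. f n \<in> Y"
  shows "suminf f \<in> Y"
proof -
  have "(\<Sum>i<n. f i) \<in> Y" for n
    using f(2) by (intro complex_vector.subspace_sum Y)
  then show ?thesis by (rule closed_sequentially[OF Y(2) _ summable_LIMSEQ[OF f(1)]])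
qed

text \<open>The open mapping theorem for \<open>(y, z) -> y + z\<close>. Baire's theorem yields a
  ball in the closure of some \<open>D n\<close>; rescaling gives decompositions up to half of the
  vector, and repeating them on the remainder sums to an exact one.\<close>

lemma bounded_decomposition:
  fixes Y Z :: "'a::cbanach set"
  assumes Y: "complex_vector.subspace Y" "closed Y" and Z: "complex_vector.subspace Z" "closed Z"
    and sum: "\<And>x. \<exists>y\<in>Y. \<exists>z\<in>Z. x = y + z"
  obtains C where "C > 0"
    "\<And>x. \<exists>y\<in>Y. \<exists>z\<in>Z. x = y + z \<and> norm y \<le> C * norm x \<and> norm z \<le> C * norm x"
proof -
  define D where "D n = {y + z |y z. y \<in> Y \<and> z \<in> Z \<and> norm y \<le> real n \<and> norm z \<le> real n}" for n
  have "\<exists>n. interior (closure (D n)) \<noteq> {}"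
  proof (rule ccontr)
    assume "\<not> ?thesis"
    then have "euclidean interior_of \<Union>(range (\<lambda>n. closure (D n))) = {}"
      by (intro Baire_category_alt) (auto simp: completely_metrizable_space_euclidean)
    moreover have "\<Union>(range (\<lambda>n. closure (D n))) = UNIV"
    proof -
      have "x \<in> \<Union>(range (\<lambda>n. closure (D n)))" for x
      proof -
        obtain y z where "y \<in> Y" "z \<in> Z" "x = y + z" using sum by blast
        moreover obtain n where "max (norm y) (norm z) \<le> real n" using real_arch_simple by blast
        ultimately have "x \<in> D n" by (auto simp: D_def)
        then show ?thesis using closure_subset by blast
      qed
      then show ?thesis by blast
    qed
    ultimately show False by simp
  qed
  then obtain n x0 where "x0 \<in> interior (closure (D n))" by blast
  then obtain e where e: "e > 0" "ball x0 e \<subseteq> closure (D n)" by (auto simp: mem_interior)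
  \<comment> \<open>Differences of elements of \<open>D n\<close> have components of norm at most
    \<open>2 * n\<close>; undoing the scaling by \<open>t = e / (2 * norm v)\<close> multiplies this
    by \<open>2 * norm v / e\<close>.\<close>
  define B where "B = 4 * real n / e"
  have approx: "\<exists>y\<in>Y. \<exists>z\<in>Z. norm y \<le> B * norm v \<and> norm z \<le> B * norm v \<and> norm (v - (y + z)) \<le> 1 / 2 * norm v" for v
  proof (cases "v = 0")
    case True
    then show ?thesis
      by (intro bexI[of _ 0]) (simp_all add: complex_vector.subspace_0 Y Z)
  next
    case False
    define t where "t = e / (2 * norm v)"
    have t: "t > 0" using e(1) False by (simp add: t_def)
    have nt: "norm (t *\<^sub>R v) = e / 2" using e(1) False by (simp add: t_def)
    have "x0 + t *\<^sub>R v \<in> closure (D n)" "x0 \<in> closure (D n)"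
      using e nt by (auto simp: dist_norm intro!: subsetD[OF e(2)])
    \<comment> \<open>Two approximation errors below \<open>e / 8\<close>, divided by
      \<open>t\<close>, together stay below \<open>norm v / 2\<close>.\<close>
    moreover have "e / 8 > 0" using e(1) by simp
    ultimately obtain p p' where p: "p \<in> D n" "dist p (x0 + t *\<^sub>R v) < e / 8" and p': "p' \<in> D n" "dist p' x0 < e / 8"
      unfolding closure_approachable by blast
    obtain y z where yz: "p = y + z" "y \<in> Y" "z \<in> Z" "norm y \<le> real n" "norm z \<le> real n"
      using p(1) by (auto simp: D_def)
    obtain y' z' where yz': "p' = y' + z'" "y' \<in> Y" "z' \<in> Z" "norm y' \<le> real n" "norm z' \<le> real n"
      using p'(1) by (auto simp: D_def)
    define a where "a = (1 / t) *\<^sub>R (y - y')"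
    define b where "b = (1 / t) *\<^sub>R (z - z')"
    have "a \<in> Y" "b \<in> Z"
      unfolding a_def b_def
      by (intro subspace_scaleR complex_vector.subspace_diff Y Z yz yz')+
    moreover have "norm a \<le> B * norm v"
    proof -
      have "norm (y - y') \<le> 2 * real n" using norm_triangle_ineq4[of y y'] yz yz' by linarith
      then have "norm a \<le> (1 / t) * (2 * real n)" unfolding a_def using t by (simp add: divide_right_mono)
      then show ?thesis using False e(1) by (simp add: t_def B_def mult_ac)
    qed
    moreover have "norm b \<le> B * norm v"
    proof -
      have "norm (z - z') \<le> 2 * real n" using norm_triangle_ineq4[of z z'] yz yz' by linarith
      then have "norm b \<le> (1 / t) * (2 * real n)" unfolding b_def using t by (simp add: divide_right_mono)
      then show ?thesis using False e(1) by (simp add: t_def B_def mult_ac)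
    qed
    moreover have "norm (v - (a + b)) \<le> 1 / 2 * norm v"
    proof -
      have "v - (a + b) = (1 / t) *\<^sub>R (t *\<^sub>R v - ((y - y') + (z - z')))"
        using t by (simp add: a_def b_def algebra_simps)
      also have "t *\<^sub>R v - ((y - y') + (z - z')) = (p' - x0) - (p - (x0 + t *\<^sub>R v))"
        unfolding yz yz' by simp
      finally have "norm (v - (a + b)) = norm ((p' - x0) - (p - (x0 + t *\<^sub>R v))) / t"
        using t by simp
      also have "\<dots> \<le> (e / 4) / t"
        using norm_triangle_ineq4[of "p' - x0" "p - (x0 + t *\<^sub>R v)"] p(2) p'(2) t
        by (intro divide_right_mono) (auto simp: dist_norm)
      also have "\<dots> = 1 / 2 * norm v" using False e(1) by (simp add: t_def)
      finally show ?thesis .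
    qed
    ultimately show ?thesis by blast
  qed
  then obtain f g where fg: "\<And>v. f v \<in> Y" "\<And>v. g v \<in> Z" "\<And>v. norm (f v) \<le> B * norm v"
    "\<And>v. norm (g v) \<le> B * norm v" "\<And>v. norm (v - (f v + g v)) \<le> 1 / 2 * norm v"
    by metis
  have B: "B \<ge> 0" using e(1) by (simp add: B_def)
  \<comment> \<open>The geometric series gives the constant \<open>2 * B\<close>; the extra 1 makes
    it positive also when \<open>n = 0\<close>.\<close>
  have "\<exists>y\<in>Y. \<exists>z\<in>Z. x = y + z \<and> norm y \<le> (2 * B + 1) * norm x \<and> norm z \<le> (2 * B + 1) * norm x" for x
  proof -
    define v where "v n = ((\<lambda>v. v - (f v + g v)) ^^ n) x" for n
    have v_Suc: "v (Suc n) = v n - (f (v n) + g (v n))" for n by (simp add: v_def)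
    have v_norm: "norm (v n) \<le> (1 / 2) ^ n * norm x" for n
    proof (induction n)
      case (Suc n)
      have "norm (v (Suc n)) \<le> 1 / 2 * norm (v n)" unfolding v_Suc by (rule fg)
      also have "\<dots> \<le> 1 / 2 * ((1 / 2) ^ n * norm x)" using Suc by simp
      finally show ?case by simp
    qed (simp add: v_def)
    have geom: "summable (\<lambda>n. B * ((1 / 2) ^ n * norm x))" "(\<Sum>n. B * ((1 / 2) ^ n * norm x)) = 2 * B * norm x"
    proof -
      have "(\<lambda>n. (B * norm x) * (1 / 2) ^ n) sums ((B * norm x) * (1 / (1 - 1 / 2)))"
        by (intro sums_mult geometric_sums) simp
      then have "(\<lambda>n. B * ((1 / 2) ^ n * norm x)) sums (2 * B * norm x)" by (simp add: mult_ac)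
      then show "summable (\<lambda>n. B * ((1 / 2) ^ n * norm x))" "(\<Sum>n. B * ((1 / 2) ^ n * norm x)) = 2 * B * norm x"
        by (simp_all add: sums_iff)
    qed
    have bnd: "norm (w (v n)) \<le> B * ((1 / 2) ^ n * norm x)" if "\<And>u. norm (w u) \<le> B * norm u" for w :: "'a \<Rightarrow> 'a" and n
      by (rule order_trans[OF that mult_left_mono[OF v_norm B]])
    have sumw: "summable (\<lambda>n. w (v n))" "norm (\<Sum>n. w (v n)) \<le> 2 * B * norm x"
      if "\<And>u. norm (w u) \<le> B * norm u" for w :: "'a \<Rightarrow> 'a"
    proof -
      have 1: "summable (\<lambda>n. norm (w (v n)))"
        by (rule summable_comparison_test[OF _ geom(1)]) (use bnd[OF that] in auto)
      then show "summable (\<lambda>n. w (v n))" by (rule summable_norm_cancel)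
      have "norm (\<Sum>n. w (v n)) \<le> (\<Sum>n. norm (w (v n)))" by (rule summable_norm[OF 1])
      also have "\<dots> \<le> (\<Sum>n. B * ((1 / 2) ^ n * norm x))"
        by (rule suminf_le[OF bnd[OF that] 1 geom(1)])
      finally show "norm (\<Sum>n. w (v n)) \<le> 2 * B * norm x" by (simp add: geom(2))
    qed
    define y where "y = (\<Sum>n. f (v n))"
    define z where "z = (\<Sum>n. g (v n))"
    have "y \<in> Y" unfolding y_def using fg sumw(1) by (intro suminf_in_closed_subspace Y) auto
    moreover have "z \<in> Z" unfolding z_def using fg sumw(1) by (intro suminf_in_closed_subspace Z) auto
    moreover have "norm y \<le> (2 * B + 1) * norm x" "norm z \<le> (2 * B + 1) * norm x"
      using sumw(2)[of f, OF fg(3)] sumw(2)[of g, OF fg(4)] norm_ge_zero[of x]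
      unfolding y_def z_def distrib_right by linarith+
    moreover have "x = y + z"
    proof -
      have part: "(\<Sum>i<n. f (v i)) + (\<Sum>i<n. g (v i)) = x - v n" for n
      proof (induction n)
        case 0
        then show ?case by (simp add: v_def)
      next
        case (Suc n)
        have "(\<Sum>i<Suc n. f (v i)) + (\<Sum>i<Suc n. g (v i))
            = ((\<Sum>i<n. f (v i)) + (\<Sum>i<n. g (v i))) + (f (v n) + g (v n))"
          by simp
        then show ?case unfolding Suc v_Suc by simp
      qed
      have lim: "(\<lambda>n. (\<Sum>i<n. f (v i)) + (\<Sum>i<n. g (v i))) \<longlonglongrightarrow> y + z"
        unfolding y_def z_def using fg sumw(1) by (intro tendsto_add summable_LIMSEQ) auto
      have "v \<longlonglongrightarrow> 0"
      proof (rule Lim_null_comparison)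
        show "\<forall>\<^sub>F n in sequentially. norm (v n) \<le> (1 / 2) ^ n * norm x" using v_norm by simp
        show "(\<lambda>n. (1 / 2 :: real) ^ n * norm x) \<longlonglongrightarrow> 0"
          by (intro tendsto_mult_left_zero LIMSEQ_power_zero) simp
      qed
      then have "(\<lambda>n. x - v n) \<longlonglongrightarrow> x - 0" by (intro tendsto_intros)
      then show ?thesis using lim unfolding part by (simp add: LIMSEQ_unique)
    qed
    ultimately show ?thesis by blast
  qed
  then show ?thesis using that[of "2 * B + 1"] B by simp
qed

section \<open>Hyperinvariant hulls\<close>

lemma commute_iff:
  fixes A B :: "'a::complex_normed_vector \<Rightarrow>\<^sub>C\<^sub>L 'a"
  shows "A o\<^sub>C\<^sub>L B = B o\<^sub>C\<^sub>L A \<longleftrightarrow> (\<forall>x. A (B x) = B (A x))"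
  by transfer (auto simp: fun_eq_iff)

definition hyper_hull :: "('a::cbanach \<Rightarrow>\<^sub>C\<^sub>L 'a) \<Rightarrow> 'a set \<Rightarrow> 'a set" where
  "hyper_hull T Y = closure (complex_vector.span {cblinfun_apply A y |A y. A o\<^sub>C\<^sub>L T = T o\<^sub>C\<^sub>L A \<and> y \<in> Y})"

lemma hyper_hull_closed_subspace:
  "complex_vector.subspace (hyper_hull T Y)" "closed (hyper_hull T Y)"
  by (simp_all add: hyper_hull_def csubspace_closure complex_vector.subspace_span)

lemma subset_hyper_hull: "Y \<subseteq> hyper_hull T Y"
proof
  fix y assume "y \<in> Y"
  then have "cblinfun_apply cblinfun_id y \<in> {cblinfun_apply A y |A y. A o\<^sub>C\<^sub>L T = T o\<^sub>C\<^sub>L A \<and> y \<in> Y}"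
    by (intro CollectI exI[of _ cblinfun_id] exI[of _ y] conjI refl) (simp_all add: commute_iff cblinfun_id.rep_eq)
  then have "y \<in> {cblinfun_apply A y |A y. A o\<^sub>C\<^sub>L T = T o\<^sub>C\<^sub>L A \<and> y \<in> Y}"
    by (simp only: cblinfun_id.rep_eq)
  then show "y \<in> hyper_hull T Y"
    unfolding hyper_hull_def by (rule subsetD[OF closure_subset complex_vector.span_base])
qed

lemma cblinfun_add:
  fixes T :: "'a::complex_normed_vector \<Rightarrow>\<^sub>C\<^sub>L 'b::complex_normed_vector"
  shows "cblinfun_apply T (x + y) = cblinfun_apply T x + cblinfun_apply T y"
  by (rule linear_add[OF bounded_linear.linear[OF bounded_linear_cblinfun_apply]])

lemma cblinfun_diff:
  fixes T :: "'a::complex_normed_vector \<Rightarrow>\<^sub>C\<^sub>L 'b::complex_normed_vector"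
  shows "cblinfun_apply T (x - y) = cblinfun_apply T x - cblinfun_apply T y"
  by (rule linear_diff[OF bounded_linear.linear[OF bounded_linear_cblinfun_apply]])

lemma cblinfun_zero:
  fixes T :: "'a::complex_normed_vector \<Rightarrow>\<^sub>C\<^sub>L 'b::complex_normed_vector"
  shows "cblinfun_apply T 0 = 0"
  by (rule linear_0[OF bounded_linear.linear[OF bounded_linear_cblinfun_apply]])

lemma cblinfun_bound:
  fixes T :: "'a::complex_normed_vector \<Rightarrow>\<^sub>C\<^sub>L 'a"
  obtains K where "K > 0" "\<And>x. norm (cblinfun_apply T x) \<le> K * norm x"
  by (rule bop_bound[OF bop_UNIV[of T]]) (rule that, auto)

lemma hyper_hull_invariant:
  fixes T :: "'a::cbanach \<Rightarrow>\<^sub>C\<^sub>L 'a"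
  assumes B: "B o\<^sub>C\<^sub>L T = T o\<^sub>C\<^sub>L B"
  shows "B ` hyper_hull T Y \<subseteq> hyper_hull T Y"
proof -
  let ?G = "{cblinfun_apply A y |A y. A o\<^sub>C\<^sub>L T = T o\<^sub>C\<^sub>L A \<and> y \<in> Y}"
  have "B x \<in> complex_vector.span ?G" if "x \<in> complex_vector.span ?G" for x
    using that
  proof (induction rule: complex_vector.span_induct_alt)
    case base
    then show ?case by (simp add: cblinfun_zero complex_vector.span_zero)
  next
    case (step c x y)
    from step(1) obtain A u where u: "x = cblinfun_apply A u" "A o\<^sub>C\<^sub>L T = T o\<^sub>C\<^sub>L A" "u \<in> Y" by blast
    have "(B o\<^sub>C\<^sub>L A) o\<^sub>C\<^sub>L T = T o\<^sub>C\<^sub>L (B o\<^sub>C\<^sub>L A)"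
      using B u(2) unfolding commute_iff by (simp add: cblinfun_compose.rep_eq)
    moreover have "B x = cblinfun_apply (B o\<^sub>C\<^sub>L A) u" by (simp add: u cblinfun_compose.rep_eq)
    ultimately have "B x \<in> ?G" using u(3) by blast
    then show ?case
      using step(2) by (simp add: cblinfun_add cblinfun_apply_scaleC complex_vector.span_add
          complex_vector.span_scale complex_vector.span_base)
  qed
  then have "B ` complex_vector.span ?G \<subseteq> hyper_hull T Y"
    unfolding hyper_hull_def using closure_subset by blast
  then show ?thesis
    unfolding hyper_hull_def
    by (intro image_closure_subset linear_continuous_on bounded_linear_cblinfun_apply) simp_all
qed

text \<open>Containment of the hull in the second summand \<open>Z'\<close> yields only the lower
  bound, since preimages found in \<open>Z'\<close> could leave the hull. Preimages are therefore
  taken from \<open>Y\<close>: \<open>A (R u)\<close> is one for \<open>A u\<close>, and the lower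
  bound carries surjectivity from the span to its closure.\<close>

lemma hyper_hull_regular:
  fixes T :: "'a::cbanach \<Rightarrow>\<^sub>C\<^sub>L 'a"
  assumes dec: "decomposable T" and Y: "complex_vector.subspace Y" "T ` Y \<subseteq> Y"
    and reg: "regular_on Y (\<lambda>y. T y - z *\<^sub>C y)"
  shows "regular_on (hyper_hull T Y) (\<lambda>y. T y - z *\<^sub>C y)"
proof -
  let ?N = "\<lambda>y. T y - z *\<^sub>C y"
  let ?G = "{cblinfun_apply A y |A y. A o\<^sub>C\<^sub>L T = T o\<^sub>C\<^sub>L A \<and> y \<in> Y}"
  have N_UNIV: "bounded_operator_on UNIV ?N"
    by (rule bop_shift[OF complex_vector.subspace_UNIV bop_UNIV])
  obtain R where R: "bounded_operator_on Y R" "\<And>y. y \<in> Y \<Longrightarrow> R (?N y) = y" "\<And>y. y \<in> Y \<Longrightarrow> ?N (R y) = y"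
    using regular_onE[OF reg] by metis
  obtain K where K: "K > 0" "\<And>y. y \<in> Y \<Longrightarrow> norm (R y) \<le> K * norm y"
    using bop_bound[OF R(1)] by metis
  \<comment> \<open>Makes \<open>r * K = 1 / 2\<close>: the factor \<open>r ^ k\<close> from
    \<open>(T - z)^k\<close> on \<open>Y'\<close> then beats the growth \<open>K ^ k\<close> of the
    preimages \<open>a\<close> of \<open>A y\<close>.\<close>
  define r where "r = 1 / (2 * K)"
  have r: "r > 0" using K(1) by (simp add: r_def)
  have "open (ball z r)" "open (- cball z (r / 2))" "ball z r \<union> - cball z (r / 2) = UNIV"
    using r by auto
  then obtain Y' Z' where Y': "complex_vector.subspace Y'" "closed Y'" "T ` Y' \<subseteq> Y'"
    and Z': "complex_vector.subspace Z'" "closed Z'" "T ` Z' \<subseteq> Z'"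
    and sum: "\<forall>x. \<exists>y\<in>Y'. \<exists>z\<in>Z'. x = y + z"
    and sp: "spectrum_on Y' T \<subseteq> ball z r" "spectrum_on Z' T \<subseteq> - cball z (r / 2)"
    using dec[unfolded decomposable_def, rule_format, of "ball z r" "- cball z (r / 2)"] by blast
  have N_Y': "bounded_operator_on Y' ?N" and N_Z': "bounded_operator_on Z' ?N"
    by (intro bop_shift bop_cblinfun Y' Z')+
  have "regular_on Y' (\<lambda>y. ?N y - w *\<^sub>C y)" if "cmod w \<ge> r" for w
  proof -
    have "z + w \<notin> ball z r" using that by (simp add: dist_norm)
    then have "regular_on Y' (\<lambda>y. T y - (z + w) *\<^sub>C y)"
      using sp(1) spectrum_on_regular[OF Y'(1,3)] by blast
    then show ?thesis by (simp add: scaleC_add_left algebra_simps)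
  qed
  then obtain C where C: "C > 0" "\<And>k y. y \<in> Y' \<Longrightarrow> norm ((?N ^^ k) y) \<le> C * r ^ k * norm y"
    using power_bounded_of_shifts_regular[OF Y'(1,2) N_Y' r] by blast
  have reg_Z': "regular_on Z' ?N"
    using sp(2) spectrum_on_regular[OF Z'(1,3)] r by auto
  obtain C' where C': "C' > 0"
    "\<And>x. \<exists>y\<in>Y'. \<exists>z\<in>Z'. x = y + z \<and> norm y \<le> C' * norm x \<and> norm z \<le> C' * norm x"
    using bounded_decomposition[OF Y'(1,2) Z'(1,2)] sum by metis
  have gen: "A y \<in> Z'" if A: "A o\<^sub>C\<^sub>L T = T o\<^sub>C\<^sub>L A" and y: "y \<in> Y" for A y
  proof -
    have AT: "A (T x) = T (A x)" for x using A by (simp add: commute_iff)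
    obtain L where L: "L > 0" "\<And>x. norm (cblinfun_apply A x) \<le> L * norm x"
      using cblinfun_bound[of A] by metis
    have R_pow: "norm ((R ^^ k) y) \<le> K ^ k * norm y" for k
    proof (induction k)
      case (Suc k)
      have "norm ((R ^^ Suc k) y) \<le> K * norm ((R ^^ k) y)"
        using K(2)[OF bop_mem[OF bop_funpow[OF R(1)] y]] by simp
      also have "\<dots> \<le> K * (K ^ k * norm y)" using Suc K(1) by simp
      finally show ?case by simp
    qed simp
    have NR: "(?N ^^ k) ((R ^^ k) y) = y" for k
    proof (induction k)
      case (Suc k)
      have "(?N ^^ Suc k) ((R ^^ Suc k) y) = (?N ^^ k) (?N (R ((R ^^ k) y)))"
        using funpow_Suc_right[of k ?N] by simp
      also have "?N (R ((R ^^ k) y)) = (R ^^ k) y" by (rule R(3)[OF bop_mem[OF bop_funpow[OF R(1)] y]])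
      finally show ?case using Suc by simp
    qed simp
    have NA: "(?N ^^ k) (A x) = A ((?N ^^ k) x)" for k x
      by (induction k) (simp_all add: AT cblinfun_diff cblinfun_apply_scaleC)
    \<comment> \<open>In \<open>A y = (T - z)^k a\<close> only the \<open>Y'\<close> part of
      \<open>a\<close> is estimated; the \<open>Z'\<close> part stays in \<open>Z'\<close> and
      serves as the approximation of \<open>A y\<close>.\<close>
    have "\<exists>v\<in>Z'. norm (A y - v) \<le> C * C' * L * norm y * (1 / 2) ^ k" for k
    proof -
      define a where "a = A ((R ^^ k) y)"
      have a: "(?N ^^ k) a = A y" by (simp add: a_def NA NR)
      have "norm a \<le> L * norm ((R ^^ k) y)" unfolding a_def by (rule L)
      also have "\<dots> \<le> L * (K ^ k * norm y)" using R_pow L(1) by simp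
      finally have na: "norm a \<le> L * (K ^ k * norm y)" .
      obtain u v where uv: "u \<in> Y'" "v \<in> Z'" "a = u + v" "norm u \<le> C' * norm a"
        using C'(2) by metis
      have "A y = (?N ^^ k) u + (?N ^^ k) v"
        unfolding a[symmetric] uv(3) by (rule bop_add[OF bop_funpow[OF N_UNIV]]) auto
      then have "norm (A y - (?N ^^ k) v) = norm ((?N ^^ k) u)" by simp
      also have "\<dots> \<le> C * r ^ k * norm u" by (rule C(2)[OF uv(1)])
      also have "\<dots> \<le> C * r ^ k * (C' * (L * (K ^ k * norm y)))"
        using order_trans[OF uv(4) mult_left_mono[OF na]] C'(1) C(1) r by (intro mult_left_mono) auto
      also have "\<dots> = C * C' * L * norm y * (r * K) ^ k" by (simp add: power_mult_distrib mult_ac)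
      also have "r * K = 1 / 2" using K(1) by (simp add: r_def)
      finally show ?thesis by (rule bexI[OF _ bop_mem[OF bop_funpow[OF N_Z'] uv(2)]])
    qed
    then obtain v where v: "\<And>k. v k \<in> Z'" "\<And>k. norm (A y - v k) \<le> C * C' * L * norm y * (1 / 2) ^ k"
      by metis
    have "(\<lambda>k. A y - v k) \<longlonglongrightarrow> 0"
    proof (rule Lim_null_comparison)
      show "\<forall>\<^sub>F k in sequentially. norm (A y - v k) \<le> C * C' * L * norm y * (1 / 2) ^ k"
        using v(2) by simp
      show "(\<lambda>k. C * C' * L * norm y * (1 / 2) ^ k) \<longlonglongrightarrow> 0"
        by (intro tendsto_mult_right_zero LIMSEQ_power_zero) simp
    qed
    from tendsto_diff[OF tendsto_const[of "A y"] this] have "v \<longlonglongrightarrow> A y" by simp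
    with v(1) show ?thesis by (rule closed_sequentially[OF Z'(2)])
  qed
  then have "complex_vector.span ?G \<subseteq> Z'" by (intro complex_vector.span_minimal Z') auto
  then have hull: "hyper_hull T Y \<subseteq> Z'"
    unfolding hyper_hull_def by (rule closure_minimal[OF _ Z'(2)])
  obtain c where c: "c > 0" "\<And>y. y \<in> Z' \<Longrightarrow> c * norm y \<le> norm (?N y)"
    using regular_on_bounded_below[OF reg_Z'] by metis
  have onto_span: "\<exists>v\<in>complex_vector.span ?G. ?N v = x" if "x \<in> complex_vector.span ?G" for x
    using that
  proof (induction rule: complex_vector.span_induct_alt)
    case base
    then show ?case by (intro bexI[of _ 0]) (simp_all add: cblinfun_zero complex_vector.span_zero)
  next
    case (step a x y)
    from step(1) obtain A u where u: "x = cblinfun_apply A u" "A o\<^sub>C\<^sub>L T = T o\<^sub>C\<^sub>L A" "u \<in> Y" by blast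
    from step(2) obtain v where v: "v \<in> complex_vector.span ?G" "?N v = y" by blast
    have "?N (A (R u)) = A (?N (R u))"
      using u(2) by (simp add: commute_iff cblinfun_diff cblinfun_apply_scaleC)
    then have "?N (A (R u)) = x" using u R(3) by simp
    then have "?N (a *\<^sub>C A (R u) + v) = a *\<^sub>C x + y"
      using v(2) by (simp only: bop_add[OF N_UNIV UNIV_I UNIV_I] bop_scaleC[OF N_UNIV UNIV_I])
    moreover have "A (R u) \<in> ?G" using u(2,3) bop_mem[OF R(1)] by blast
    then have "a *\<^sub>C A (R u) + v \<in> complex_vector.span ?G"
      by (intro complex_vector.span_add complex_vector.span_scale v) (rule complex_vector.span_base)
    ultimately show ?case by blast
  qed
  have T_inv: "T ` hyper_hull T Y \<subseteq> hyper_hull T Y" by (rule hyper_hull_invariant) simp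
  show ?thesis
  proof (rule regular_onI_bounded_below[OF hyper_hull_closed_subspace(1) _ c(1)])
    show "bounded_operator_on (hyper_hull T Y) ?N"
      by (intro bop_shift bop_cblinfun hyper_hull_closed_subspace T_inv)
    show "c * norm y \<le> norm (?N y)" if "y \<in> hyper_hull T Y" for y
      by (rule c(2)[OF subsetD[OF hull that]])
    fix x assume "x \<in> hyper_hull T Y"
    then have "\<exists>f. (\<forall>n. f n \<in> complex_vector.span ?G) \<and> f \<longlonglongrightarrow> x"
      unfolding hyper_hull_def closure_sequential .
    then obtain f where f': "(\<forall>n. f n \<in> complex_vector.span ?G) \<and> f \<longlonglongrightarrow> x" ..
    then have f: "f n \<in> complex_vector.span ?G" "f \<longlonglongrightarrow> x" for n by (rule conjunct1[THEN spec], rule conjunct2)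
    have "\<forall>n. \<exists>v. v \<in> complex_vector.span ?G \<and> ?N v = f n"
      using onto_span[OF f(1)] unfolding Bex_def by (rule allI)
    from choice[OF this] obtain v where "\<forall>n. v n \<in> complex_vector.span ?G \<and> ?N (v n) = f n" ..
    then have v: "v n \<in> complex_vector.span ?G" "?N (v n) = f n" for n by simp_all
    have vh: "v n \<in> hyper_hull T Y" for n
      unfolding hyper_hull_def by (rule subsetD[OF closure_subset v(1)])
    have "Cauchy v"
    proof (rule metric_CauchyI)
      fix e :: real assume "e > 0"
      then have "c * e > 0" using c(1) by simp
      then obtain M where M: "\<And>m n. m \<ge> M \<Longrightarrow> n \<ge> M \<Longrightarrow> dist (f m) (f n) < c * e"
        using metric_CauchyD[OF LIMSEQ_imp_Cauchy[OF f(2)]] by blast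
      have "dist (v m) (v n) < e" if "m \<ge> M" "n \<ge> M" for m n
      proof -
        have "v m - v n \<in> Z'"
          using hull vh by (intro complex_vector.subspace_diff Z') auto
        from c(2)[OF this] have "c * dist (v m) (v n) \<le> dist (f m) (f n)"
          unfolding dist_norm v(2)[symmetric]
          by (simp only: bop_diff[OF complex_vector.subspace_UNIV N_UNIV UNIV_I UNIV_I])
        with M[OF that] have "c * dist (v m) (v n) < c * e" by linarith
        then show ?thesis using c(1) by simp
      qed
      then show "\<exists>M. \<forall>m\<ge>M. \<forall>n\<ge>M. dist (v m) (v n) < e" by blast
    qed
    then obtain l where l: "v \<longlonglongrightarrow> l" using convergentD[OF Cauchy_convergent] by blast
    have "l \<in> hyper_hull T Y"
      using closed_sequentially[OF hyper_hull_closed_subspace(2) vh l] .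
    moreover have "?N l = x"
      using bop_tendsto[OF complex_vector.subspace_UNIV N_UNIV UNIV_I UNIV_I l] f(2)
      unfolding v(2) by (rule LIMSEQ_unique)
    ultimately show "\<exists>y\<in>hyper_hull T Y. ?N y = x" by blast
  qed
qed

section \<open>Hyperinvariant decompositions of perturbations\<close>

text \<open>Invariance is asked under everything that commutes with both \<open>T\<close> and
  \<open>S\<close>, not merely under \<open>T + S\<close>: a spectral projection of \<open>S\<close>
  must preserve the pieces when two decompositions are glued.\<close>

definition hyper_decomposition ::
    "('a::cbanach \<Rightarrow>\<^sub>C\<^sub>L 'a) \<Rightarrow> ('a \<Rightarrow>\<^sub>C\<^sub>L 'a) \<Rightarrow> complex set \<Rightarrow> complex set \<Rightarrow> bool" where
  "hyper_decomposition T S U V \<longleftrightarrow>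
     (\<exists>Y Z. complex_vector.subspace Y \<and> closed Y \<and> complex_vector.subspace Z \<and> closed Z \<and>
        (\<forall>B. B o\<^sub>C\<^sub>L T = T o\<^sub>C\<^sub>L B \<and> B o\<^sub>C\<^sub>L S = S o\<^sub>C\<^sub>L B \<longrightarrow> B ` Y \<subseteq> Y \<and> B ` Z \<subseteq> Z) \<and>
        (\<forall>x. \<exists>y\<in>Y. \<exists>z\<in>Z. x = y + z) \<and>
        (\<forall>l. l \<notin> U \<longrightarrow> regular_on Y (\<lambda>y. T y + S y - l *\<^sub>C y)) \<and>
        (\<forall>l. l \<notin> V \<longrightarrow> regular_on Z (\<lambda>y. T y + S y - l *\<^sub>C y)))"

lemma regular_on_eq:
  "regular_on Y f \<Longrightarrow> (\<And>y. y \<in> Y \<Longrightarrow> f y = g y) \<Longrightarrow> complex_vector.subspace Y \<Longrightarrow> regular_on Y g"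
  using regular_on_cong[of Y f g] by blast

lemma funpow_comp_commute:
  assumes R: "bounded_operator_on Y R" and A: "bounded_operator_on Y A"
    and comm: "\<And>y. y \<in> Y \<Longrightarrow> A (R y) = R (A y)" and y: "y \<in> Y"
  shows "((\<lambda>y. R (A y)) ^^ k) y = (R ^^ k) ((A ^^ k) y)"
proof (induction k)
  case (Suc k)
  have "A ((R ^^ k) v) = (R ^^ k) (A v)" if "v \<in> Y" for v
    using comm R that by (intro funpow_commute[where Y = Y]) (auto simp: bounded_operator_on_def)
  then show ?case using Suc bop_mem[OF bop_funpow[OF A] y] by simp
qed simp

text \<open>With \<open>f = T - (l - m)\<close>, \<open>A = S - m\<close> and
  \<open>R = f^-1\<close> on the hull, \<open>T + S - l = f (1 + R A)\<close>. Since
  \<open>T - (l - m + w)\<close> is invertible for all \<open>|w| \<le> e\<close>, the powers of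
  \<open>R\<close> are \<open>O(e^-k)\<close>, while those of \<open>A\<close> are
  \<open>O(q^k)\<close>; as \<open>R\<close> and \<open>A\<close> commute, some power of
  \<open>R A\<close> is a contraction.\<close>

lemma hyper_hull_regular_perturbed:
  fixes T S :: "'a::cbanach \<Rightarrow>\<^sub>C\<^sub>L 'a"
  assumes dec: "decomposable T" and comm: "S o\<^sub>C\<^sub>L T = T o\<^sub>C\<^sub>L S"
    and bound: "\<And>k x. norm (((\<lambda>x. S x - m *\<^sub>C x) ^^ k) x) \<le> C * q ^ k * norm x"
    and q: "0 \<le> q" "q < e"
    and Y: "complex_vector.subspace Y" "T ` Y \<subseteq> Y"
    and sp: "spectrum_on Y T \<subseteq> interior {z. cball (z + m) e \<subseteq> U}" and l: "l \<notin> U"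
  shows "regular_on (hyper_hull T Y) (\<lambda>y. T y + S y - l *\<^sub>C y)"
proof -
  let ?H = "hyper_hull T Y"
  let ?f = "\<lambda>y. T y - (l - m) *\<^sub>C y" and ?A = "\<lambda>x. S x - m *\<^sub>C x"
  note H = hyper_hull_closed_subspace[of T Y]
  have T_H: "bounded_operator_on ?H T" and S_H: "bounded_operator_on ?H S"
    by (intro bop_cblinfun hyper_hull_invariant comm refl)+
  have A_H: "bounded_operator_on ?H ?A" by (rule bop_shift[OF H(1) S_H])
  have reg: "regular_on ?H (\<lambda>y. T y - (l - m + w) *\<^sub>C y)" if "cmod w \<le> e" for w
  proof (rule hyper_hull_regular[OF dec Y])
    \<comment> \<open>Otherwise the closed \<open>e\<close>-disc about the translate of this point
      by \<open>m\<close> would lie in \<open>U\<close> and contain \<open>l\<close>.\<close>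
    have "l - m + w \<notin> interior {z. cball (z + m) e \<subseteq> U}"
    proof
      assume "l - m + w \<in> interior {z. cball (z + m) e \<subseteq> U}"
      from subsetD[OF interior_subset this] have "cball (l - m + w + m) e \<subseteq> U" by simp
      moreover have "l \<in> cball (l - m + w + m) e" using that by (simp add: dist_norm)
      ultimately show False using l by blast
    qed
    then show "regular_on Y (\<lambda>y. T y - (l - m + w) *\<^sub>C y)"
      using sp spectrum_on_regular[OF Y] by blast
  qed
  have e: "e > 0" using q by linarith
  from reg[of 0] e have f: "regular_on ?H ?f" by simp
  obtain R where R: "bounded_operator_on ?H R" "\<And>y. y \<in> ?H \<Longrightarrow> R (?f y) = y" "\<And>y. y \<in> ?H \<Longrightarrow> ?f (R y) = y"
    using regular_onE[OF f] by metis
  have R_reg: "regular_on ?H R" by (rule regular_onI[OF R(1) regular_on_bop[OF f] R(3) R(2)])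
  \<comment> \<open>\<open>1 - w R = (T - (l - m + w)) R\<close>.\<close>
  have "regular_on ?H (\<lambda>y. y - w *\<^sub>C R y)" if "cmod w \<le> e" for w
  proof -
    have "regular_on ?H (\<lambda>y. T (R y) - (l - m + w) *\<^sub>C R y)"
      by (rule regular_on_comp[OF reg[OF that] R_reg])
    moreover have "T (R y) - (l - m + w) *\<^sub>C R y = y - w *\<^sub>C R y" if "y \<in> ?H" for y
    proof -
      have "T (R y) - (l - m + w) *\<^sub>C R y = ?f (R y) - w *\<^sub>C R y"
        by (simp add: scaleC_add_left)
      then show ?thesis by (simp only: R(3)[OF that])
    qed
    ultimately show ?thesis by (rule regular_on_eq[OF _ _ H(1)])
  qed
  then obtain C' where C': "C' > 0" "\<And>k y. y \<in> ?H \<Longrightarrow> e ^ k * norm ((R ^^ k) y) \<le> C' * norm y"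
    using power_bounded_of_regular[OF H R(1) less_imp_le[OF e]] by metis
  have "?A (R y) = R (?A y)" if "y \<in> ?H" for y
  proof (rule regular_on_inverse_commute[OF R _ _ that])
    show "?A (?f y) = ?f (?A y)" for y
      using comm by (simp add: commute_iff cblinfun_diff cblinfun_apply_scaleC
          complex_vector.scale_right_diff_distrib scaleC_scaleC mult.commute)
  qed (simp_all add: bop_mem[OF A_H])
  then have RA: "((\<lambda>y. R (?A y)) ^^ k) y = (R ^^ k) ((?A ^^ k) y)" if "y \<in> ?H" for k y
    using funpow_comp_commute[of ?H R ?A] R(1) A_H that by simp
  define B where "B = (\<lambda>y. R (?A y))"
  have B: "bounded_operator_on ?H B" unfolding B_def by (rule bop_comp[OF R(1) A_H])
  have "(\<lambda>k. C' * C * (q / e) ^ k) \<longlonglongrightarrow> 0"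
    using q e by (intro tendsto_mult_right_zero LIMSEQ_power_zero) simp
  then have "eventually (\<lambda>k. C' * C * (q / e) ^ k < 1 / 2) sequentially"
    by (rule order_tendstoD) simp
  then obtain k where k: "C' * C * (q / e) ^ k < 1 / 2" by (auto simp: eventually_sequentially)
  have B_pow: "norm ((B ^^ k) y) \<le> 1 / 2 * norm y" if y: "y \<in> ?H" for y
  proof -
    have "e ^ k * norm ((B ^^ k) y) \<le> C' * norm ((?A ^^ k) y)"
      unfolding B_def RA[OF y] by (rule C'(2)[OF bop_mem[OF bop_funpow[OF A_H] y]])
    also have "\<dots> \<le> C' * (C * q ^ k * norm y)"
      using bound[of k y] C'(1) by (intro mult_left_mono) auto
    finally have "norm ((B ^^ k) y) \<le> C' * C * (q / e) ^ k * norm y"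
      using e by (simp add: power_divide field_simps)
    also have "\<dots> \<le> 1 / 2 * norm y" using k by (intro mult_right_mono) auto
    finally show ?thesis .
  qed
  have "regular_on ?H (\<lambda>y. y - (-1) *\<^sub>C B y)"
  proof (rule regular_on_id_minus_power_contraction[OF H bop_scale[OF H(1) B], of "1 / 2" k])
    show "norm (((\<lambda>y. (-1) *\<^sub>C B y) ^^ k) y) \<le> 1 / 2 * norm y" if "y \<in> ?H" for y
      unfolding funpow_scaleC[OF H(1) B that] using B_pow[OF that] by (simp add: norm_scaleC norm_power)
  qed simp
  then have "regular_on ?H (\<lambda>y. ?f (y - (-1) *\<^sub>C B y))" by (rule regular_on_comp[OF f])
  moreover have "?f (y - (-1) *\<^sub>C B y) = T y + S y - l *\<^sub>C y" if y: "y \<in> ?H" for y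
  proof -
    have "?f (y - (-1) *\<^sub>C B y) = ?f y + ?f (B y)"
      by (simp add: cblinfun_add scaleC_add_right)
    also have "?f (B y) = ?A y" unfolding B_def by (rule R(3)[OF bop_mem[OF A_H y]])
    finally show ?thesis by (simp add: complex_vector.scale_left_diff_distrib)
  qed
  ultimately show ?thesis by (rule regular_on_eq[OF _ _ H(1)])
qed

lemma hyper_decomposition_near_scalar:
  fixes T S :: "'a::cbanach \<Rightarrow>\<^sub>C\<^sub>L 'a"
  assumes dec: "decomposable T" and comm: "S o\<^sub>C\<^sub>L T = T o\<^sub>C\<^sub>L S"
    and bound: "\<And>k x. norm (((\<lambda>x. S x - m *\<^sub>C x) ^^ k) x) \<le> C * q ^ k * norm x"
    and q: "0 \<le> q" "q < e"
    and cover: "\<And>z. ball z (2 * e) \<subseteq> U \<or> ball z (2 * e) \<subseteq> V"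
  shows "hyper_decomposition T S U V"
proof -
  \<comment> \<open>Points that can be moved by \<open>m\<close> and then by at most
    \<open>e\<close> without leaving the set; the interior is taken because decomposability asks for
    an open cover. Of the radius \<open>2 * e\<close> in \<open>cover\<close>, one \<open>e\<close>
    pays for the motion and the other for the interior.\<close>
  define I where "I U = interior {z. cball (z + m) e \<subseteq> U}" for U
  have I: "z \<in> I U" if sub: "ball (z + m) (2 * e) \<subseteq> U" for z U
  proof -
    have "ball z e \<subseteq> {z. cball (z + m) e \<subseteq> U}"
    proof safe
      fix w v assume w: "w \<in> ball z e" and v: "v \<in> cball (w + m) e"
      have "dist (z + m) v \<le> dist (z + m) (w + m) + dist (w + m) v" by (rule dist_triangle)
      with w v have "v \<in> ball (z + m) (2 * e)" by simp
      with sub show "v \<in> U" by blast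
    qed
    moreover have "e > 0" using q by linarith
    ultimately show ?thesis unfolding I_def mem_interior by blast
  qed
  have "open (I U)" "open (I V)" by (simp_all add: I_def)
  moreover have "I U \<union> I V = UNIV" using I cover by blast
  ultimately obtain Y Z where Y: "complex_vector.subspace Y" "T ` Y \<subseteq> Y"
    and Z: "complex_vector.subspace Z" "T ` Z \<subseteq> Z"
    and sum: "\<And>x. \<exists>y\<in>Y. \<exists>z\<in>Z. x = y + z"
    and sp: "spectrum_on Y T \<subseteq> I U" "spectrum_on Z T \<subseteq> I V"
    using dec[unfolded decomposable_def, rule_format, of "I U" "I V"] by blast
  show ?thesis
    unfolding hyper_decomposition_def
  proof (rule exI[of _ "hyper_hull T Y"], rule exI[of _ "hyper_hull T Z"], intro conjI allI impI hyper_hull_closed_subspace)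
    show "\<exists>y\<in>hyper_hull T Y. \<exists>z\<in>hyper_hull T Z. x = y + z" for x
      using sum[of x] subset_hyper_hull by blast
    show "regular_on (hyper_hull T Y) (\<lambda>y. T y + S y - l *\<^sub>C y)" if "l \<notin> U" for l
      by (rule hyper_hull_regular_perturbed[OF dec comm bound q Y sp(1)[unfolded I_def] that])
    show "regular_on (hyper_hull T Z) (\<lambda>y. T y + S y - l *\<^sub>C y)" if "l \<notin> V" for l
      by (rule hyper_hull_regular_perturbed[OF dec comm bound q Z sp(2)[unfolded I_def] that])
  qed (auto dest: hyper_hull_invariant)
qed

section \<open>Gluing along a projection\<close>

lemma closed_subspace_preimage:
  fixes f g :: "'a::complex_normed_vector \<Rightarrow> 'a"
  assumes f: "f = cblinfun_apply F" and g: "g = cblinfun_apply G"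
    and Y: "complex_vector.subspace Y1" "closed Y1" "complex_vector.subspace Y2" "closed Y2"
  shows "complex_vector.subspace {x. f x \<in> Y1 \<and> g x \<in> Y2}" "closed {x. f x \<in> Y1 \<and> g x \<in> Y2}"
proof -
  show "complex_vector.subspace {x. f x \<in> Y1 \<and> g x \<in> Y2}"
    unfolding f g
    by (rule complex_vector.subspaceI)
      (auto simp: cblinfun_zero cblinfun_add cblinfun_apply_scaleC complex_vector.subspace_0
        complex_vector.subspace_add complex_vector.subspace_scale Y)
  have "closed (f -` Y1)" "closed (g -` Y2)"
    unfolding f g
    by (intro closed_vimage Y linear_continuous_on bounded_linear_cblinfun_apply)+
  moreover have "{x. f x \<in> Y1 \<and> g x \<in> Y2} = f -` Y1 \<inter> g -` Y2" by blast
  ultimately show "closed {x. f x \<in> Y1 \<and> g x \<in> Y2}" by (simp only: closed_Int)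
qed

text \<open>\<open>Y1\<close> and \<open>Y2\<close> need not lie in the ranges of \<open>P\<close>
  and \<open>Q\<close>, and \<open>F1\<close>, \<open>F2\<close> have to agree with \<open>F\<close>
  only on those ranges. Commuting with the projections transports their invertibility to
  \<open>Y\<close>.\<close>

lemma regular_on_direct_sum:
  fixes F P Q :: "'a::cbanach \<Rightarrow>\<^sub>C\<^sub>L 'a" and F1 F2 :: "'a \<Rightarrow> 'a"
  assumes P: "\<And>x. P (P x) = P x" and Q: "Q = cblinfun_id - P"
    and Y1: "complex_vector.subspace Y1" "P ` Y1 \<subseteq> Y1"
    and Y2: "complex_vector.subspace Y2" "Q ` Y2 \<subseteq> Y2"
    and Y: "Y = {x. P x \<in> Y1 \<and> Q x \<in> Y2}" "complex_vector.subspace Y"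
    and F: "\<And>x. P (F x) = F (P x)"
    and F1: "regular_on Y1 F1" "\<And>x. F1 (P x) = F (P x)" "\<And>x. P (F1 x) = F1 (P x)"
    and F2: "regular_on Y2 F2" "\<And>x. F2 (Q x) = F (Q x)" "\<And>x. Q (F2 x) = F2 (Q x)"
  shows "regular_on Y F"
proof -
  have Q_app: "Q x = x - P x" for x
    by (simp add: Q minus_cblinfun.rep_eq cblinfun_id.rep_eq)
  have QF: "Q (F x) = F (Q x)" for x by (simp add: Q_app F cblinfun_diff)
  have PQ: "P (Q x) = 0" "Q (P x) = 0" "Q (Q x) = Q x" "P x + Q x = x" for x
    by (simp_all add: Q_app P cblinfun_diff)
  obtain c1 where c1: "c1 > 0" "\<And>y. y \<in> Y1 \<Longrightarrow> c1 * norm y \<le> norm (F1 y)"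
    using regular_on_bounded_below[OF F1(1)] by metis
  obtain c2 where c2: "c2 > 0" "\<And>y. y \<in> Y2 \<Longrightarrow> c2 * norm y \<le> norm (F2 y)"
    using regular_on_bounded_below[OF F2(1)] by metis
  obtain K where K: "K > 0" "\<And>x. norm (P x) \<le> K * norm x" using cblinfun_bound[of P] by metis
  obtain L where L: "L > 0" "\<And>x. norm (Q x) \<le> L * norm x" using cblinfun_bound[of Q] by metis
  have FY: "F ` Y \<subseteq> Y"
  proof safe
    fix x assume "x \<in> Y"
    then have "P (F x) = F1 (P x)" "P x \<in> Y1" "Q (F x) = F2 (Q x)" "Q x \<in> Y2"
      by (simp_all add: Y F F1(2) QF F2(2))
    then show "F x \<in> Y"
      using bop_mem[OF regular_on_bop[OF F1(1)]] bop_mem[OF regular_on_bop[OF F2(1)]] by (simp add: Y)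
  qed
  \<comment> \<open>From \<open>norm x \<le> norm (P x) + norm (Q x)\<close>, with each part
    estimated through \<open>F1\<close> or \<open>F2\<close>.\<close>
  define c where "c = 1 / (K / c1 + L / c2)"
  show ?thesis
  proof (rule regular_onI_bounded_below[OF Y(2) bop_cblinfun[OF FY]])
    have s: "K / c1 + L / c2 > 0" using K L c1 c2 by (intro add_pos_pos divide_pos_pos) auto
    then show "c > 0" by (simp add: c_def)
    show "c * norm x \<le> norm (F x)" if x: "x \<in> Y" for x
    proof -
      have "c1 * norm (P x) \<le> norm (P (F x))"
        using c1(2)[of "P x"] x by (simp add: Y F F1(2))
      with K(2)[of "F x"] have "norm (P x) \<le> K / c1 * norm (F x)" using c1(1) by (simp add: field_simps)
      moreover have "c2 * norm (Q x) \<le> norm (Q (F x))"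
        using c2(2)[of "Q x"] x by (simp add: Y QF F2(2))
      with L(2)[of "F x"] have "norm (Q x) \<le> L / c2 * norm (F x)" using c2(1) by (simp add: field_simps)
      ultimately have "norm x \<le> (K / c1 + L / c2) * norm (F x)"
        using norm_triangle_ineq[of "P x" "Q x"] unfolding PQ(4) distrib_right by linarith
      with s show ?thesis unfolding c_def by (simp add: pos_divide_le_eq mult.commute)
    qed
    fix y assume y: "y \<in> Y"
    obtain u1 where u1: "u1 \<in> Y1" "F1 u1 = P y"
      using regular_on_surj[OF F1(1), of "P y"] y by (auto simp: Y)
    obtain u2 where u2: "u2 \<in> Y2" "F2 u2 = Q y"
      using regular_on_surj[OF F2(1), of "Q y"] y by (auto simp: Y)
    \<comment> \<open>\<open>u1\<close> and \<open>u2\<close> may have components in the wrong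
      summand; projecting them keeps them preimages.\<close>
    have "F (P u1 + Q u2) = F1 (P u1) + F2 (Q u2)" by (simp add: cblinfun_add F1(2) F2(2))
    also have "\<dots> = P (P y) + Q (Q y)" by (simp flip: F1(3) F2(3) add: u1 u2)
    also have "\<dots> = y" by (simp add: P PQ)
    finally have "F (P u1 + Q u2) = y" .
    moreover have "P (P u1 + Q u2) = P u1" "Q (P u1 + Q u2) = Q u2"
      by (simp_all add: cblinfun_add P PQ)
    then have "P u1 + Q u2 \<in> Y" using u1 u2 Y1 Y2 by (auto simp: Y)
    ultimately show "\<exists>x\<in>Y. F x = y" by blast
  qed
qed

text \<open>\<open>S1\<close> keeps \<open>S\<close> on the range of \<open>P\<close> and is the
  scalar \<open>m\<close> on the range of \<open>Q\<close>, so it can be close to a scalar on the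
  whole space. \<open>bicomm\<close> puts \<open>P\<close> in the bicommutant of \<open>S\<close>:
  hence \<open>P\<close> commutes with \<open>T\<close>, and every \<open>B\<close> commuting with
  \<open>S\<close> commutes with \<open>S1\<close> and \<open>S2\<close>, so hyperinvariance
  survives the gluing.\<close>

lemma hyper_decomposition_direct_sum:
  fixes T S P Q S1 S2 :: "'a::cbanach \<Rightarrow>\<^sub>C\<^sub>L 'a"
  assumes comm: "S o\<^sub>C\<^sub>L T = T o\<^sub>C\<^sub>L S" and P: "P o\<^sub>C\<^sub>L P = P"
    and bicomm: "\<And>B. B o\<^sub>C\<^sub>L S = S o\<^sub>C\<^sub>L B \<Longrightarrow> B o\<^sub>C\<^sub>L P = P o\<^sub>C\<^sub>L B"
    and Q: "Q = cblinfun_id - P"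
    and S1: "S1 = S o\<^sub>C\<^sub>L P + m *\<^sub>C Q" and S2: "S2 = S o\<^sub>C\<^sub>L Q"
    and dec1: "hyper_decomposition T S1 U V" and dec2: "hyper_decomposition T S2 U V"
  shows "hyper_decomposition T S U V"
proof -
  have Q_app: "Q x = x - P x" for x
    by (simp add: Q minus_cblinfun.rep_eq cblinfun_id.rep_eq)
  have PP: "P (P x) = P x" for x using arg_cong[OF P, of "\<lambda>F. cblinfun_apply F x"] by (simp add: cblinfun_compose.rep_eq)
  have PQ: "P (Q x) = 0" "Q (P x) = 0" "Q (Q x) = Q x" "P x + Q x = x" for x
    by (simp_all add: Q_app PP cblinfun_diff)
  have S1_app: "S1 x = S (P x) + m *\<^sub>C Q x" for x
    by (simp add: S1 plus_cblinfun.rep_eq cblinfun_compose.rep_eq scaleC_cblinfun.rep_eq)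
  have S2_app: "S2 x = S (Q x)" for x
    by (simp add: S2 cblinfun_compose.rep_eq)
  have inherit: "B o\<^sub>C\<^sub>L P = P o\<^sub>C\<^sub>L B \<and> B o\<^sub>C\<^sub>L S1 = S1 o\<^sub>C\<^sub>L B \<and> B o\<^sub>C\<^sub>L S2 = S2 o\<^sub>C\<^sub>L B"
    if "B o\<^sub>C\<^sub>L S = S o\<^sub>C\<^sub>L B" for B
    using that bicomm[OF that] unfolding commute_iff
    by (simp add: S1_app S2_app Q_app cblinfun_add cblinfun_diff cblinfun_apply_scaleC)
  have PS: "P o\<^sub>C\<^sub>L S = S o\<^sub>C\<^sub>L P" by (rule bicomm[OF refl, symmetric])
  have PT: "P o\<^sub>C\<^sub>L T = T o\<^sub>C\<^sub>L P" by (rule bicomm[OF comm[symmetric], symmetric])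
  have QT: "Q o\<^sub>C\<^sub>L T = T o\<^sub>C\<^sub>L Q" and QS: "Q o\<^sub>C\<^sub>L S = S o\<^sub>C\<^sub>L Q"
    using PT PS unfolding commute_iff by (simp_all add: Q_app cblinfun_diff)
  from dec1 obtain Y1 Z1 where d1: "complex_vector.subspace Y1 \<and> closed Y1 \<and> complex_vector.subspace Z1 \<and> closed Z1 \<and>
        (\<forall>B. B o\<^sub>C\<^sub>L T = T o\<^sub>C\<^sub>L B \<and> B o\<^sub>C\<^sub>L S1 = S1 o\<^sub>C\<^sub>L B \<longrightarrow> B ` Y1 \<subseteq> Y1 \<and> B ` Z1 \<subseteq> Z1) \<and>
        (\<forall>x. \<exists>y\<in>Y1. \<exists>z\<in>Z1. x = y + z) \<and>
        (\<forall>l. l \<notin> U \<longrightarrow> regular_on Y1 (\<lambda>y. T y + S1 y - l *\<^sub>C y)) \<and>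
        (\<forall>l. l \<notin> V \<longrightarrow> regular_on Z1 (\<lambda>y. T y + S1 y - l *\<^sub>C y))"
    unfolding hyper_decomposition_def by (elim exE)
  have 1: "complex_vector.subspace Y1" "closed Y1" "complex_vector.subspace Z1" "closed Z1"
      "\<And>B. B o\<^sub>C\<^sub>L T = T o\<^sub>C\<^sub>L B \<Longrightarrow> B o\<^sub>C\<^sub>L S = S o\<^sub>C\<^sub>L B \<Longrightarrow> B ` Y1 \<subseteq> Y1 \<and> B ` Z1 \<subseteq> Z1"
      "\<And>x. \<exists>y\<in>Y1. \<exists>z\<in>Z1. x = y + z"
      "\<And>l. l \<notin> U \<Longrightarrow> regular_on Y1 (\<lambda>y. T y + S1 y - l *\<^sub>C y)"
      "\<And>l. l \<notin> V \<Longrightarrow> regular_on Z1 (\<lambda>y. T y + S1 y - l *\<^sub>C y)"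
    using d1 inherit by simp_all
  from dec2 obtain Y2 Z2 where d2: "complex_vector.subspace Y2 \<and> closed Y2 \<and> complex_vector.subspace Z2 \<and> closed Z2 \<and>
        (\<forall>B. B o\<^sub>C\<^sub>L T = T o\<^sub>C\<^sub>L B \<and> B o\<^sub>C\<^sub>L S2 = S2 o\<^sub>C\<^sub>L B \<longrightarrow> B ` Y2 \<subseteq> Y2 \<and> B ` Z2 \<subseteq> Z2) \<and>
        (\<forall>x. \<exists>y\<in>Y2. \<exists>z\<in>Z2. x = y + z) \<and>
        (\<forall>l. l \<notin> U \<longrightarrow> regular_on Y2 (\<lambda>y. T y + S2 y - l *\<^sub>C y)) \<and>
        (\<forall>l. l \<notin> V \<longrightarrow> regular_on Z2 (\<lambda>y. T y + S2 y - l *\<^sub>C y))"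
    unfolding hyper_decomposition_def by (elim exE)
  have 2: "complex_vector.subspace Y2" "closed Y2" "complex_vector.subspace Z2" "closed Z2"
      "\<And>B. B o\<^sub>C\<^sub>L T = T o\<^sub>C\<^sub>L B \<Longrightarrow> B o\<^sub>C\<^sub>L S = S o\<^sub>C\<^sub>L B \<Longrightarrow> B ` Y2 \<subseteq> Y2 \<and> B ` Z2 \<subseteq> Z2"
      "\<And>x. \<exists>y\<in>Y2. \<exists>z\<in>Z2. x = y + z"
      "\<And>l. l \<notin> U \<Longrightarrow> regular_on Y2 (\<lambda>y. T y + S2 y - l *\<^sub>C y)"
      "\<And>l. l \<notin> V \<Longrightarrow> regular_on Z2 (\<lambda>y. T y + S2 y - l *\<^sub>C y)"
    using d2 inherit by simp_all
  define sum where "sum A B = {x. P x \<in> A \<and> Q x \<in> B}" for A B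
  have sub: "complex_vector.subspace (sum A B)" "closed (sum A B)"
    if "complex_vector.subspace A" "closed A" "complex_vector.subspace B" "closed B" for A B
    unfolding sum_def by (rule closed_subspace_preimage[OF refl refl that])+
  have inv: "B ` sum X1 X2 \<subseteq> sum X1 X2" if "B o\<^sub>C\<^sub>L S = S o\<^sub>C\<^sub>L B" "B ` X1 \<subseteq> X1" "B ` X2 \<subseteq> X2" for B X1 X2
  proof -
    have "P (B x) = B (P x)" "Q (B x) = B (Q x)" for x
      using bicomm[OF that(1)] by (simp_all add: commute_iff Q_app cblinfun_diff)
    then show ?thesis using that(2,3) by (auto simp: sum_def)
  qed
  have reg: "regular_on (sum X1 X2) (\<lambda>y. T y + S y - l *\<^sub>C y)"
    if X: "complex_vector.subspace X1" "closed X1" "complex_vector.subspace X2" "closed X2" "P ` X1 \<subseteq> X1" "Q ` X2 \<subseteq> X2"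
      and r1: "regular_on X1 (\<lambda>y. T y + S1 y - l *\<^sub>C y)"
      and r2: "regular_on X2 (\<lambda>y. T y + S2 y - l *\<^sub>C y)" for X1 X2 l
  proof -
    define F where "F = T + S - l *\<^sub>C cblinfun_id"
    have F: "F x = T x + S x - l *\<^sub>C x" for x
      by (simp add: F_def plus_cblinfun.rep_eq minus_cblinfun.rep_eq scaleC_cblinfun.rep_eq cblinfun_id.rep_eq)
    have "regular_on (sum X1 X2) F"
      by (rule regular_on_direct_sum[OF PP Q X(1,5) X(3,6) sum_def sub(1)[OF X(1-4)] _ r1 _ _ r2])
        (use PT PS QT QS in \<open>simp_all add: F S1_app S2_app PP PQ commute_iff cblinfun_add cblinfun_diff
          cblinfun_apply_scaleC cblinfun_zero\<close>)
    then show ?thesis by (rule regular_on_eq[OF _ F sub(1)[OF X(1-4)]])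
  qed
  have PY: "P ` Y1 \<subseteq> Y1" "P ` Z1 \<subseteq> Z1" "P ` Y2 \<subseteq> Y2" "P ` Z2 \<subseteq> Z2"
    and QY: "Q ` Y2 \<subseteq> Y2" "Q ` Z2 \<subseteq> Z2"
    using 1(5)[OF PT PS] 2(5)[OF PT PS] 2(5)[OF QT QS] by auto
  show ?thesis
    unfolding hyper_decomposition_def
  proof (rule exI[of _ "sum Y1 Y2"], rule exI[of _ "sum Z1 Z2"], intro conjI allI impI)
    show "\<exists>y\<in>sum Y1 Y2. \<exists>z\<in>sum Z1 Z2. x = y + z" for x
    proof -
      obtain y1 z1 where x1: "y1 \<in> Y1" "z1 \<in> Z1" "P x = y1 + z1" using 1(6) by blast
      obtain y2 z2 where x2: "y2 \<in> Y2" "z2 \<in> Z2" "Q x = y2 + z2" using 2(6) by blast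
      have "x = P (P x) + Q (Q x)" by (simp add: PP PQ)
      also have "\<dots> = (P y1 + Q y2) + (P z1 + Q z2)"
        unfolding x1(3) x2(3) cblinfun_add by simp
      finally have "x = (P y1 + Q y2) + (P z1 + Q z2)" .
      moreover have "P (P a + Q b) = P a" "Q (P a + Q b) = Q b" for a b
        by (simp_all add: cblinfun_add PP PQ)
      then have "P y1 + Q y2 \<in> sum Y1 Y2" "P z1 + Q z2 \<in> sum Z1 Z2"
        using x1(1,2) x2(1,2) PY QY by (auto simp: sum_def)
      ultimately show ?thesis by blast
    qed
    show "regular_on (sum Y1 Y2) (\<lambda>y. T y + S y - l *\<^sub>C y)" if "l \<notin> U" for l
      by (rule reg[OF 1(1,2) 2(1,2) PY(1) QY(1) 1(7)[OF that] 2(7)[OF that]])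
    show "regular_on (sum Z1 Z2) (\<lambda>y. T y + S y - l *\<^sub>C y)" if "l \<notin> V" for l
      by (rule reg[OF 1(3,4) 2(3,4) PY(2) QY(2) 1(8)[OF that] 2(8)[OF that]])
    show "B ` sum Y1 Y2 \<subseteq> sum Y1 Y2" "B ` sum Z1 Z2 \<subseteq> sum Z1 Z2"
      if "B o\<^sub>C\<^sub>L T = T o\<^sub>C\<^sub>L B \<and> B o\<^sub>C\<^sub>L S = S o\<^sub>C\<^sub>L B" for B
      using that 1(5)[of B] 2(5)[of B] by (auto intro!: inv[THEN subsetD])
  qed (rule sub[OF 1(1,2) 2(1,2)] sub[OF 1(3,4) 2(3,4)])+
qed

section \<open>Splitting off spectral points\<close>

lemma cblinfun_minus:
  fixes T :: "'a::complex_normed_vector \<Rightarrow>\<^sub>C\<^sub>L 'a"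
  shows "T (- x) = - T x"
  using cblinfun_diff[of T 0 x] by (simp add: cblinfun_zero)

lemma spectral_projection_at:
  fixes S :: "'a::cbanach \<Rightarrow>\<^sub>C\<^sub>L 'a"
  assumes r: "r > 0" and circle: "\<forall>z. cmod (z - l) = r \<longrightarrow> z \<notin> spectrum S"
  shows "\<exists>P C. P o\<^sub>C\<^sub>L P = P \<and> (\<forall>B. B o\<^sub>C\<^sub>L S = S o\<^sub>C\<^sub>L B \<longrightarrow> B o\<^sub>C\<^sub>L P = P o\<^sub>C\<^sub>L B) \<and>
    (\<forall>k x. norm (((\<lambda>x. S x - l *\<^sub>C x) ^^ k) (cblinfun_apply P x)) \<le> C * r ^ k * norm x) \<and>
    regular_on {x. cblinfun_apply P x = 0} (\<lambda>x. S x - l *\<^sub>C x)"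
proof -
  let ?N = "\<lambda>x. S x - l *\<^sub>C x"
  let ?c = "complex_of_real (1 / r)"
  define A where "A = (\<lambda>x. ?c *\<^sub>C ?N x)"
  have N: "bounded_operator_on UNIV ?N" by (rule bop_shift[OF complex_vector.subspace_UNIV bop_UNIV])
  have A: "bounded_operator_on UNIV A"
    unfolding A_def by (rule bop_scale[OF complex_vector.subspace_UNIV N])
  have reg: "regular_on UNIV (\<lambda>y. y - w *\<^sub>C A y)" if w: "cmod w = 1" for w
  proof -
    have w0: "w \<noteq> 0" using w by auto
    \<comment> \<open>With this point of the circle,
      \<open>1 - w A = - (w / r) (S - z)\<close>.\<close>
    define z where "z = l + of_real r / w"
    have "cmod (z - l) = r" using w r by (simp add: z_def norm_divide)
    then have "regular_on UNIV (\<lambda>y. S y - z *\<^sub>C y)"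
      using circle spectrum_regular by blast
    then have "regular_on UNIV (\<lambda>y. (- (w * ?c)) *\<^sub>C (S y - z *\<^sub>C y))"
      by (rule regular_on_scale[OF complex_vector.subspace_UNIV]) (use w0 r in simp)
    moreover have "(- (w * ?c)) *\<^sub>C (S y - z *\<^sub>C y) = y - w *\<^sub>C A y" for y
    proof -
      have eq: "S y - z *\<^sub>C y = ?N y - (of_real r / w) *\<^sub>C y"
        by (simp add: z_def scaleC_add_left)
      have gen: "(- a) *\<^sub>C (u - b *\<^sub>C y) = (a * b) *\<^sub>C y - a *\<^sub>C u" for a b u
        by (simp add: complex_vector.scale_right_diff_distrib scaleC_scaleC)
      have "(- (w * ?c)) *\<^sub>C (S y - z *\<^sub>C y)
          = ((w * ?c) * (of_real r / w)) *\<^sub>C y - (w * ?c) *\<^sub>C ?N y"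
        unfolding eq by (rule gen)
      also have "(w * ?c) * (of_real r / w) = 1" using w0 r by simp
      finally show ?thesis by (simp add: A_def scaleC_scaleC)
    qed
    ultimately show ?thesis by (rule regular_on_eq) (rule complex_vector.subspace_UNIV)
  qed
  show ?thesis
  proof (rule spectral_projection[OF complex_vector.subspace_UNIV closed_UNIV A reg])
    fix P0 C assume P0: "bounded_operator_on UNIV P0" "\<And>y. y \<in> UNIV \<Longrightarrow> P0 (P0 y) = P0 y"
      "\<And>B y. bounded_operator_on UNIV B \<Longrightarrow> (\<And>y. y \<in> UNIV \<Longrightarrow> B (A y) = A (B y)) \<Longrightarrow> y \<in> UNIV \<Longrightarrow> B (P0 y) = P0 (B y)"
      "\<And>k y. y \<in> UNIV \<Longrightarrow> norm ((A ^^ k) (P0 y)) \<le> C * norm y"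
      "regular_on {y \<in> UNIV. P0 y = 0} A"
    obtain P where P: "P0 = cblinfun_apply P" using P0(1) bounded_operator_on_UNIV by blast
    show ?thesis
    proof (intro exI[of _ P] exI[of _ C] conjI allI impI)
      show "P o\<^sub>C\<^sub>L P = P"
        by (rule cblinfun_eqI) (use P0(2) in \<open>simp add: cblinfun_compose.rep_eq P\<close>)
      show "B o\<^sub>C\<^sub>L P = P o\<^sub>C\<^sub>L B" if B: "B o\<^sub>C\<^sub>L S = S o\<^sub>C\<^sub>L B" for B
      proof -
        have "B (A y) = A (B y)" for y
          using B by (simp add: commute_iff A_def cblinfun_diff cblinfun_apply_scaleC)
        then have "B (P0 y) = P0 (B y)" for y by (intro P0(3) bop_UNIV) auto
        then show ?thesis by (simp add: commute_iff P)
      qed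
      show "norm ((?N ^^ k) (P x)) \<le> C * r ^ k * norm x" for k x
      proof -
        have "(A ^^ k) (P x) = ?c ^ k *\<^sub>C (?N ^^ k) (P x)"
          unfolding A_def by (rule funpow_scaleC[OF complex_vector.subspace_UNIV N UNIV_I])
        then have "norm ((?N ^^ k) (P x)) / r ^ k \<le> C * norm x"
          using P0(4)[of x k] r by (simp add: P norm_scaleC norm_power norm_divide power_divide)
        then show ?thesis using r by (simp add: field_simps)
      qed
      have sub: "complex_vector.subspace {x. P x = 0}"
        by (rule complex_vector.subspaceI) (simp_all add: cblinfun_zero cblinfun_add cblinfun_apply_scaleC)
      have "regular_on {x. P x = 0} A" using P0(5) by (simp add: P)
      then have "regular_on {x. P x = 0} (\<lambda>x. of_real r *\<^sub>C A x)"
        by (rule regular_on_scale[OF sub]) (use r in simp)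
      then show "regular_on {x. P x = 0} ?N"
        by (rule regular_on_eq[OF _ _ sub]) (use r in \<open>simp add: A_def scaleC_scaleC\<close>)
    qed
  qed
qed

text \<open>\<open>S Q - z\<close> acts as \<open>- z\<close> on the range of \<open>P\<close> and
  as \<open>S - z\<close> on its kernel. The first is invertible away from 0, and on the kernel
  \<open>S - l\<close> is invertible by assumption.\<close>

lemma spectrum_remove_point:
  fixes S P Q :: "'a::cbanach \<Rightarrow>\<^sub>C\<^sub>L 'a"
  assumes P: "P o\<^sub>C\<^sub>L P = P" and PS: "P o\<^sub>C\<^sub>L S = S o\<^sub>C\<^sub>L P" and Q: "Q = cblinfun_id - P"
    and reg: "regular_on {x. P x = 0} (\<lambda>x. S x - l *\<^sub>C x)"
  shows "spectrum (S o\<^sub>C\<^sub>L Q) \<subseteq> insert 0 (spectrum S - {l})"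
proof
  fix z assume z: "z \<in> spectrum (S o\<^sub>C\<^sub>L Q)"
  have Q_app: "Q x = x - P x" for x
    by (simp add: Q minus_cblinfun.rep_eq cblinfun_id.rep_eq)
  have PP: "P (P x) = P x" for x using arg_cong[OF P, of "\<lambda>F. cblinfun_apply F x"] by (simp add: cblinfun_compose.rep_eq)
  have PS': "P (S x) = S (P x)" for x using PS by (simp add: commute_iff)
  show "z \<in> insert 0 (spectrum S - {l})"
  proof (rule ccontr)
    assume "z \<notin> insert 0 (spectrum S - {l})"
    then have z0: "z \<noteq> 0" and zl: "z \<notin> spectrum S \<or> z = l" by auto
    \<comment> \<open>At \<open>z = l\<close> invertibility is known on the kernel of
      \<open>P\<close> only; for other \<open>z\<close> the whole space can be taken.\<close>
    obtain Y where Y: "regular_on Y (\<lambda>x. S x - z *\<^sub>C x)" "complex_vector.subspace Y" "\<And>x. Q x \<in> Y"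
    proof (cases "z = l")
      case True
      have "complex_vector.subspace {x. P x = 0}"
        by (rule complex_vector.subspaceI) (simp_all add: cblinfun_zero cblinfun_add cblinfun_apply_scaleC)
      then show ?thesis using that[of "{x. P x = 0}"] reg True by (simp add: Q_app cblinfun_diff PP)
    next
      case False
      then show ?thesis using that[of UNIV] zl spectrum_regular[of z S] by (simp add: complex_vector.subspace_UNIV)
    qed
    define F where "F = S o\<^sub>C\<^sub>L Q - z *\<^sub>C cblinfun_id"
    have F: "F x = S (Q x) - z *\<^sub>C x" for x
      by (simp add: F_def minus_cblinfun.rep_eq scaleC_cblinfun.rep_eq cblinfun_id.rep_eq cblinfun_compose.rep_eq)
    have "regular_on UNIV (\<lambda>x :: 'a. x)" by (rule regular_onI[OF bop_ident bop_ident]) auto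
    then have D: "regular_on UNIV (\<lambda>x :: 'a. (- z) *\<^sub>C x)"
      by (rule regular_on_scale[OF complex_vector.subspace_UNIV]) (use z0 in simp)
    have "regular_on UNIV F"
      by (rule regular_on_direct_sum[OF PP Q complex_vector.subspace_UNIV _ Y(2) _ _ complex_vector.subspace_UNIV _ D _ _ Y(1)])
        (use Y(3) in \<open>auto simp: F Q_app PP PS' cblinfun_diff cblinfun_apply_scaleC
          cblinfun_zero cblinfun_minus complex_vector.scale_right_diff_distrib\<close>)
    then have "regular_on UNIV (\<lambda>x. (S o\<^sub>C\<^sub>L Q) x - z *\<^sub>C x)"
      by (rule regular_on_eq[OF _ _ complex_vector.subspace_UNIV]) (simp add: F cblinfun_compose.rep_eq)
    then show False using z spectrum_regular by blast
  qed
qed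

lemma spectrum_subset_ball_power_bounded:
  fixes S :: "'a::cbanach \<Rightarrow>\<^sub>C\<^sub>L 'a"
  assumes "spectrum S \<subseteq> ball 0 r" "r > 0"
  obtains C where "\<And>k x. norm ((cblinfun_apply S ^^ k) x) \<le> C * r ^ k * norm x"
proof -
  have "regular_on UNIV (\<lambda>y. S y - z *\<^sub>C y)" if "cmod z \<ge> r" for z
    using assms(1) that spectrum_regular[of z S] by auto
  then show ?thesis
    using power_bounded_of_shifts_regular[OF complex_vector.subspace_UNIV closed_UNIV bop_UNIV assms(2)] that
    by (metis UNIV_I)
qed

text \<open>Induction on the number of spectral points outside the disc of radius
  \<open>e / 2\<close>. Splitting one off lowers it, for the 0 that may enter the spectrum of
  \<open>S Q\<close> lies inside the disc. Only \<open>S\<close> varies; \<open>T\<close>, the cover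
  and \<open>e\<close> stay fixed.\<close>

lemma hyper_decomposition_finite_outer_spectrum:
  fixes T S :: "'a::cbanach \<Rightarrow>\<^sub>C\<^sub>L 'a"
  assumes dec: "decomposable T" and e: "e > 0"
    and cover: "\<And>z. ball z (2 * e) \<subseteq> U \<or> ball z (2 * e) \<subseteq> V"
    and "S o\<^sub>C\<^sub>L T = T o\<^sub>C\<^sub>L S" and "\<And>d. d > 0 \<Longrightarrow> finite (spectrum S - ball 0 d)"
  shows "hyper_decomposition T S U V"
  using assms(4,5)
proof (induction "card (spectrum S - ball 0 (e / 2))" arbitrary: S rule: less_induct)
  case less
  note comm = less.prems(1) and fin = less.prems(2)
  show ?case
  proof (cases "spectrum S \<subseteq> ball 0 (e / 2)")
    case True
    obtain C where C: "\<And>k x. norm ((cblinfun_apply S ^^ k) x) \<le> C * (e / 2) ^ k * norm x"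
      using spectrum_subset_ball_power_bounded[OF True] e by auto
    have "norm (((\<lambda>x. S x - 0 *\<^sub>C x) ^^ k) x) \<le> C * (e / 2) ^ k * norm x" for k x
      using C[of k x] by simp
    then show ?thesis
      by (rule hyper_decomposition_near_scalar[OF dec comm _ _ _ cover]) (use e in auto)
  next
    case False
    then obtain l where l: "l \<in> spectrum S" "l \<notin> ball 0 (e / 2)" by blast
    \<comment> \<open>The radius is \<open>e / 4\<close> rather than \<open>e / 2\<close>, since a
      small circle around \<open>l\<close> may enter the larger disc.\<close>
    obtain d where d: "d > 0" "\<And>x. x \<in> spectrum S - ball 0 (e / 4) \<Longrightarrow> x \<noteq> l \<Longrightarrow> d \<le> dist l x"
      using finite_set_avoid[OF fin[of "e / 4"], of l] e by auto
    \<comment> \<open>Below \<open>d\<close>, so that no other outer spectral point lies on the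
      circle, and below \<open>e / 4\<close>, so that the circle misses the disc of radius
      \<open>e / 4\<close>.\<close>
    define r where "r = min d (e / 4) / 2"
    have r: "r > 0" "r < d" "r < e / 4" using d(1) e by (auto simp: r_def)
    have circle: "z \<notin> spectrum S" if z: "cmod (z - l) = r" for z
    proof
      assume "z \<in> spectrum S"
      moreover have "cmod l \<le> cmod z + cmod (z - l)" using norm_triangle_sub[of l z] by (simp add: norm_minus_commute)
      then have "z \<notin> ball 0 (e / 4)" using l(2) z r(3) by simp
      moreover have "z \<noteq> l" using z r by auto
      ultimately have "d \<le> dist l z" using d(2) by blast
      then show False using z r(2) by (simp add: dist_norm norm_minus_commute)
    qed
    from spectral_projection_at[of r l S, OF r(1)] circle
    have "\<exists>P C. P o\<^sub>C\<^sub>L P = P \<and> (\<forall>B. B o\<^sub>C\<^sub>L S = S o\<^sub>C\<^sub>L B \<longrightarrow> B o\<^sub>C\<^sub>L P = P o\<^sub>C\<^sub>L B) \<and>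
      (\<forall>k x. norm (((\<lambda>x. S x - l *\<^sub>C x) ^^ k) (cblinfun_apply P x)) \<le> C * r ^ k * norm x) \<and>
      regular_on {x. cblinfun_apply P x = 0} (\<lambda>x. S x - l *\<^sub>C x)" by blast
    then
    obtain P C where P: "P o\<^sub>C\<^sub>L P = P" "\<forall>B. B o\<^sub>C\<^sub>L S = S o\<^sub>C\<^sub>L B \<longrightarrow> B o\<^sub>C\<^sub>L P = P o\<^sub>C\<^sub>L B"
      "\<forall>k x. norm (((\<lambda>x. S x - l *\<^sub>C x) ^^ k) (cblinfun_apply P x)) \<le> C * r ^ k * norm x"
      "regular_on {x. cblinfun_apply P x = 0} (\<lambda>x. S x - l *\<^sub>C x)"
      by (elim exE conjE)
    have bicomm: "B o\<^sub>C\<^sub>L P = P o\<^sub>C\<^sub>L B" if "B o\<^sub>C\<^sub>L S = S o\<^sub>C\<^sub>L B" for B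
      using P(2) that by blast
    define Q where "Q = cblinfun_id - P"
    define S1 where "S1 = S o\<^sub>C\<^sub>L P + l *\<^sub>C Q"
    define S2 where "S2 = S o\<^sub>C\<^sub>L Q"
    have Q_app: "Q x = x - P x" for x
      by (simp add: Q_def minus_cblinfun.rep_eq cblinfun_id.rep_eq)
    have PP: "P (P x) = P x" for x using arg_cong[OF P(1), of "\<lambda>F. cblinfun_apply F x"] by (simp add: cblinfun_compose.rep_eq)
    have S1_app: "S1 x = S (P x) + l *\<^sub>C Q x" for x
      by (simp add: S1_def plus_cblinfun.rep_eq cblinfun_compose.rep_eq scaleC_cblinfun.rep_eq)
    have S2_app: "S2 x = S (Q x)" for x
      by (simp add: S2_def cblinfun_compose.rep_eq)
    have PT: "P (T x) = T (P x)" and ST: "S (T x) = T (S x)" and PS: "P (S x) = S (P x)" for x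
      using bicomm[OF comm[symmetric]] bicomm[OF refl] comm by (simp_all add: commute_iff)
    have S1T: "S1 o\<^sub>C\<^sub>L T = T o\<^sub>C\<^sub>L S1" and S2T: "S2 o\<^sub>C\<^sub>L T = T o\<^sub>C\<^sub>L S2"
      by (simp_all add: commute_iff S1_app S2_app Q_app PT ST cblinfun_add cblinfun_diff cblinfun_apply_scaleC)
    have h1: "hyper_decomposition T S1 U V"
    proof (rule hyper_decomposition_near_scalar[OF dec S1T _ _ _ cover])
      let ?N = "\<lambda>x. S x - l *\<^sub>C x"
      \<comment> \<open>Positive exponents only: at exponent 0 the left side is \<open>x\<close> and
        the right side would be \<open>P x\<close>. This is why the growth constant below is
        \<open>max C 1\<close>.\<close>
      have pow: "((\<lambda>x. S1 x - l *\<^sub>C x) ^^ Suc k) x = (?N ^^ Suc k) (P x)" for k x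
      proof (induction k)
        case 0
        show ?case by (simp add: S1_app Q_app complex_vector.scale_right_diff_distrib)
      next
        case (Suc k)
        have "P ((?N ^^ Suc k) (P x)) = (?N ^^ Suc k) (P (P x))"
          by (rule funpow_commute[of UNIV]) (auto simp: cblinfun_diff cblinfun_apply_scaleC PS)
        then have 1: "P ((?N ^^ Suc k) (P x)) = (?N ^^ Suc k) (P x)" by (simp only: PP)
        have "((\<lambda>x. S1 x - l *\<^sub>C x) ^^ Suc (Suc k)) x = (\<lambda>x. S1 x - l *\<^sub>C x) ((?N ^^ Suc k) (P x))"
          unfolding Suc[symmetric] by simp
        also have "\<dots> = ?N (P ((?N ^^ Suc k) (P x)))"
          by (simp only: S1_app Q_app complex_vector.scale_right_diff_distrib) simp
        also have "\<dots> = (?N ^^ Suc (Suc k)) (P x)" unfolding 1 by simp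
        finally show ?case .
      qed
      show "norm (((\<lambda>x. S1 x - l *\<^sub>C x) ^^ k) x) \<le> max C 1 * r ^ k * norm x" for k x
      proof (cases k)
        case 0
        then show ?thesis using mult_right_mono[of 1 "max C 1" "norm x"] by simp
      next
        case (Suc j)
        have "norm (((\<lambda>x. S1 x - l *\<^sub>C x) ^^ k) x) \<le> C * r ^ k * norm x"
          unfolding Suc pow using P(3) by blast
        also have "\<dots> \<le> max C 1 * r ^ k * norm x"
          using r by (intro mult_right_mono) auto
        finally show ?thesis .
      qed
    qed (use r e in auto)
    have h2: "hyper_decomposition T S2 U V"
    proof (rule less.hyps[OF _ S2T])
      have "P o\<^sub>C\<^sub>L S = S o\<^sub>C\<^sub>L P" by (simp add: commute_iff PS)
      from spectrum_remove_point[OF P(1) this Q_def P(4)]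
      have sub: "spectrum S2 - ball 0 d \<subseteq> (spectrum S - ball 0 d) - {l}" if "d > 0" for d
        using that by (auto simp: S2_def)
      show "finite (spectrum S2 - ball 0 d)" if "d > 0" for d
        using finite_subset[OF sub[OF that]] fin[OF that] by simp
      have "finite (spectrum S - ball 0 (e / 2))" using fin e by simp
      moreover have "l \<in> spectrum S - ball 0 (e / 2)" using l by simp
      ultimately have "card ((spectrum S - ball 0 (e / 2)) - {l}) < card (spectrum S - ball 0 (e / 2))"
        by (rule card_Diff1_less)
      moreover have "card (spectrum S2 - ball 0 (e / 2)) \<le> card ((spectrum S - ball 0 (e / 2)) - {l})"
        using e fin by (intro card_mono sub) auto
      ultimately show "card (spectrum S2 - ball 0 (e / 2)) < card (spectrum S - ball 0 (e / 2))" by linarith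
    qed
    show ?thesis
      by (rule hyper_decomposition_direct_sum[OF comm P(1) _ Q_def S1_def S2_def h1 h2]) (rule bicomm)
  qed
qed

lemma regular_on_outside_bound:
  fixes X :: "'a::cbanach set"
  assumes X: "complex_vector.subspace X" "closed X" and A: "bounded_operator_on X A"
    and K: "\<And>y. norm (A y) \<le> K * norm y" "0 \<le> K" "K < cmod l"
  shows "regular_on X (\<lambda>y. A y - l *\<^sub>C y)"
proof -
  have l0: "l \<noteq> 0" using K(2,3) by auto
  have "regular_on X (\<lambda>y. y - (1 / l) *\<^sub>C A y)"
  proof (rule regular_on_id_minus_contraction[OF X])
    show "bounded_operator_on X (\<lambda>y. (1 / l) *\<^sub>C A y)" by (rule bop_scale[OF X(1) A])
    show "K / cmod l < 1" using K(2,3) by (subst pos_divide_less_eq) auto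
    show "norm ((1 / l) *\<^sub>C A y) \<le> K / cmod l * norm y" for y
      using divide_right_mono[OF K(1)[of y], of "cmod l"] by (simp add: norm_scaleC norm_divide)
  qed
  then have "regular_on X (\<lambda>y. (- l) *\<^sub>C (y - (1 / l) *\<^sub>C A y))"
    by (rule regular_on_scale[OF X(1)]) (use l0 in simp)
  then show ?thesis
    by (rule regular_on_eq[OF _ _ X(1)])
      (use l0 in \<open>simp add: complex_vector.scale_right_diff_distrib scaleC_scaleC\<close>)
qed

lemma decomposable_perturbation:
  fixes T S :: "'a::cbanach \<Rightarrow>\<^sub>C\<^sub>L 'a"
  assumes dec: "decomposable T" and comm: "S o\<^sub>C\<^sub>L T = T o\<^sub>C\<^sub>L S"
    and fin: "\<And>d. d > 0 \<Longrightarrow> finite (spectrum S - ball 0 d)"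
  shows "decomposable (T + S)"
  unfolding decomposable_def
proof (intro allI impI)
  fix U V :: "complex set" assume UV: "open U \<and> open V \<and> U \<union> V = UNIV"
  obtain K where K: "K > 0" "\<And>x. norm (cblinfun_apply (T + S) x) \<le> K * norm x"
    using cblinfun_bound[of "T + S"] by metis
  \<comment> \<open>A Lebesgue number needs a compact set, so only \<open>cball 0 (K + 1)\<close> is
    treated that way. Beyond radius \<open>K\<close>, \<open>T + S\<close> has no spectrum on any
    closed invariant subspace, so both sets may be enlarged by that exterior.\<close>
  define U' where "U' = U \<union> - cball 0 K"
  define V' where "V' = V \<union> - cball 0 K"
  have "open U'" "open V'" using UV by (auto simp: U'_def V'_def)
  moreover have "cball 0 (K + 1) \<subseteq> \<Union>{U', V'}" using UV by (auto simp: U'_def V'_def)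
  ultimately obtain d where d: "d > 0" "\<And>z. z \<in> cball 0 (K + 1) \<Longrightarrow> \<exists>G\<in>{U', V'}. ball z d \<subseteq> G"
    using Heine_Borel_lemma[of "cball 0 (K + 1)" "{U', V'}"] by (metis compact_cball empty_iff insert_iff)
  \<comment> \<open>\<open>2 * e \<le> 1\<close> keeps a disc centred outside radius
    \<open>K + 1\<close> away from \<open>cball 0 K\<close>.\<close>
  define e where "e = min d 1 / 2"
  have e: "e > 0" "2 * e \<le> d" "2 * e \<le> 1" using d(1) by (auto simp: e_def)
  have cover: "ball z (2 * e) \<subseteq> U' \<or> ball z (2 * e) \<subseteq> V'" for z
  proof (cases "z \<in> cball 0 (K + 1)")
    case True
    then show ?thesis using d(2)[OF True] subset_ball[OF e(2), of z] by blast
  next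
    case False
    have "ball z (2 * e) \<subseteq> - cball 0 K"
    proof
      fix w assume "w \<in> ball z (2 * e)"
      then have "cmod (z - w) < 1" using e(3) by (simp add: dist_norm)
      moreover have "cmod z \<le> cmod w + cmod (z - w)" by (rule norm_triangle_sub)
      ultimately show "w \<in> - cball 0 K" using False by simp
    qed
    then show ?thesis by (auto simp: U'_def)
  qed
  have "hyper_decomposition T S U' V'"
    by (rule hyper_decomposition_finite_outer_spectrum[OF dec e(1) cover comm fin])
  then obtain Y Z where YZ: "complex_vector.subspace Y \<and> closed Y \<and> complex_vector.subspace Z \<and> closed Z \<and>
        (\<forall>B. B o\<^sub>C\<^sub>L T = T o\<^sub>C\<^sub>L B \<and> B o\<^sub>C\<^sub>L S = S o\<^sub>C\<^sub>L B \<longrightarrow> B ` Y \<subseteq> Y \<and> B ` Z \<subseteq> Z) \<and>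
        (\<forall>x. \<exists>y\<in>Y. \<exists>z\<in>Z. x = y + z) \<and>
        (\<forall>l. l \<notin> U' \<longrightarrow> regular_on Y (\<lambda>y. T y + S y - l *\<^sub>C y)) \<and>
        (\<forall>l. l \<notin> V' \<longrightarrow> regular_on Z (\<lambda>y. T y + S y - l *\<^sub>C y))"
    unfolding hyper_decomposition_def by (elim exE)
  have TS: "cblinfun_apply (T + S) x = T x + S x" for x by (simp add: plus_cblinfun.rep_eq)
  have "(T + S) o\<^sub>C\<^sub>L T = T o\<^sub>C\<^sub>L (T + S)" "(T + S) o\<^sub>C\<^sub>L S = S o\<^sub>C\<^sub>L (T + S)"
    using comm by (simp_all add: commute_iff TS cblinfun_add)
  then have inv: "(T + S) ` Y \<subseteq> Y" "(T + S) ` Z \<subseteq> Z" using YZ by blast+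
  have sp: "spectrum_on X (T + S) \<subseteq> W"
    if X: "complex_vector.subspace X" "closed X" "(T + S) ` X \<subseteq> X"
      and reg: "\<And>l. l \<notin> W \<union> - cball 0 K \<Longrightarrow> regular_on X (\<lambda>y. T y + S y - l *\<^sub>C y)" for X W
  proof
    fix l assume l: "l \<in> spectrum_on X (T + S)"
    show "l \<in> W"
    proof (rule ccontr)
      assume "l \<notin> W"
      have "regular_on X (\<lambda>y. (T + S) y - l *\<^sub>C y)"
      proof (cases "l \<in> cball 0 K")
        case True
        then show ?thesis using reg[of l] \<open>l \<notin> W\<close> by (simp add: TS)
      next
        case False
        then have lK: "K < cmod l" by simp
        show ?thesis
          by (rule regular_on_outside_bound[OF X(1,2) bop_cblinfun[OF X(3)] K(2)]) (use lK K(1) in simp_all)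
      qed
      then show False using l spectrum_on_regular[OF X(1,3)] by blast
    qed
  qed
  have "spectrum_on Y (T + S) \<subseteq> U" "spectrum_on Z (T + S) \<subseteq> V"
    by (rule sp; use YZ inv in \<open>simp add: U'_def V'_def\<close>)+
  then show "\<exists>Y Z. complex_vector.subspace Y \<and> closed Y \<and> (T + S) ` Y \<subseteq> Y \<and>
              complex_vector.subspace Z \<and> closed Z \<and> (T + S) ` Z \<subseteq> Z \<and>
              (\<forall>x. \<exists>y\<in>Y. \<exists>z\<in>Z. x = y + z) \<and>
              spectrum_on Y (T + S) \<subseteq> U \<and> spectrum_on Z (T + S) \<subseteq> V"
    using YZ inv by - (rule exI[of _ Y], rule exI[of _ Z], simp)
qed

section \<open>Spectra with finitely many points away from zero\<close>

text \<open>If \<open>R = (S - z)^-1\<close>, then \<open>S - w = (S - z) (1 - (w - z) R)\<close>,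
  and the second factor is invertible for \<open>|w - z| < 1 / K\<close>, where \<open>K\<close>
  bounds \<open>R\<close>.\<close>

lemma closed_spectrum:
  fixes S :: "'a::cbanach \<Rightarrow>\<^sub>C\<^sub>L 'a"
  shows "closed (spectrum S)"
  unfolding closed_def open_dist
proof (intro ballI)
  fix z assume "z \<in> - spectrum S"
  then have reg: "regular_on UNIV (\<lambda>y. S y - z *\<^sub>C y)" using spectrum_regular by blast
  obtain R where R: "bounded_operator_on UNIV R" "\<And>y. y \<in> UNIV \<Longrightarrow> S (R y) - z *\<^sub>C R y = y"
    by (rule regular_onE[OF reg]) metis
  obtain K where K: "K > 0" "\<And>y. y \<in> UNIV \<Longrightarrow> norm (R y) \<le> K * norm y"
    using bop_bound[OF R(1)] by metis
  have "w \<in> - spectrum S" if w: "dist w z < 1 / K" for w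
  proof -
    have "regular_on UNIV (\<lambda>y. y - (w - z) *\<^sub>C R y)"
    proof (rule regular_on_id_minus_contraction)
      show "bounded_operator_on UNIV (\<lambda>y. (w - z) *\<^sub>C R y)"
        by (rule bop_scale[OF complex_vector.subspace_UNIV R(1)])
      show "cmod (w - z) * K < 1" using w K(1) by (simp add: dist_norm field_simps)
      show "norm ((w - z) *\<^sub>C R y) \<le> cmod (w - z) * K * norm y" for y
        using mult_left_mono[OF K(2)[of y], of "cmod (w - z)"] by (simp add: norm_scaleC mult.assoc)
    qed (simp_all add: complex_vector.subspace_UNIV)
    from regular_on_comp[OF reg this] have "regular_on UNIV (\<lambda>y. S y - w *\<^sub>C y)"
    proof (rule regular_on_eq[OF _ _ complex_vector.subspace_UNIV])
      fix y
      have "S (y - (w - z) *\<^sub>C R y) - z *\<^sub>C (y - (w - z) *\<^sub>C R y)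
          = S y - z *\<^sub>C y - (w - z) *\<^sub>C (S (R y) - z *\<^sub>C R y)"
        by (simp add: cblinfun_diff cblinfun_apply_scaleC complex_vector.scale_right_diff_distrib
            scaleC_scaleC mult.commute)
      also have "\<dots> = S y - z *\<^sub>C y - (w - z) *\<^sub>C y" by (simp only: R(2)[OF UNIV_I])
      also have "\<dots> = S y - w *\<^sub>C y" by (simp add: complex_vector.scale_left_diff_distrib)
      finally show "S (y - (w - z) *\<^sub>C R y) - z *\<^sub>C (y - (w - z) *\<^sub>C R y) = S y - w *\<^sub>C y" .
    qed
    then show ?thesis using spectrum_regular by blast
  qed
  then show "\<exists>e>0. \<forall>y. dist y z < e \<longrightarrow> y \<in> - spectrum S"
    using K(1) by (intro exI[of _ "1 / K"]) simp
qed

lemma compact_spectrum: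
  fixes S :: "'a::cbanach \<Rightarrow>\<^sub>C\<^sub>L 'a"
  shows "compact (spectrum S)"
proof -
  obtain K where K: "K > 0" "\<And>x. norm (cblinfun_apply S x) \<le> K * norm x"
    using cblinfun_bound[of S] by metis
  have "cmod z \<le> K" if z: "z \<in> spectrum S" for z
  proof (rule ccontr)
    assume "\<not> cmod z \<le> K"
    then have "regular_on UNIV (\<lambda>y. S y - z *\<^sub>C y)"
      by (intro regular_on_outside_bound[OF complex_vector.subspace_UNIV closed_UNIV bop_UNIV K(2)])
        (use K(1) in simp_all)
    then show False using z spectrum_regular by blast
  qed
  then have "bounded (spectrum S)" by (auto simp: bounded_iff)
  then show ?thesis using closed_spectrum by (simp add: compact_eq_bounded_closed)
qed

lemma quasinilpotent_finite_outer_spectrum: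
  fixes S :: "'a::cbanach \<Rightarrow>\<^sub>C\<^sub>L 'a"
  assumes "quasinilpotent S" "d > 0"
  shows "finite (spectrum S - ball 0 d)"
proof (cases "\<exists>x::'a. x \<noteq> 0")
  case True
  then have "spectrum S - ball 0 d = {}" using assms by (auto simp: quasinilpotent_def)
  then show ?thesis by (simp only: finite.emptyI)
next
  case False
  then have trivial: "x = y" for x y :: 'a by metis
  have "regular_on UNIV (\<lambda>y. S y - z *\<^sub>C y)" for z
    by (rule regular_onI[OF bop_shift[OF complex_vector.subspace_UNIV bop_UNIV] bop_ident]) (rule trivial)+
  then have "spectrum S = {}" using spectrum_regular by blast
  then show ?thesis by simp
qed

section \<open>Riesz theory of compact operators\<close>

lemma almost_orthogonal_unit_vector:
  fixes M N :: "'a::complex_normed_vector set"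
  assumes M: "complex_vector.subspace M" "closed M" and N: "complex_vector.subspace N" and MN: "M \<subseteq> N"
    and y: "y \<in> N" "y \<notin> M"
  obtains x where "x \<in> N" "norm x = 1" "\<And>m. m \<in> M \<Longrightarrow> 1 / 2 \<le> norm (x - m)"
proof -
  have ne: "M \<noteq> {}" using complex_vector.subspace_0[OF M(1)] by blast
  define D where "D = infdist y M"
  have D: "D > 0" using infdist_pos_not_in_closed[OF M(2) ne y(2)] by (simp add: D_def)
  \<comment> \<open>A nearest point need not exist; a point within twice the distance accounts for
    the constant \<open>1 / 2\<close>.\<close>
  have "(INF m\<in>M. dist y m) < 2 * D" using D ne by (simp add: D_def infdist_def)
  then obtain m0 where m0: "m0 \<in> M" "dist y m0 < 2 * D"
    using ne by (subst (asm) cINF_less_iff) auto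
  define n where "n = norm (y - m0)"
  have n: "n > 0" "n < 2 * D" using m0 y(2) by (auto simp: n_def dist_norm)
  define x where "x = (1 / n) *\<^sub>R (y - m0)"
  have "x \<in> N" unfolding x_def using y(1) m0(1) MN
    by (intro subspace_scaleR[OF N] complex_vector.subspace_diff[OF N]) auto
  moreover have "norm x = 1" using n(1) by (simp add: x_def n_def[symmetric])
  moreover have "1 / 2 \<le> norm (x - m)" if m: "m \<in> M" for m
  proof -
    have "m0 + n *\<^sub>R m \<in> M" by (intro complex_vector.subspace_add subspace_scaleR M m0 m)
    then have "D \<le> norm (y - (m0 + n *\<^sub>R m))"
      unfolding D_def dist_norm[symmetric] by (rule infdist_le)
    moreover have "x - m = (1 / n) *\<^sub>R (y - (m0 + n *\<^sub>R m))"
      using n(1) by (simp add: x_def algebra_simps)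
    then have "norm (x - m) = norm (y - (m0 + n *\<^sub>R m)) / n" using n(1) by simp
    ultimately have "n * (1 / 2) < n * norm (x - m)" using n by simp
    then show ?thesis using n(1) by simp
  qed
  ultimately show ?thesis using that by blast
qed

lemma compact_operator_subsequence:
  fixes S :: "'a::cbanach \<Rightarrow>\<^sub>C\<^sub>L 'a"
  assumes S: "compact_operator S" and x: "\<And>n::nat. norm (x n) = 1"
  obtains l r where "strict_mono (r :: nat \<Rightarrow> nat)" "(\<lambda>n. S (x (r n))) \<longlonglongrightarrow> l"
proof -
  have "\<forall>n. S (x n) \<in> closure (S ` cball 0 1)"
    using x by (intro allI subsetD[OF closure_subset] imageI) simp
  moreover have "seq_compact (closure (S ` cball 0 1))"
    using S by (simp add: compact_operator_def compact_imp_seq_compact)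
  ultimately obtain l r where "strict_mono r" "((\<lambda>n. S (x n)) \<circ> r) \<longlonglongrightarrow> l"
    using seq_compactE by metis
  then show ?thesis using that by (simp add: o_def)
qed

lemma compact_operator_no_separated:
  fixes S :: "'a::cbanach \<Rightarrow>\<^sub>C\<^sub>L 'a"
  assumes S: "compact_operator S" and x: "\<And>n::nat. norm (x n) = 1" and e: "e > 0"
    and sep: "\<And>m n. m < n \<Longrightarrow> e \<le> norm (S (x m) - S (x n))"
  shows False
proof -
  obtain l r where r: "strict_mono (r :: nat \<Rightarrow> nat)" "(\<lambda>n. S (x (r n))) \<longlonglongrightarrow> l"
    by (rule compact_operator_subsequence[of S x, OF S x])
  obtain N where N: "\<And>m n. m \<ge> N \<Longrightarrow> n \<ge> N \<Longrightarrow> dist (S (x (r m))) (S (x (r n))) < e"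
    using metric_CauchyD[OF LIMSEQ_imp_Cauchy[OF r(2)] e] by metis
  have "r N < r (Suc N)" using r(1) by (simp add: strict_mono_def)
  from sep[OF this] N[of N "Suc N"] show False by (simp add: dist_norm)
qed

text \<open>Otherwise there are unit vectors \<open>x n\<close> with \<open>S (x n) - l x n\<close>
  tending to 0. Along a subsequence \<open>S (x n)\<close> converges, hence so does
  \<open>x n\<close> as \<open>l\<close> is nonzero, and the limit is an eigenvector of norm
  1.\<close>

lemma compact_operator_bounded_below:
  fixes S :: "'a::cbanach \<Rightarrow>\<^sub>C\<^sub>L 'a"
  assumes S: "compact_operator S" and l: "l \<noteq> 0" and inj: "\<And>x. S x = l *\<^sub>C x \<Longrightarrow> x = 0"
  obtains c where "c > 0" "\<And>x. c * norm x \<le> norm (S x - l *\<^sub>C x)"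
proof (rule ccontr)
  assume contra: "\<not> thesis"
  have "\<exists>x. norm (S x - l *\<^sub>C x) < 1 / real (Suc n) * norm x" for n
  proof (rule ccontr)
    assume "\<not> ?thesis"
    then have "1 / real (Suc n) * norm x \<le> norm (S x - l *\<^sub>C x)" for x by (simp add: not_less)
    then show False using that[of "1 / real (Suc n)"] contra by simp
  qed
  then obtain y where y: "\<And>n. norm (S (y n) - l *\<^sub>C y n) < 1 / real (Suc n) * norm (y n)" by metis
  define x where "x n = (1 / norm (y n)) *\<^sub>R y n" for n
  have y0: "norm (y n) > 0" for n
    using order_le_less_trans[OF norm_ge_zero y[of n]] by (auto simp: zero_less_mult_iff)
  have x1: "norm (x n) = 1" for n using y0[of n] by (simp add: x_def)
  have small: "norm (S (x n) - l *\<^sub>C x n) \<le> inverse (real (Suc n))" for n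
  proof -
    let ?c = "complex_of_real (1 / norm (y n))"
    have "S (x n) - l *\<^sub>C x n = ?c *\<^sub>C (S (y n) - l *\<^sub>C y n)"
      unfolding x_def scaleC_of_real[symmetric]
      by (simp only: cblinfun_apply_scaleC complex_vector.scale_right_diff_distrib scaleC_scaleC mult.commute)
    then have "norm (S (x n) - l *\<^sub>C x n) = norm (S (y n) - l *\<^sub>C y n) / norm (y n)"
      by (simp add: norm_scaleC norm_divide)
    also have "\<dots> \<le> inverse (real (Suc n))"
      using y[of n] y0[of n] by (subst pos_divide_le_eq) (simp_all add: inverse_eq_divide)
    finally show ?thesis .
  qed
  obtain v r where r: "strict_mono (r :: nat \<Rightarrow> nat)" "(\<lambda>n. S (x (r n))) \<longlonglongrightarrow> v"
    by (rule compact_operator_subsequence[of S x, OF S x1])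
  have "(\<lambda>n. S (x n) - l *\<^sub>C x n) \<longlonglongrightarrow> 0"
    by (rule Lim_null_comparison[OF _ LIMSEQ_inverse_real_of_nat]) (use small in simp)
  from LIMSEQ_subseq_LIMSEQ[OF this r(1)]
  have "(\<lambda>n. S (x (r n)) - l *\<^sub>C x (r n)) \<longlonglongrightarrow> 0" by (simp add: o_def)
  from tendsto_diff[OF r(2) this] have lx: "(\<lambda>n. l *\<^sub>C x (r n)) \<longlonglongrightarrow> v" by simp
  have xl: "(\<lambda>n. x (r n)) \<longlonglongrightarrow> (1 / l) *\<^sub>C v"
    using bounded_linear.tendsto[OF bounded_linear_scaleC lx, of "1 / l"] l by (simp add: scaleC_scaleC)
  have "(\<lambda>n. S (x (r n))) \<longlonglongrightarrow> S ((1 / l) *\<^sub>C v)"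
    by (rule bounded_linear.tendsto[OF bounded_linear_cblinfun_apply xl])
  with r(2) have "S ((1 / l) *\<^sub>C v) = v" by (rule LIMSEQ_unique[symmetric])
  then have "(1 / l) *\<^sub>C v = 0" using l by (intro inj) (simp add: scaleC_scaleC)
  moreover have "norm ((1 / l) *\<^sub>C v) = 1"
    using tendsto_norm[OF xl] x1 by (simp add: LIMSEQ_const_iff)
  ultimately show False by (metis norm_zero zero_neq_one)
qed

text \<open>If \<open>y\<close> is missed, the closed ranges \<open>X n\<close> of
  \<open>(S - l)^n\<close> decrease strictly: \<open>(S - l)^n y\<close> lies in \<open>X n\<close>
  but, by injectivity, not in \<open>X (Suc n)\<close>. Almost orthogonal unit vectors taken along
  this chain have images under \<open>S\<close> that stay apart, against compactness.\<close>

lemma compact_operator_surj: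
  fixes S :: "'a::cbanach \<Rightarrow>\<^sub>C\<^sub>L 'a"
  assumes S: "compact_operator S" and l: "l \<noteq> 0" and c: "c > 0" "\<And>x. c * norm x \<le> norm (S x - l *\<^sub>C x)"
  shows "\<exists>x. S x - l *\<^sub>C x = y"
proof (rule ccontr)
  assume y: "\<nexists>x. S x - l *\<^sub>C x = y"
  define N where "N = (\<lambda>x. S x - l *\<^sub>C x)"
  have N: "bounded_operator_on UNIV N"
    unfolding N_def by (rule bop_shift[OF complex_vector.subspace_UNIV bop_UNIV])
  have Nc: "c ^ n * norm x \<le> norm ((N ^^ n) x)" for n x
  proof (induction n)
    case (Suc n)
    have "c * (c ^ n * norm x) \<le> c * norm ((N ^^ n) x)" using Suc c(1) by simp
    also have "\<dots> \<le> norm ((N ^^ Suc n) x)" using c(2)[of "(N ^^ n) x"] by (simp add: N_def)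
    finally show ?case by simp
  qed simp
  have inj: "u = v" if "(N ^^ n) u = (N ^^ n) v" for n u v
  proof -
    have "(N ^^ n) (u - v) = 0"
      using that bop_diff[OF complex_vector.subspace_UNIV bop_funpow[OF N] UNIV_I UNIV_I] by simp
    then have "c ^ n * norm (u - v) \<le> 0" using Nc[of n "u - v"] by simp
    moreover have "c ^ n > 0" using c(1) by simp
    ultimately show ?thesis by (simp add: mult_le_0_iff)
  qed
  define X where "X n = range (N ^^ n)" for n
  have X: "complex_vector.subspace (X n)" "closed (X n)" for n
  proof -
    obtain F where F: "N ^^ n = cblinfun_apply F"
      using bop_funpow[OF N] bounded_operator_on_UNIV by blast
    show "complex_vector.subspace (X n)"
    proof (rule complex_vector.subspaceI)
      show "0 \<in> X n" unfolding X_def F by (rule range_eqI[of _ _ 0]) (simp add: cblinfun_zero)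
      show "a + b \<in> X n" if "a \<in> X n" "b \<in> X n" for a b
        using that unfolding X_def F by (auto simp flip: cblinfun_add)
      show "k *\<^sub>C a \<in> X n" if "a \<in> X n" for k a
        using that unfolding X_def F by (auto simp flip: cblinfun_apply_scaleC)
    qed
    have "complete (X n)"
      unfolding X_def F
    proof (rule complete_isometric_image[of "c ^ n"])
      show "bounded_linear (cblinfun_apply F)" by (rule bounded_linear_cblinfun_apply)
      show "\<forall>x\<in>UNIV. c ^ n * norm x \<le> norm (F x)" using Nc[where n = n] by (simp add: F)
    qed (use c(1) complete_UNIV in auto)
    then show "closed (X n)" by (rule complete_imp_closed)
  qed
  have X_Suc: "X (Suc n) \<subseteq> X n" for n
    unfolding X_def by (auto simp: funpow_swap1[of N])
  have X_mono: "X n \<subseteq> X m" if "m \<le> n" for m n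
    using that X_Suc by (rule lift_Suc_antimono_le[of X, rotated])
  have "\<exists>x. x \<in> X n \<and> norm x = 1 \<and> (\<forall>m\<in>X (Suc n). 1 / 2 \<le> norm (x - m))" for n
  proof -
    have "(N ^^ n) y \<notin> X (Suc n)"
    proof
      assume "(N ^^ n) y \<in> X (Suc n)"
      then obtain u where "(N ^^ n) y = (N ^^ Suc n) u" by (auto simp: X_def)
      then have "(N ^^ n) y = (N ^^ n) (N u)" by (simp add: funpow_swap1)
      from inj[OF this] y show False by (auto simp: N_def)
    qed
    then show ?thesis
      using almost_orthogonal_unit_vector[OF X X(1) X_Suc[of n], of "(N ^^ n) y"]
      by (metis X_def rangeI)
  qed
  then obtain x where x: "\<And>n. x n \<in> X n" "\<And>n. norm (x n) = 1"
    "\<And>n m. m \<in> X (Suc n) \<Longrightarrow> 1 / 2 \<le> norm (x n - m)"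
    by metis
  have sep: "cmod l / 2 \<le> norm (S (x m) - S (x n))" if "m < n" for m n
  proof -
    have NS: "(N ^^ k) (S v) = S ((N ^^ k) v)" for k v
      by (rule funpow_commute[of UNIV, symmetric]) (auto simp: N_def cblinfun_diff cblinfun_apply_scaleC)
    have "N (x m) \<in> X (Suc m)"
      using x(1)[of m] by (auto simp: X_def)
    moreover have "S (x n) \<in> X n"
      using x(1)[of n] by (auto simp: X_def simp flip: NS)
    then have "S (x n) \<in> X (Suc m)" using X_mono[of "Suc m" n] that by auto
    ultimately have w: "(1 / l) *\<^sub>C (S (x n) - N (x m)) \<in> X (Suc m)"
      by (intro complex_vector.subspace_scale complex_vector.subspace_diff X)
    \<comment> \<open>Since \<open>S = l + N\<close>, the difference is \<open>l\<close> times the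
      difference of \<open>x m\<close> and an element of \<open>X (Suc m)\<close>, from which
      \<open>x m\<close> keeps distance \<open>1 / 2\<close>.\<close>
    have "S (x m) - S (x n) = l *\<^sub>C (x m - (1 / l) *\<^sub>C (S (x n) - N (x m)))"
      using l by (simp add: N_def complex_vector.scale_right_diff_distrib scaleC_scaleC)
    then have "norm (S (x m) - S (x n)) = cmod l * norm (x m - (1 / l) *\<^sub>C (S (x n) - N (x m)))"
      by (simp only: norm_scaleC)
    also have "\<dots> \<ge> cmod l * (1 / 2)" by (intro mult_left_mono x(3)[OF w]) simp
    finally show ?thesis by simp
  qed
  show False
    by (rule compact_operator_no_separated[OF S x(2) _ sep]) (use l in simp)
qed

lemma compact_operator_eigenvector:
  fixes S :: "'a::cbanach \<Rightarrow>\<^sub>C\<^sub>L 'a"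
  assumes S: "compact_operator S" and l: "l \<in> spectrum S" "l \<noteq> 0"
  shows "\<exists>x. x \<noteq> 0 \<and> S x = l *\<^sub>C x"
proof (rule ccontr)
  assume none: "\<not> ?thesis"
  obtain c where c: "c > 0" "\<And>x. c * norm x \<le> norm (S x - l *\<^sub>C x)"
    by (rule compact_operator_bounded_below[OF S l(2)]) (use none in blast)+
  have "regular_on UNIV (\<lambda>x. S x - l *\<^sub>C x)"
    by (rule regular_onI_bounded_below[OF complex_vector.subspace_UNIV _ c(1)])
      (use c compact_operator_surj[OF S l(2) c] in \<open>simp_all add: bop_shift complex_vector.subspace_UNIV bop_UNIV\<close>)
  then show False using l(1) spectrum_regular by blast
qed

text \<open>The product of the \<open>S - l i\<close> over \<open>i < n\<close>. Its kernel stands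
  in for the span of the first \<open>n\<close> eigenvectors and is closed and
  \<open>S\<close>-invariant by construction.\<close>

primrec annihilating_product :: "('a::cbanach \<Rightarrow>\<^sub>C\<^sub>L 'a) \<Rightarrow> (nat \<Rightarrow> complex) \<Rightarrow> nat \<Rightarrow> 'a \<Rightarrow> 'a" where
  "annihilating_product S l 0 x = x"
| "annihilating_product S l (Suc n) x = annihilating_product S l n (S x - l n *\<^sub>C x)"

text \<open>Mirror image of the surjectivity argument: infinitely many eigenvalues of modulus at
  least \<open>d\<close> give strictly increasing closed kernels \<open>M n\<close>, and
  \<open>S - l n\<close> maps \<open>M (Suc n)\<close> into \<open>M n\<close>. Almost orthogonal
  unit vectors again have images that stay apart, now by \<open>d / 2\<close>.\<close>

lemma compact_operator_finite_outer_spectrum: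
  fixes S :: "'a::cbanach \<Rightarrow>\<^sub>C\<^sub>L 'a"
  assumes S: "compact_operator S" and d: "d > 0"
  shows "finite (spectrum S - ball 0 d)"
proof (rule ccontr)
  assume "infinite (spectrum S - ball 0 d)"
  then obtain l :: "nat \<Rightarrow> complex" where l: "inj l" "range l \<subseteq> spectrum S - ball 0 d"
    using infinite_countable_subset by blast
  then have "l n \<in> spectrum S - ball 0 d" for n by blast
  then have ln: "l n \<in> spectrum S" "d \<le> cmod (l n)" for n by (simp_all add: not_less)
  then have l0: "l n \<noteq> 0" for n using d by (metis norm_zero not_less)
  have "\<exists>x. x \<noteq> 0 \<and> S x = l n *\<^sub>C x" for n
    by (rule compact_operator_eigenvector[OF S ln(1) l0])
  then obtain v where v: "\<And>n. v n \<noteq> 0" "\<And>n. S (v n) = l n *\<^sub>C v n" by metis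
  define p where "p = annihilating_product S l"
  have p0: "p 0 x = x" and p_Suc: "p (Suc n) x = p n (S x - l n *\<^sub>C x)" for n x
    by (simp_all add: p_def)
  have p_bop: "bounded_operator_on UNIV (p n)" for n
  proof (induction n)
    case 0
    have "p 0 = (\<lambda>x. x)" by (rule ext) (rule p0)
    then show ?case by (simp add: bop_ident)
  next
    case (Suc n)
    have "p (Suc n) = (\<lambda>x. p n (S x - l n *\<^sub>C x))" by (rule ext) (rule p_Suc)
    then show ?case
      using bop_comp[OF Suc bop_shift[OF complex_vector.subspace_UNIV bop_UNIV]] by simp
  qed
  have p_diff: "p n (x - y) = p n x - p n y" for n x y
    by (rule bop_diff[OF complex_vector.subspace_UNIV p_bop UNIV_I UNIV_I])
  have p_scale: "p n (c *\<^sub>C x) = c *\<^sub>C p n x" for n c x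
    by (rule bop_scaleC[OF p_bop UNIV_I])
  have p_zero: "p n 0 = 0" for n by (rule bop_zero[OF complex_vector.subspace_UNIV p_bop])
  have pS: "p n (S x) = S (p n x)" for n x
    by (induction n arbitrary: x) (simp_all add: p0 p_Suc p_diff p_scale cblinfun_diff cblinfun_apply_scaleC)
  define M where "M n = {x\<in>UNIV. p n x = 0}" for n
  have M: "complex_vector.subspace (M n)" "closed (M n)" for n
    unfolding M_def by (rule closed_kernel_on[OF complex_vector.subspace_UNIV closed_UNIV p_bop])+
  have M_Suc: "M n \<subseteq> M (Suc n)" for n
    by (auto simp: M_def p_Suc p_diff p_scale pS cblinfun_zero)
  have M_mono: "M m \<subseteq> M n" if "m \<le> n" for m n
    using M_Suc that by (rule lift_Suc_mono_le)
  \<comment> \<open>The factor with index \<open>i\<close> multiplies the eigenvector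
    \<open>v n\<close> by \<open>l n - l i\<close>, which is nonzero for
    \<open>i < n\<close>.\<close>
  have pv: "p k (v n) \<noteq> 0" if "k \<le> n" for k n
    using that
  proof (induction k)
    case 0
    then show ?case by (simp add: p0 v)
  next
    case (Suc k)
    have "p (Suc k) (v n) = (l n - l k) *\<^sub>C p k (v n)"
      by (simp add: p_Suc v p_diff p_scale complex_vector.scale_left_diff_distrib)
    moreover have "l n \<noteq> l k" using l(1) Suc.prems by (auto dest: injD)
    ultimately show ?case using Suc by (simp add: complex_vector.scale_eq_0_iff)
  qed
  have "\<exists>x. x \<in> M (Suc n) \<and> norm x = 1 \<and> (\<forall>m\<in>M n. 1 / 2 \<le> norm (x - m))" for n
  proof -
    have "v n \<in> M (Suc n)" by (simp add: M_def p_Suc v p_zero)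
    moreover have "v n \<notin> M n" using pv[of n n] by (simp add: M_def)
    ultimately show ?thesis
      using almost_orthogonal_unit_vector[OF M M(1) M_Suc[of n]] by metis
  qed
  then obtain x where x: "\<And>n. x n \<in> M (Suc n)" "\<And>n. norm (x n) = 1"
    "\<And>n m. m \<in> M n \<Longrightarrow> 1 / 2 \<le> norm (x n - m)"
    by metis
  have sep: "d / 2 \<le> norm (S (x m) - S (x n))" if "m < n" for m n
  proof -
    let ?N = "S (x n) - l n *\<^sub>C x n"
    have 1: "?N \<in> M n" using x(1)[of n] by (simp add: M_def p_Suc)
    have "S (x m) \<in> M (Suc m)" using x(1)[of m] by (simp add: M_def pS cblinfun_zero)
    then have 2: "S (x m) \<in> M n" using M_mono[of "Suc m" n] that by auto
    have w: "(1 / l n) *\<^sub>C (S (x m) - ?N) \<in> M n"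
      by (rule complex_vector.subspace_scale[OF M(1) complex_vector.subspace_diff[OF M(1) 2 1]])
    have "S (x n) - S (x m) = l n *\<^sub>C (x n - (1 / l n) *\<^sub>C (S (x m) - ?N))"
      using l0 by (simp add: complex_vector.scale_right_diff_distrib scaleC_scaleC)
    then have "norm (S (x n) - S (x m)) = cmod (l n) * norm (x n - (1 / l n) *\<^sub>C (S (x m) - ?N))"
      by (simp only: norm_scaleC)
    also have "\<dots> \<ge> d * (1 / 2)" using d ln(2)[of n] by (intro mult_mono x(3)[OF w]) auto
    finally show ?thesis by (simp add: norm_minus_commute)
  qed
  show False
    by (rule compact_operator_no_separated[OF S x(2) _ sep]) (use d in simp)
qed

section \<open>Decomposability implies property $(\delta)$\<close>

lemma norm_cblinfun_le:
  fixes \<phi> :: "'a::complex_normed_vector \<Rightarrow>\<^sub>C\<^sub>L 'b::complex_normed_vector"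
  assumes "0 \<le> b" "\<And>x. norm (\<phi> x) \<le> b * norm x"
  shows "norm \<phi> \<le> b"
  using assms by transfer (rule onorm_bound)

lemma norm_cblinfun_apply_le:
  fixes \<phi> :: "'a::complex_normed_vector \<Rightarrow>\<^sub>C\<^sub>L 'b::complex_normed_vector"
  shows "norm (\<phi> x) \<le> norm \<phi> * norm x"
  by transfer (simp add: onorm)

lemma bounded_linear_eval:
  fixes y :: "'a::complex_normed_vector"
  shows "bounded_linear (\<lambda>\<phi> :: 'a \<Rightarrow>\<^sub>C\<^sub>L 'b::complex_normed_vector. cblinfun_apply \<phi> y)"
  by (rule bounded_linear_intro[where K = "norm y"])
    (simp_all add: plus_cblinfun.rep_eq scaleR_cblinfun.rep_eq norm_cblinfun_apply_le)

lemma holomorphic_on_eval: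
  fixes f :: "complex \<Rightarrow> 'a::complex_normed_vector cdual"
  assumes "vector_analytic_on f U"
  shows "(\<lambda>z. cblinfun_apply (f z) y) holomorphic_on U"
  unfolding holomorphic_on_def
proof
  fix z assume "z \<in> U"
  then obtain D where "(f has_derivative (\<lambda>h. h *\<^sub>C D)) (at z)"
    using assms by (auto simp: vector_analytic_on_def)
  from bounded_linear.has_derivative[OF bounded_linear_eval this]
  have "((\<lambda>z. cblinfun_apply (f z) y) has_derivative (\<lambda>h. cblinfun_apply (h *\<^sub>C D) y)) (at z)" .
  then have "((\<lambda>z. cblinfun_apply (f z) y) has_field_derivative D y) (at z)"
    by (simp add: has_field_derivative_def scaleC_cblinfun.rep_eq scaleC_complex_def mult.commute[of _ "D y"])
  then show "(\<lambda>z. cblinfun_apply (f z) y) field_differentiable at z within U"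
    using field_differentiable_at_within field_differentiable_def by blast
qed

text \<open>On a summand whose spectrum misses the disc, the estimate is pointwise in the disc; on a
  summand whose spectrum lies inside the disc it holds on the circle and propagates inwards by the
  maximum principle.\<close>

lemma dual_bounded_below_on_disc:
  fixes T :: "'a::cbanach \<Rightarrow>\<^sub>C\<^sub>L 'a"
  assumes dec: "decomposable T" and R: "R > 0"
  shows "\<exists>K>0. \<forall>f e. (\<forall>y. (\<lambda>z. cblinfun_apply (f z) y) holomorphic_on cball a R) \<longrightarrow>
    (\<forall>z\<in>cball a R. norm (dual_operator T (f z) - z *\<^sub>C f z) \<le> e) \<longrightarrow>
    (\<forall>z\<in>cball a (R / 2). norm (f z) \<le> K * e)"
proof -
  have "open (ball a R)" "open (- cball a (R / 2))" "ball a R \<union> - cball a (R / 2) = UNIV"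
    using R by auto
  then obtain Y Z where Y: "complex_vector.subspace Y" "closed Y" "T ` Y \<subseteq> Y"
    and Z: "complex_vector.subspace Z" "closed Z" "T ` Z \<subseteq> Z"
    and sum: "\<forall>x. \<exists>y\<in>Y. \<exists>z\<in>Z. x = y + z"
    and sp: "spectrum_on Y T \<subseteq> ball a R" "spectrum_on Z T \<subseteq> - cball a (R / 2)"
    using dec[unfolded decomposable_def, rule_format, of "ball a R" "- cball a (R / 2)"] by blast
  have regY: "regular_on Y (\<lambda>y. T y - w *\<^sub>C y)" if "w \<in> sphere a R" for w
  proof -
    have "w \<notin> spectrum_on Y T" using sp(1) that by auto
    then show ?thesis using spectrum_on_regular[OF Y(1,3)] by blast
  qed
  have regZ: "regular_on Z (\<lambda>y. T y - w *\<^sub>C y)" if "w \<in> cball a (R / 2)" for w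
  proof -
    have "w \<notin> spectrum_on Z T" using sp(2) that by auto
    then show ?thesis using spectrum_on_regular[OF Z(1,3)] by blast
  qed
  obtain cY where cY: "cY > 0" "\<And>w y. w \<in> sphere a R \<Longrightarrow> y \<in> Y \<Longrightarrow> cY * norm y \<le> norm (T y - w *\<^sub>C y)"
    using regular_on_uniformly_bounded_below[OF Y(1) bop_cblinfun[OF Y(3)] bop_ident compact_sphere regY] by metis
  obtain cZ where cZ: "cZ > 0" "\<And>w y. w \<in> cball a (R / 2) \<Longrightarrow> y \<in> Z \<Longrightarrow> cZ * norm y \<le> norm (T y - w *\<^sub>C y)"
    using regular_on_uniformly_bounded_below[OF Z(1) bop_cblinfun[OF Z(3)] bop_ident compact_cball regZ] by metis
  obtain C where C: "C > 0"
    "\<And>x. \<exists>y\<in>Y. \<exists>z\<in>Z. x = y + z \<and> norm y \<le> C * norm x \<and> norm z \<le> C * norm x"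
    using bounded_decomposition[OF Y(1,2) Z(1,2)] sum by metis
  \<comment> \<open>One constant for all \<open>f\<close> and \<open>e\<close>; this uniformity is
    what the passage to sequences of functions requires.\<close>
  define K where "K = C / cY + C / cZ"
  show ?thesis
  proof (intro exI[of _ K] conjI allI impI ballI)
    show "K > 0" using C(1) cY(1) cZ(1) by (simp add: K_def add_pos_pos)
    fix f e z
    assume hol': "\<forall>y. (\<lambda>z. cblinfun_apply (f z) y) holomorphic_on cball a R"
      and small': "\<forall>z\<in>cball a R. norm (dual_operator T (f z) - z *\<^sub>C f z) \<le> e"
      and z: "z \<in> cball a (R / 2)"
    note hol = hol'[rule_format] and small = small'[rule_format]
    have e: "0 \<le> e" using order_trans[OF norm_ge_zero small[of a]] R by simp
    \<comment> \<open>Moving the dual operator across the pairing controls \<open>f w\<close> on the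
      values of \<open>T - w\<close>; invertibility of \<open>T - w\<close> on a summand then
      controls \<open>f w\<close> on that whole summand.\<close>
    have apply_le: "cmod (f w (T v - w *\<^sub>C v)) \<le> e * norm v" if "w \<in> cball a R" for w v
    proof -
      have "f w (T v - w *\<^sub>C v) = (dual_operator T (f w) - w *\<^sub>C f w) v"
        by (simp add: dual_operator.rep_eq minus_cblinfun.rep_eq scaleC_cblinfun.rep_eq
            cblinfun_compose.rep_eq cblinfun_diff cblinfun_apply_scaleC)
      also have "cmod \<dots> \<le> norm (dual_operator T (f w) - w *\<^sub>C f w) * norm v"
        by (rule norm_cblinfun_apply_le)
      also have "\<dots> \<le> e * norm v" using small[OF that] by (rule mult_right_mono) simp
      finally show ?thesis .
    qed
    have circle: "cmod (f w y) \<le> e / cY * norm y" if w: "w \<in> sphere a R" and y: "y \<in> Y" for w y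
    proof -
      obtain v where v: "v \<in> Y" "T v - w *\<^sub>C v = y" by (rule regular_on_surj[OF regY[OF w] y])
      have "cmod (f w y) \<le> e * norm v" using apply_le[of w v] w v by simp
      also have "\<dots> \<le> e * (norm y / cY)"
        using cY(2)[OF w v(1)] cY(1) v(2) e by (intro mult_left_mono) (simp_all add: field_simps)
      finally show ?thesis by simp
    qed
    have onY: "cmod (f z y) \<le> e / cY * norm y" if y: "y \<in> Y" for y
    proof (rule maximum_modulus_frontier[of "\<lambda>z. f z y" "cball a R"])
      show "(\<lambda>z. f z y) holomorphic_on interior (cball a R)"
        by (rule holomorphic_on_subset[OF hol interior_subset])
      show "continuous_on (closure (cball a R)) (\<lambda>z. f z y)"
        using holomorphic_on_imp_continuous_on[OF hol[of y]] by simp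
      show "cmod (f w y) \<le> e / cY * norm y" if "w \<in> frontier (cball a R)" for w
        using that circle[OF _ y] R by (simp add: frontier_cball)
    qed (use z R in auto)
    have onZ: "cmod (f z v) \<le> e / cZ * norm v" if v: "v \<in> Z" for v
    proof -
      obtain u where u: "u \<in> Z" "T u - z *\<^sub>C u = v" by (rule regular_on_surj[OF regZ[OF z] v])
      have "cmod (f z v) \<le> e * norm u" using apply_le[of z u] z u R by simp
      also have "\<dots> \<le> e * (norm v / cZ)"
        using cZ(2)[OF z u(1)] cZ(1) u(2) e by (intro mult_left_mono) (simp_all add: field_simps)
      finally show ?thesis by simp
    qed
    show "norm (f z) \<le> K * e"
    proof (rule norm_cblinfun_le)
      show "0 \<le> K * e" using C(1) cY(1) cZ(1) e by (simp add: K_def)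
      fix x
      obtain y v where yv: "y \<in> Y" "v \<in> Z" "x = y + v" "norm y \<le> C * norm x" "norm v \<le> C * norm x"
        using C(2)[of x] by blast
      have "cmod (f z x) \<le> cmod (f z y) + cmod (f z v)"
        unfolding yv(3) cblinfun_add by (rule norm_triangle_ineq)
      also have "\<dots> \<le> e / cY * (C * norm x) + e / cZ * (C * norm x)"
        using yv e cY(1) cZ(1)
        by (intro add_mono order_trans[OF onY] order_trans[OF onZ] mult_left_mono) simp_all
      also have "\<dots> = K * e * norm x" by (simp add: K_def algebra_simps)
      finally show "cmod (f z x) \<le> K * e * norm x" .
    qed
  qed
qed

text \<open>The disc estimate has one constant for all \<open>f n\<close>, so uniform smallness of
  the images on a disc passes to \<open>f n\<close> on the concentric disc of half the radius;
  finitely many such discs cover a compact set.\<close>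

lemma decomposable_imp_property_delta:
  fixes T :: "'a::cbanach \<Rightarrow>\<^sub>C\<^sub>L 'a"
  assumes dec: "decomposable T"
  shows "property_delta T"
  unfolding property_delta_def property_beta_def
proof (intro allI impI, elim conjE)
  fix U :: "complex set" and f :: "nat \<Rightarrow> complex \<Rightarrow> 'a cdual" and K
  assume U: "open U" and an: "\<forall>n. vector_analytic_on (f n) U"
    and lim: "\<forall>K. compact K \<and> K \<subseteq> U \<longrightarrow>
      uniform_limit K (\<lambda>n z. dual_operator T (f n z) - z *\<^sub>C f n z) (\<lambda>_. 0) sequentially"
    and K: "compact K" "K \<subseteq> U"
  show "uniform_limit K f (\<lambda>_. 0) sequentially"
    unfolding uniform_limit_iff
  proof (intro allI impI)
    fix \<epsilon> :: real assume eps: "\<epsilon> > 0"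
    have local: "\<exists>r>0. \<forall>\<^sub>F n in sequentially. \<forall>z\<in>ball a r. dist (f n z) 0 < \<epsilon>" if "a \<in> U" for a
    proof -
      from U that obtain R where R: "R > 0" "cball a R \<subseteq> U" unfolding open_contains_cball by auto
      from dual_bounded_below_on_disc[OF dec R(1), of a]
      obtain M where M: "M > 0" "\<forall>f e. (\<forall>y. (\<lambda>z. cblinfun_apply (f z) y) holomorphic_on cball a R) \<longrightarrow>
          (\<forall>z\<in>cball a R. norm (dual_operator T (f z) - z *\<^sub>C f z) \<le> e) \<longrightarrow>
          (\<forall>z\<in>cball a (R / 2). norm (f z) \<le> M * e)"
        by (elim exE conjE)
      \<comment> \<open>The factor 2 turns the weak bound \<open>M * e\<close> into a strict
        one.\<close>
      define e where "e = \<epsilon> / (2 * M)"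
      have e: "e > 0" "M * e < \<epsilon>" using eps M(1) by (simp_all add: e_def)
      have "uniform_limit (cball a R) (\<lambda>n z. dual_operator T (f n z) - z *\<^sub>C f n z) (\<lambda>_. 0) sequentially"
        using lim R(2) by simp
      then have "\<forall>\<^sub>F n in sequentially. \<forall>z\<in>cball a R. dist (dual_operator T (f n z) - z *\<^sub>C f n z) 0 < e"
        using e(1) by (simp only: uniform_limit_iff)
      then have "\<forall>\<^sub>F n in sequentially. \<forall>z\<in>ball a (R / 2). dist (f n z) 0 < \<epsilon>"
      proof (rule eventually_mono, intro ballI)
        fix n z
        assume small: "\<forall>z\<in>cball a R. dist (dual_operator T (f n z) - z *\<^sub>C f n z) 0 < e" and z: "z \<in> ball a (R / 2)"
        have "norm (f n z) \<le> M * e"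
        proof (rule M(2)[rule_format])
          show "(\<lambda>z. cblinfun_apply (f n z) y) holomorphic_on cball a R" for y
            using an R(2) by (intro holomorphic_on_subset[OF holomorphic_on_eval]) auto
          show "norm (dual_operator T (f n z) - z *\<^sub>C f n z) \<le> e" if "z \<in> cball a R" for z
            using small that by (simp add: less_imp_le)
        qed (use z in simp)
        with e(2) show "dist (f n z) 0 < \<epsilon>" by simp
      qed
      then show ?thesis using R(1) by (intro exI[of _ "R / 2"]) simp
    qed
    have "\<forall>a\<in>U. \<exists>r. r > 0 \<and> (\<forall>\<^sub>F n in sequentially. \<forall>z\<in>ball a r. dist (f n z) 0 < \<epsilon>)"
      by (intro ballI) (rule local)
    from bchoice[OF this] obtain r where r:
      "\<forall>a\<in>U. r a > 0 \<and> (\<forall>\<^sub>F n in sequentially. \<forall>z\<in>ball a (r a). dist (f n z) 0 < \<epsilon>)" ..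
    have cov: "K \<subseteq> (\<Union>a\<in>K. ball a (r a))"
    proof
      fix a assume "a \<in> K"
      moreover from this have "a \<in> ball a (r a)" using r K(2) by auto
      ultimately show "a \<in> (\<Union>a\<in>K. ball a (r a))" by (rule UN_I)
    qed
    obtain F where F: "F \<subseteq> K" "finite F" "K \<subseteq> (\<Union>a\<in>F. ball a (r a))"
      by (rule compactE_image[OF K(1) open_ball cov])
    have "\<forall>\<^sub>F n in sequentially. \<forall>a\<in>F. \<forall>z\<in>ball a (r a). dist (f n z) 0 < \<epsilon>"
    proof (rule eventually_ball_finite[OF F(2)], rule ballI)
      fix a assume "a \<in> F"
      then have "a \<in> U" using F(1) K(2) by blast
      with r show "\<forall>\<^sub>F n in sequentially. \<forall>z\<in>ball a (r a). dist (f n z) 0 < \<epsilon>" by blast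
    qed
    then show "\<forall>\<^sub>F n in sequentially. \<forall>z\<in>K. dist (f n z) 0 < \<epsilon>"
      by (rule eventually_mono) (use F(3) in blast)
  qed
qed

theorem corollary2p7:
  fixes T S :: "'a::cbanach \<Rightarrow>\<^sub>C\<^sub>L 'a"
  assumes "decomposable T"
    and "S o\<^sub>C\<^sub>L T = T o\<^sub>C\<^sub>L S"
    and "quasinilpotent S \<or> compact_operator S \<or> has_discrete_spectrum S"
  shows "decomposable (T + S) \<and> property_delta (T + S)"
proof -
  have "finite (spectrum S - ball 0 d)" if "d > 0" for d
  proof -
    \<comment> \<open>The spectrum is compact, so discreteness makes it finite.\<close>
    have "finite (spectrum S)" if "has_discrete_spectrum S"
      using that compact_spectrum[of S] discrete_compact_finite_iff[of "spectrum S"]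
      by (simp add: has_discrete_spectrum_def)
    then show ?thesis
      using assms(3) quasinilpotent_finite_outer_spectrum[OF _ that, of S]
        compact_operator_finite_outer_spectrum[OF _ that, of S] by blast
  qed
  then have "decomposable (T + S)" by (rule decomposable_perturbation[OF assms(1,2)])
  then show ?thesis by (simp add: decomposable_imp_property_delta)
qed

end
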